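(* For every positive integer $n$, the cube complex $\widehat{D}_n$ has a finite degree cover, namely the cube complex $M_n$ (both defined in the context), which is a compact, special cube complex.
   Context: **Cube complexes.** A cube complex is a space obtained from a collection of cubes $[-1,1]^k$ of various dimensions $k$ by gluing cubes along faces via isometries. A midcube of a $k$-cube is the set of its points where one fixed coordinate is $0$. Take the disjoint union of all midcubes of a cube complex $X$ and glue them according to the gluings in $X$; a hyperplane is the image in $X$ of a connected component of the resulting space. A 1-cube is dual to the midcube containing its midpoint, and dual to the hyperplane containing that midcube. The link of a 0-cube $v$ has as vertices the directed 1-cubes originating from $v$, and a finite set of vertices spans a simplex if the corresponding directed 1-cubes span the corner of a cube. A complex is flag if every finite clique spans a simplex. $X$ is nonpositively curved (NPC) if every link is a flag simplicial complex. Given an oriented 1-cube $\vec\epsilon$ dual to a hyperplane $H$, orient the opposite 1-cube in each 2-cube containing it in the same direction, and continue to all 1-cubes dual to $H$; $H$ is two-sided if each dual 1-cube receives a unique orientation. Hyperplanes $H_1,H_2$ intersect if they have dual 1-cubes $\epsilon_1\neq\epsilon_2$, respectively, that meet at a 0-cube and form a corner of a 2-cube. They osculate if they have oriented dual 1-cubes $\vec\epsilon_1\ne\vec\epsilon_2$, respectively, originating from the same 0-cube but not forming a corner of a 2-cube. They inter-osculate if they both intersect and osculate. A hyperplane self-intersects (self-osculates) if it intersects (osculates with) itself. A cube complex is special if it is NPC, all hyperplanes are two-sided, no hyperplane self-intersects, no hyperplane self-osculates, and no two hyperplanes inter-osculate. **Forests.** A tree is a finite connected graph without cycles, with at least one edge,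 in which no vertex is contained in exactly 2 edges. All trees are rooted: one vertex of degree one is the root; the other vertices of degree one are the leaves (the root is not called a leaf). An edge $e$ at a vertex $v$ is descending at $v$ if every path from the root to $v$ contains $e$, and ascending at $v$ otherwise. A vertex $v$ lies above a vertex $v'$ (resp. an edge $e$) if all paths from $v$ to the root pass through $v'$ (resp. contain $e$). A planar tree is a rooted tree with a linear ordering of the ascending edges at each vertex. Write $[n]=\{1,\dots,n\}$. A planar forest labelled by $[n]$ is a sequence of planar trees having $n$ leaves in total, bijectively labelled by $[n]$ (considered up to isomorphism). An internal edge is an edge containing no leaf (equivalently, having at least two leaves above it); $E(\tau)$ is the set of internal edges of $\tau$. $PF_n(k)$ is the set of planar forests labelled by $[n]$ with exactly $k$ internal edges, and $PF_n=\bigcup_{k=0}^n PF_n(k)$. For $e\in E(\tau)$, ascending at $v_1$ and descending at $v_2$: the forest $r_e(\tau)$ is obtained by reversing the order of the ascending edges at every vertex equal to or above $v_2$. If $v_1$ is not a root, $d_e(\tau)$ is obtained by collapsing $e$ and inserting the ordered set of ascending edges at $v_2$ in place of $e$ into the ordered set of ascending edges at $v_1$. If $v_1$ is the root of the tree $\tau_i$ of $\tau=(\tau_1,\dots,\tau_m)$, $d_e(\tau)$ is obtained by replacing $\tau_i$ in the sequence by the trees obtained from deleting the closed edge $e$, one for each ascending edge at $v_2$, in that order, each given its own new root. Naturally $E(r_e(\tau))=E(\tau)$ and $E(d_e(\tau))=E(\tau)\setminus\{e\}$. **The complex $\widehat D_n$.** $\widehat D_n=\bigcup_{\tau\in PF_n}\{\tau\}\times[-1,1]^{E(\tau)}/\!\sim$,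 where $(\tau,(t,s))\sim(r_e(\tau),(t,-s))$, $(\tau,(t,1))\sim(d_e(\tau),t)$ for $e\in E(\tau)$, with $s$ (resp. $1$) the $e$-coordinate and $t$ the remaining coordinates, and $(\tau,t)\sim(\tau',t)$ whenever the sequence of trees $\tau'$ is a permutation of $\tau$. Equivalently, $\widehat D_n$ is obtained from the positive subcubes $\{\tau\}\times[0,1]^{E(\tau)}$ by $(\tau,(t,0))\sim(r_e(\tau),(t,0))$, $(\tau,(t,1))\sim(d_e(\tau),t)$, and the permutation identifications. **The complex $M_n$.** Let $L$ be the set of subsets of $[n]$ with at least two elements, so $|L|=2^n-n-1$. For $e\in E(\tau)$ let $\mathcal L(\tau,e)\in L$ be the set of labels of the leaves above $e$, and let $1_e\in(\mathbb Z/2\mathbb Z)^L$ be the vector whose only nonzero entry is in coordinate $\mathcal L(\tau,e)$. Define $$M_n=\bigcup_{\tau\in PF_n}\{\tau\}\times[0,1]^{E(\tau)}\times(\mathbb Z/2\mathbb Z)^L/\!\sim$$ with, for all $\tau$, $s$: $(\tau,(t,1),s)\sim(d_e(\tau),t,s)$; $(\tau,t,s)\sim(\tau',t,s)$ if $\tau'$ is a permutation of the trees of $\tau$; and $(\tau,(t,0),s)\sim(r_e(\tau),(t,0),s+1_e)$. The cubes of $M_n$ are the unions of all subcubes obtained from a given subcube labelled $(\tau,s)$ by repeatedly passing to $(r_e(\tau),s+1_e)$, $e\in E(\tau)$; such a union is identified with $[-1,1]^{E(\tau)}$, with $(\tau,s)$ corresponding to $[0,1]^{E(\tau)}$. The covering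 map is $(\tau,t,s)\mapsto(\tau,t)$. *)

theory Defs
  imports
    "HOL-Analysis.Analysis"
    "HOL-Library.Multiset"
    "HOL-Library.Z2"
begin

section \<open>Quotient spaces and coverings for abstract topologies\<close>

definition gen_equiv :: "'a set \<Rightarrow> 'a rel \<Rightarrow> 'a rel" where
  "gen_equiv A g = {(x, y). x \<in> A \<and> y \<in> A \<and> (x, y) \<in> (g \<union> g\<inverse>)\<^sup>*}"

definition gen_class :: "'a topology \<Rightarrow> 'a rel \<Rightarrow> 'a \<Rightarrow> 'a set" where
  "gen_class T g x = gen_equiv (topspace T) g `` {x}"

text \<open>The points of the quotient are the equivalence classes themselves.\<close>

definition quotient_space :: "'a topology \<Rightarrow> 'a rel \<Rightarrow> 'a set topology" where
  "quotient_space T g =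
     topology (\<lambda>U. U \<subseteq> topspace T // gen_equiv (topspace T) g \<and> openin T (\<Union>U))"

lemma equiv_gen_equiv: "equiv A (gen_equiv A g)"
proof (rule equivI)
  show "gen_equiv A g \<subseteq> A \<times> A" "refl_on A (gen_equiv A g)"
    by (auto simp: gen_equiv_def refl_on_def)
  have "sym ((g \<union> g\<inverse>)\<^sup>*)" by (intro sym_rtrancl) (auto simp: sym_def)
  then show "sym (gen_equiv A g)" by (auto simp: gen_equiv_def sym_def)
  show "trans (gen_equiv A g)" by (auto simp: gen_equiv_def trans_def)
qed

lemma istopology_quotient_space:
  "istopology (\<lambda>U. U \<subseteq> topspace T // gen_equiv (topspace T) g \<and> openin T (\<Union>U))"
proof -
  let ?Q = "topspace T // gen_equiv (topspace T) g"
  have "\<Union>(U \<inter> V) = \<Union>U \<inter> \<Union>V" if "U \<subseteq> ?Q" "V \<subseteq> ?Q" for U V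
  proof
    show "\<Union>U \<inter> \<Union>V \<subseteq> \<Union>(U \<inter> V)"
    proof
      fix x assume "x \<in> \<Union>U \<inter> \<Union>V"
      then obtain C D where CD: "C \<in> U" "D \<in> V" "x \<in> C" "x \<in> D" by blast
      then have "C = D"
        using quotient_disj[OF equiv_gen_equiv, of C "topspace T" g D] that by blast
      with CD show "x \<in> \<Union>(U \<inter> V)" by blast
    qed
  qed blast
  moreover have "openin T (\<Union>(\<Union>\<K>))" if "\<forall>U\<in>\<K>. U \<subseteq> ?Q \<and> openin T (\<Union>U)" for \<K>
  proof -
    have "\<Union>(\<Union>\<K>) = \<Union>(Union ` \<K>)" by blast
    with that show ?thesis by auto
  qed
  ultimately show ?thesis
    unfolding istopology_def by (simp add: Sup_le_iff le_infI1 openin_Int)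
qed

definition covering_map :: "'a topology \<Rightarrow> 'b topology \<Rightarrow> ('a \<Rightarrow> 'b) \<Rightarrow> bool" where
  "covering_map X Y p \<longleftrightarrow>
     continuous_map X Y p \<and> p ` topspace X = topspace Y \<and>
     (\<forall>y \<in> topspace Y. \<exists>U. openin Y U \<and> y \<in> U \<and>
        (\<exists>\<V>. \<Union>\<V> = {x \<in> topspace X. p x \<in> U} \<and> pairwise disjnt \<V> \<and>
             (\<forall>V \<in> \<V>. openin X V \<and>
                homeomorphic_map (subtopology X V) (subtopology Y U) p)))"

definition finite_degree_covering_map :: "'a topology \<Rightarrow> 'b topology \<Rightarrow> ('a \<Rightarrow> 'b) \<Rightarrow> bool" where
  "finite_degree_covering_map X Y p \<longleftrightarrow>
     covering_map X Y p \<and>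
     (\<exists>d>0. \<forall>y \<in> topspace Y. card {x \<in> topspace X. p x = y} = d)"


section \<open>Cubes\<close>

text \<open>
  The cube \<open>[-1,1]^E\<close> consists of extensional functions on the finite coordinate set \<open>E\<close>, and
  carries the Euclidean metric, given by \<^const>\<open>L2_set\<close>.
\<close>

definition cube :: "'c set \<Rightarrow> ('c \<Rightarrow> real) set" where
  "cube E = (\<Pi>\<^sub>E e\<in>E. {-1..1})"

definition cube_topology :: "'c set \<Rightarrow> ('c \<Rightarrow> real) topology" where
  "cube_topology E = product_topology (\<lambda>_. top_of_set {-1..1}) E"

definition corners :: "'c set \<Rightarrow> ('c \<Rightarrow> real) set" where
  "corners E = (\<Pi>\<^sub>E e\<in>E. {-1, 1})"

text \<open>The face through the corner \<open>v\<close> whose free coordinates are those in \<open>F\<close>.\<close>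

definition face :: "'c set \<Rightarrow> ('c \<Rightarrow> real) \<Rightarrow> 'c set \<Rightarrow> ('c \<Rightarrow> real) set" where
  "face E v F = {x \<in> cube E. \<forall>e \<in> E - F. x e = v e}"

definition is_face :: "'c set \<Rightarrow> ('c \<Rightarrow> real) set \<Rightarrow> bool" where
  "is_face E A \<longleftrightarrow> (\<exists>v \<in> corners E. \<exists>F \<subseteq> E. A = face E v F)"


section \<open>Cube complexes\<close>

text \<open>
  A space together with maps into it from a collection of cubes; the cube indexed by \<open>i\<close> is
  \<open>[-1,1]^(coords i)\<close>.
\<close>

record ('i, 'c, 'x) cubing =
  space_of :: "'x topology"
  cells :: "'i set"
  coords :: "'i \<Rightarrow> 'c set"
  chart :: "'i \<Rightarrow> ('c \<Rightarrow> real) \<Rightarrow> 'x"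

text \<open>
  The gluings of the complex: isometries \<open>h\<close> from a face \<open>A\<close> of the cube \<open>i\<close> onto a face \<open>B\<close> of the
  cube \<open>j\<close> that identify \<open>A\<close> with \<open>B\<close> in the space.
\<close>

definition gluing ::
  "('i, 'c, 'x) cubing \<Rightarrow> 'i \<Rightarrow> ('c \<Rightarrow> real) set \<Rightarrow> 'i \<Rightarrow> ('c \<Rightarrow> real) set \<Rightarrow>
     (('c \<Rightarrow> real) \<Rightarrow> ('c \<Rightarrow> real)) \<Rightarrow> bool" where
  "gluing K i A j B h \<longleftrightarrow>
     i \<in> cells K \<and> j \<in> cells K \<and> is_face (coords K i) A \<and> is_face (coords K j) B \<and>
     h ` A = B \<and>
     (\<forall>x\<in>A. \<forall>y\<in>A. L2_set (\<lambda>e. h x e - h y e) (coords K j) = L2_set (\<lambda>e. x e - y e) (coords K i)) \<and>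
     (\<forall>x\<in>A. chart K j (h x) = chart K i x)"

definition glue :: "('i, 'c, 'x) cubing \<Rightarrow> ('i \<times> ('c \<Rightarrow> real)) rel" where
  "glue K = {((i, x), (j, h x)) | i x j h A B. gluing K i A j B h \<and> x \<in> A}"

text \<open>
  The space is the quotient of the disjoint union of the cubes, and two points of this disjoint
  union are identified only as a result of gluing faces by isometries.
\<close>

definition cube_complex :: "('i, 'c, 'x) cubing \<Rightarrow> bool" where
  "cube_complex K \<longleftrightarrow>
     (\<forall>i \<in> cells K. finite (coords K i)) \<and>
     quotient_map (sum_topology (\<lambda>i. cube_topology (coords K i)) (cells K)) (space_of K)
       (\<lambda>(i, x). chart K i x) \<and>
     (\<forall>i \<in> cells K. \<forall>j \<in> cells K. \<forall>x \<in> cube (coords K i). \<forall>y \<in> cube (coords K j).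
        chart K i x = chart K j y \<longrightarrow> ((i, x), (j, y)) \<in> (glue K \<union> (glue K)\<inverse>)\<^sup>*)"


subsection \<open>Directed 1-cubes and links\<close>

text \<open>
  A directed 1-cube is represented by its parametrisation \<open>[-1,1] \<rightarrow> X\<close>, so that 1-cubes
  which are glued together are equal; it originates from its value at \<open>-1\<close>. The underlying
  (undirected) 1-cube is the image of this parametrisation. Faces of the cubes of the collection
  count as cubes of the complex.
\<close>

definition edge :: "('i, 'c, 'x) cubing \<Rightarrow> 'i \<Rightarrow> ('c \<Rightarrow> real) \<Rightarrow> 'c \<Rightarrow> real \<Rightarrow> 'x" where
  "edge K i v e = (\<lambda>u\<in>{-1..1}. chart K i (v(e := - u * v e)))"

definition edges :: "('i, 'c, 'x) cubing \<Rightarrow> (real \<Rightarrow> 'x) set" where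
  "edges K = {edge K i v e | i v e. i \<in> cells K \<and> v \<in> corners (coords K i) \<and> e \<in> coords K i}"

definition rev_edge :: "(real \<Rightarrow> 'x) \<Rightarrow> real \<Rightarrow> 'x" where
  "rev_edge \<gamma> = (\<lambda>u\<in>{-1..1}. \<gamma> (- u))"

definition origin :: "(real \<Rightarrow> 'x) \<Rightarrow> 'x" where
  "origin \<gamma> = \<gamma> (-1)"

definition underlying :: "(real \<Rightarrow> 'x) \<Rightarrow> 'x set" where
  "underlying \<gamma> = \<gamma> ` {-1..1}"

definition zero_cubes :: "('i, 'c, 'x) cubing \<Rightarrow> 'x set" where
  "zero_cubes K = {chart K i v | i v. i \<in> cells K \<and> v \<in> corners (coords K i)}"

text \<open>\<open>(i, v, F)\<close> is the corner at \<open>v\<close> of the face of the cube \<open>i\<close> with free coordinates \<open>F\<close>.\<close>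

definition cube_corner ::
  "('i, 'c, 'x) cubing \<Rightarrow> 'x \<Rightarrow> 'i \<Rightarrow> ('c \<Rightarrow> real) \<Rightarrow> 'c set \<Rightarrow> bool" where
  "cube_corner K x i v F \<longleftrightarrow>
     i \<in> cells K \<and> v \<in> corners (coords K i) \<and> F \<subseteq> coords K i \<and> chart K i v = x"

definition link_vertices :: "('i, 'c, 'x) cubing \<Rightarrow> 'x \<Rightarrow> (real \<Rightarrow> 'x) set" where
  "link_vertices K x = {\<gamma> \<in> edges K. origin \<gamma> = x}"

definition link_simplices :: "('i, 'c, 'x) cubing \<Rightarrow> 'x \<Rightarrow> (real \<Rightarrow> 'x) set set" where
  "link_simplices K x = {edge K i v ` F | i v F. cube_corner K x i v F}"

text \<open>
  The link is a simplicial complex if the corner of a \<open>k\<close>-cube has \<open>k\<close> distinct directed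
  1-cubes, and if corners with the same directed 1-cubes are the same corner in the complex, i.e.
  are identified by a gluing (this excludes loops and multiple simplices).
\<close>

definition link_simplicial :: "('i, 'c, 'x) cubing \<Rightarrow> 'x \<Rightarrow> bool" where
  "link_simplicial K x \<longleftrightarrow>
     (\<forall>i v F. cube_corner K x i v F \<longrightarrow> inj_on (edge K i v) F) \<and>
     (\<forall>i v F j w G. cube_corner K x i v F \<longrightarrow> cube_corner K x j w G \<longrightarrow>
        edge K i v ` F = edge K j w ` G \<longrightarrow>
        (\<exists>h. gluing K i (face (coords K i) v F) j (face (coords K j) w G) h \<and> h v = w))"

definition link_flag :: "('i, 'c, 'x) cubing \<Rightarrow> 'x \<Rightarrow> bool" where
  "link_flag K x \<longleftrightarrow>
     (\<forall>S. finite S \<and> S \<subseteq> link_vertices K x \<and>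
          (\<forall>a\<in>S. \<forall>b\<in>S. a \<noteq> b \<longrightarrow> {a, b} \<in> link_simplices K x)
        \<longrightarrow> S \<in> link_simplices K x)"

definition nonpositively_curved :: "('i, 'c, 'x) cubing \<Rightarrow> bool" where
  "nonpositively_curved K \<longleftrightarrow> (\<forall>x \<in> zero_cubes K. link_simplicial K x \<and> link_flag K x)"


subsection \<open>Hyperplanes\<close>

text \<open>
  The midcube \<open>(i, e)\<close> is \<open>{x \<in> [-1,1]^(coords i). x e = 0}\<close>. A gluing \<open>h\<close> from \<open>A\<close> to \<open>B\<close>
  glues the face \<open>{x \<in> A. x e = 0}\<close> of \<open>(i, e)\<close> to the face \<open>{y \<in> B. y f = 0}\<close> of \<open>(j, f)\<close> if it
  maps the one onto the other.
\<close>

definition midcube_sum ::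
  "('i, 'c, 'x) cubing \<Rightarrow> (('i \<times> 'c) \<times> ('c \<Rightarrow> real)) topology" where
  "midcube_sum K =
     sum_topology (\<lambda>(i, e). subtopology (cube_topology (coords K i)) {x. x e = 0})
       (SIGMA i : cells K. coords K i)"

definition midcube_glue ::
  "('i, 'c, 'x) cubing \<Rightarrow> (('i \<times> 'c) \<times> ('c \<Rightarrow> real)) rel" where
  "midcube_glue K =
     {(((i, e), x), ((j, f), h x)) | i e x j f h A B.
        gluing K i A j B h \<and> e \<in> coords K i \<and> f \<in> coords K j \<and> x \<in> A \<and> x e = 0 \<and>
        h ` {z \<in> A. z e = 0} = {z \<in> B. z f = 0}}"

definition hyperplanes :: "('i, 'c, 'x) cubing \<Rightarrow> 'x set set" where
  "hyperplanes K =
     {{chart K i x | i e x. ((i, e), x) \<in> \<Union>C} | C.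
        C \<in> connected_components_of (quotient_space (midcube_sum K) (midcube_glue K))}"

text \<open>The midcubes containing the midpoint \<open>\<gamma> 0\<close> of a 1-cube all lie in a single hyperplane.\<close>

definition dual :: "('i, 'c, 'x) cubing \<Rightarrow> (real \<Rightarrow> 'x) \<Rightarrow> 'x set \<Rightarrow> bool" where
  "dual K \<gamma> H \<longleftrightarrow> \<gamma> \<in> edges K \<and> \<gamma> 0 \<in> H"

text \<open>Pairs of opposite 1-cubes of a 2-cube, directed in the same direction.\<close>

definition opposite :: "('i, 'c, 'x) cubing \<Rightarrow> (real \<Rightarrow> 'x) rel" where
  "opposite K =
     {(edge K i v e, edge K i (v(f := - v f)) e) | i v e f.
        i \<in> cells K \<and> v \<in> corners (coords K i) \<and> e \<in> coords K i \<and> f \<in> coords K i \<and> e \<noteq> f}"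

text \<open>Starting from any oriented dual 1-cube, each dual 1-cube receives exactly one orientation.\<close>

definition two_sided :: "('i, 'c, 'x) cubing \<Rightarrow> 'x set \<Rightarrow> bool" where
  "two_sided K H \<longleftrightarrow>
     (\<forall>\<gamma> \<delta>. dual K \<gamma> H \<longrightarrow> dual K \<delta> H \<longrightarrow>
        ((\<gamma>, \<delta>) \<in> (opposite K)\<^sup>*) \<noteq> ((\<gamma>, rev_edge \<delta>) \<in> (opposite K)\<^sup>*))"

definition square_corner :: "('i, 'c, 'x) cubing \<Rightarrow> (real \<Rightarrow> 'x) \<Rightarrow> (real \<Rightarrow> 'x) \<Rightarrow> bool" where
  "square_corner K \<gamma> \<delta> \<longleftrightarrow>
     (\<exists>i v e f. i \<in> cells K \<and> v \<in> corners (coords K i) \<and> e \<in> coords K i \<and> f \<in> coords K i \<and>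
        e \<noteq> f \<and> \<gamma> = edge K i v e \<and> \<delta> = edge K i v f)"

definition intersect :: "('i, 'c, 'x) cubing \<Rightarrow> 'x set \<Rightarrow> 'x set \<Rightarrow> bool" where
  "intersect K H\<^sub>1 H\<^sub>2 \<longleftrightarrow>
     (\<exists>\<gamma> \<delta>. dual K \<gamma> H\<^sub>1 \<and> dual K \<delta> H\<^sub>2 \<and> underlying \<gamma> \<noteq> underlying \<delta> \<and> square_corner K \<gamma> \<delta>)"

definition osculate :: "('i, 'c, 'x) cubing \<Rightarrow> 'x set \<Rightarrow> 'x set \<Rightarrow> bool" where
  "osculate K H\<^sub>1 H\<^sub>2 \<longleftrightarrow>
     (\<exists>\<gamma> \<delta>. dual K \<gamma> H\<^sub>1 \<and> dual K \<delta> H\<^sub>2 \<and> \<gamma> \<noteq> \<delta> \<and> origin \<gamma> = origin \<delta> \<and> \<not> square_corner K \<gamma> \<delta>)"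

definition special :: "('i, 'c, 'x) cubing \<Rightarrow> bool" where
  "special K \<longleftrightarrow>
     cube_complex K \<and> nonpositively_curved K \<and>
     (\<forall>H \<in> hyperplanes K. two_sided K H \<and> \<not> intersect K H H \<and> \<not> osculate K H H) \<and>
     (\<forall>H\<^sub>1 \<in> hyperplanes K. \<forall>H\<^sub>2 \<in> hyperplanes K. H\<^sub>1 \<noteq> H\<^sub>2 \<longrightarrow>
        \<not> (intersect K H\<^sub>1 H\<^sub>2 \<and> osculate K H\<^sub>1 H\<^sub>2))"


section \<open>Planar forests\<close>

text \<open>
  A planar rooted tree up to isomorphism is recorded by what lies above the edge at its root:
  either a leaf with its label, or a vertex with the ordered list of what lies above its ascending
  edges. The same applies to what lies above any edge, so the edges of a tree correspond to its
  subtrees (the edge just below the subtree; the whole tree corresponds to the edge at the root),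
  and the internal edges to the subtrees of the form \<open>Node ts\<close>.
\<close>

datatype ptree = Leaf nat | Node "ptree list"

fun leaf_list :: "ptree \<Rightarrow> nat list" where
  "leaf_list (Leaf i) = [i]"
| "leaf_list (Node ts) = concat (map leaf_list ts)"

abbreviation leaves :: "ptree \<Rightarrow> nat set" where
  "leaves t \<equiv> set (leaf_list t)"

fun subtrees :: "ptree \<Rightarrow> ptree set" where
  "subtrees (Leaf i) = {Leaf i}"
| "subtrees (Node ts) = insert (Node ts) (\<Union>t\<in>set ts. subtrees t)"

text \<open>
  An internal edge is named by the set \<open>\<L>(\<tau>, e)\<close> of labels of the leaves above it, which
  determines it since no vertex lies on exactly two edges and labels are distinct. Under this
  naming \<open>\<L>(\<tau>, e)\<close> is \<open>e\<close> itself, and the natural identifications \<open>E(r\<^sub>e(\<tau>)) = E(\<tau>)\<close> and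
  \<open>E(d\<^sub>e(\<tau>)) = E(\<tau>) - {e}\<close> are equalities of sets.
\<close>

definition internal_edges :: "ptree list \<Rightarrow> nat set set" where
  "internal_edges \<tau> = {leaves (Node ts) | ts. Node ts \<in> (\<Union>t\<in>set \<tau>. subtrees t)}"

definition PF_k :: "nat \<Rightarrow> nat \<Rightarrow> ptree list set" where
  "PF_k n k = {\<tau>.
     (\<forall>t\<in>set \<tau>. \<forall>ts. Node ts \<in> subtrees t \<longrightarrow> 2 \<le> length ts) \<and>
     distinct (concat (map leaf_list \<tau>)) \<and> set (concat (map leaf_list \<tau>)) = {1..n} \<and>
     card (internal_edges \<tau>) = k}"

definition PF :: "nat \<Rightarrow> ptree list set" where
  "PF n = (\<Union>k\<le>n. PF_k n k)"

fun mirror :: "ptree \<Rightarrow> ptree" where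
  "mirror (Leaf i) = Leaf i"
| "mirror (Node ts) = Node (rev (map mirror ts))"

fun reverse_tree :: "nat set \<Rightarrow> ptree \<Rightarrow> ptree" where
  "reverse_tree e (Leaf i) = Leaf i"
| "reverse_tree e (Node ts) =
     (if leaves (Node ts) = e then mirror (Node ts) else Node (map (reverse_tree e) ts))"

definition reverse :: "nat set \<Rightarrow> ptree list \<Rightarrow> ptree list" where
  "reverse e \<tau> = map (reverse_tree e) \<tau>"

text \<open>
  Both cases of \<open>d\<^sub>e\<close> replace, in a list of trees, the tree above \<open>e\<close> by the list of trees above its
  ascending edges; the list is that of the ascending edges at a vertex or the forest itself.
\<close>

fun collapse_tree :: "nat set \<Rightarrow> ptree \<Rightarrow> ptree list" where
  "collapse_tree e (Leaf i) = [Leaf i]"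
| "collapse_tree e (Node ts) =
     (if leaves (Node ts) = e then ts else [Node (concat (map (collapse_tree e) ts))])"

definition collapse :: "nat set \<Rightarrow> ptree list \<Rightarrow> ptree list" where
  "collapse e \<tau> = concat (map (collapse_tree e) \<tau>)"

text \<open>The composition of all \<open>r\<^sub>e\<close>, \<open>e \<in> N\<close>; these commute by the lemma below.\<close>

definition reverse_all :: "nat set set \<Rightarrow> ptree list \<Rightarrow> ptree list" where
  "reverse_all N \<tau> = Finite_Set.fold reverse \<tau> N"

lemma leaves_mirror: "leaves (mirror t) = leaves t"
  by (induction t) auto

lemma leaves_reverse_tree: "leaves (reverse_tree e t) = leaves t"
proof (induction t)
  case (Node ts)
  then show ?case using leaves_mirror[of "Node ts"] by auto
qed auto

lemma mirror_mirror: "mirror (mirror t) = t"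
  by (induction t) (auto simp: rev_map map_idI)

lemma reverse_tree_mirror: "reverse_tree e (mirror t) = mirror (reverse_tree e t)"
proof (induction t)
  case (Node ts)
  then show ?case
    using leaves_mirror[of "Node ts"] mirror_mirror by (auto simp: rev_map)
qed auto

lemma reverse_tree_root: "leaves t = e \<Longrightarrow> reverse_tree e t = mirror t"
  by (cases t) auto

lemma reverse_tree_commute:
  "reverse_tree e (reverse_tree f t) = reverse_tree f (reverse_tree e t)"
proof (induction t)
  case (Node ts)
  let ?t = "Node ts"
  consider "leaves ?t = e" | "leaves ?t = f" | "leaves ?t \<noteq> e" "leaves ?t \<noteq> f" by blast
  then show ?case
  proof cases
    case 1
    then show ?thesis
      using reverse_tree_root[of ?t e] reverse_tree_root[of "reverse_tree f ?t" e]
        leaves_reverse_tree[of f ?t] reverse_tree_mirror[of f ?t] by simp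
  next
    case 2
    then show ?thesis
      using reverse_tree_root[of ?t f] reverse_tree_root[of "reverse_tree e ?t" f]
        leaves_reverse_tree[of e ?t] reverse_tree_mirror[of e ?t] by simp
  next
    case 3
    then show ?thesis
      using Node leaves_reverse_tree by auto
  qed
qed auto

lemma comp_fun_commute_reverse: "comp_fun_commute reverse"
  by standard (auto simp: reverse_def reverse_tree_commute fun_eq_iff)


section \<open>The complexes\<close>

definition Dhat_sum :: "nat \<Rightarrow> (ptree list \<times> (nat set \<Rightarrow> real)) topology" where
  "Dhat_sum n = sum_topology (\<lambda>\<tau>. cube_topology (internal_edges \<tau>)) (PF n)"

definition Dhat_glue :: "nat \<Rightarrow> (ptree list \<times> (nat set \<Rightarrow> real)) rel" where
  "Dhat_glue n =
     {((\<tau>, t), (reverse e \<tau>, t(e := - t e))) | \<tau> t e.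
        \<tau> \<in> PF n \<and> t \<in> cube (internal_edges \<tau>) \<and> e \<in> internal_edges \<tau>} \<union>
     {((\<tau>, t), (collapse e \<tau>, restrict t (internal_edges \<tau> - {e}))) | \<tau> t e.
        \<tau> \<in> PF n \<and> t \<in> cube (internal_edges \<tau>) \<and> e \<in> internal_edges \<tau> \<and> t e = 1} \<union>
     {((\<tau>, t), (\<tau>', t)) | \<tau> \<tau>' t.
        \<tau> \<in> PF n \<and> t \<in> cube (internal_edges \<tau>) \<and> mset \<tau>' = mset \<tau>}"

definition Dhat_pt :: "nat \<Rightarrow> ptree list \<Rightarrow> (nat set \<Rightarrow> real) \<Rightarrow> (ptree list \<times> (nat set \<Rightarrow> real)) set"
  where "Dhat_pt n \<tau> t = gen_class (Dhat_sum n) (Dhat_glue n) (\<tau>, t)"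

definition Dhat ::
  "nat \<Rightarrow> (ptree list, nat set, (ptree list \<times> (nat set \<Rightarrow> real)) set) cubing" where
  "Dhat n = \<lparr>
     space_of = quotient_space (Dhat_sum n) (Dhat_glue n),
     cells = PF n,
     coords = internal_edges,
     chart = Dhat_pt n\<rparr>"

definition Lsets :: "nat \<Rightarrow> nat set set" where
  "Lsets n = {S. S \<subseteq> {1..n} \<and> 2 \<le> card S}"

text \<open>\<open>(\<int>/2\<int>)^L\<close>, as extensional functions.\<close>

definition Z2L :: "nat \<Rightarrow> (nat set \<Rightarrow> bit) set" where
  "Z2L n = (\<Pi>\<^sub>E S\<in>Lsets n. UNIV)"

definition pos_cube :: "'c set \<Rightarrow> ('c \<Rightarrow> real) set" where
  "pos_cube E = (\<Pi>\<^sub>E e\<in>E. {0..1})"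

type_synonym M_index = "ptree list \<times> (nat set \<Rightarrow> bit)"

definition M_sum :: "nat \<Rightarrow> (M_index \<times> (nat set \<Rightarrow> real)) topology" where
  "M_sum n =
     sum_topology (\<lambda>(\<tau>, s). subtopology (cube_topology (internal_edges \<tau>)) (pos_cube (internal_edges \<tau>)))
       (PF n \<times> Z2L n)"

definition M_glue :: "nat \<Rightarrow> (M_index \<times> (nat set \<Rightarrow> real)) rel" where
  "M_glue n =
     {(((\<tau>, s), t), ((collapse e \<tau>, s), restrict t (internal_edges \<tau> - {e}))) | \<tau> s t e.
        \<tau> \<in> PF n \<and> s \<in> Z2L n \<and> t \<in> pos_cube (internal_edges \<tau>) \<and> e \<in> internal_edges \<tau> \<and> t e = 1} \<union>
     {(((\<tau>, s), t), ((\<tau>', s), t)) | \<tau> \<tau>' s t.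
        \<tau> \<in> PF n \<and> s \<in> Z2L n \<and> t \<in> pos_cube (internal_edges \<tau>) \<and> mset \<tau>' = mset \<tau>} \<union>
     {(((\<tau>, s), t), ((reverse e \<tau>, s(e := s e + 1)), t)) | \<tau> s t e.
        \<tau> \<in> PF n \<and> s \<in> Z2L n \<and> t \<in> pos_cube (internal_edges \<tau>) \<and> e \<in> internal_edges \<tau> \<and> t e = 0}"

definition M_pt ::
  "nat \<Rightarrow> ptree list \<Rightarrow> (nat set \<Rightarrow> bit) \<Rightarrow> (nat set \<Rightarrow> real) \<Rightarrow> (M_index \<times> (nat set \<Rightarrow> real)) set" where
  "M_pt n \<tau> s t = gen_class (M_sum n) (M_glue n) ((\<tau>, s), t)"

text \<open>
  The cube of \<open>(\<tau>, s)\<close> is assembled from \<open>2^|E(\<tau>)|\<close> positive subcubes: the orthant of \<open>[-1,1]^E(\<tau>)\<close>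
  whose negative coordinates are those in \<open>N\<close> is the subcube obtained from \<open>(\<tau>, s)\<close> by passing
  to \<open>(r\<^sub>e(\<tau>), s + 1\<^sub>e)\<close> for all \<open>e \<in> N\<close>.
\<close>

definition M_chart ::
  "nat \<Rightarrow> M_index \<Rightarrow> (nat set \<Rightarrow> real) \<Rightarrow> (M_index \<times> (nat set \<Rightarrow> real)) set" where
  "M_chart n = (\<lambda>(\<tau>, s) t.
     let N = {e \<in> internal_edges \<tau>. t e < 0} in
     M_pt n (reverse_all N \<tau>) (\<lambda>S\<in>Lsets n. s S + of_bool (S \<in> N)) (\<lambda>e\<in>internal_edges \<tau>. \<bar>t e\<bar>))"

definition M_cx ::
  "nat \<Rightarrow> (M_index, nat set, (M_index \<times> (nat set \<Rightarrow> real)) set) cubing" where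
  "M_cx n = \<lparr>
     space_of = quotient_space (M_sum n) (M_glue n),
     cells = PF n \<times> Z2L n,
     coords = (\<lambda>(\<tau>, s). internal_edges \<tau>),
     chart = M_chart n\<rparr>"

end

theory Submission
  imports Defs
begin

text \<open>
  Everything rests on invariants of a point \<open>(\<tau>, t, s)\<close> of \<open>M_n\<close>. Its position in \<open>[-1,1]^L\<close> has the
  coordinate \<open>(-1)^(s_T) t_T\<close> if \<open>T\<close> is an internal edge of \<open>\<tau>\<close>, and \<open>(-1)^(s_T)\<close> otherwise. For leaves \<open>a\<close>, \<open>b\<close> above
  a common internal edge whose coordinate is not \<open>\<plusminus>1\<close>, the bit \<open>[a before b] + \<Sum>{s_T | a, b \<in> T}\<close> does not change
  under the gluings either, since \<open>r_e\<close> swaps the order of \<open>a\<close> and \<open>b\<close> precisely if both lie above \<open>e\<close>.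
  A forest is determined up to permutation of its trees by its internal edges and the order of the leaves above
  each of them, so these invariants determine the point. This describes the vertices of \<open>M_n\<close> as the elements of
  \<open>(\<int>/2)^L\<close> and the directed 1-cubes at a vertex as the linearly ordered subsets of \<open>[n]\<close> with at least two
  elements; a set of these spans a cube if and only if any two are disjoint or one is an interval of the other.

  A hyperplane has a label \<open>e \<in> L\<close>; along it the bits of pairs in \<open>e\<close> and the coordinates \<open>s_T\<close> for \<open>T\<close> crossing \<open>e\<close>
  are constant, while \<open>s_e\<close> distinguishes its two sides. Hence it neither intersects nor osculates with itself.
  If two hyperplanes labelled \<open>e \<subset> f\<close> intersect and have dual 1-cubes at another common vertex, the two invariants
  show that there, too, \<open>e\<close> is an interval of \<open>f\<close>, so that they do not osculate. Finally \<open>(\<int>/2)^L\<close> acts on \<open>M_n\<close> by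
  translation of \<open>s\<close>, freely and with quotient the complex of forests.
\<close>

section \<open>The order of the entries of a list\<close>

text \<open>Neither the order of the leaves nor the bits alone survive the gluings, which is why the
  two are combined. The bits are summed over all \<open>T\<close> in \<open>L\<close>, not only over
  the edges of the forest, so that collapsing an edge changes nothing. The order of two leaves in
  different trees can be permuted away; it carries information only while some edge above both has a
  coordinate strictly between -1 and 1, since at 1 (or at -1, after a reversal) this edge can be
  collapsed. Hence the restriction on the pairs. Both invariants are unchanged if \<open>t_e\<close>
  becomes \<open>-t_e\<close>, \<open>s_e\<close> becomes \<open>s_e + 1\<close> and the forest is
  reversed at \<open>e\<close>. They can therefore be evaluated on the assembled cubes themselves,
  and every identification of points or of 1-cubes becomes an equality of invariants. Connectedness
  of a hyperplane enters only through the principle that a property of midcubes preserved by the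
  gluings is clopen. That pairwise compatible edges span a cube rests on a construction of forests:
  a laminar family of ordered leaf sets, each of them an interval with the induced order in every
  larger one, comes from a forest.\<close>

fun before :: "'a list \<Rightarrow> 'a \<Rightarrow> 'a \<Rightarrow> bool" where
  "before [] i j \<longleftrightarrow> False"
| "before (x # xs) i j \<longleftrightarrow> x = i \<and> j \<in> set xs \<or> before xs i j"

lemma before_in_set: "before xs i j \<Longrightarrow> i \<in> set xs \<and> j \<in> set xs"
  by (induction xs) auto

lemma before_append:
  "before (xs @ ys) i j \<longleftrightarrow> before xs i j \<or> before ys i j \<or> i \<in> set xs \<and> j \<in> set ys"
  by (induction xs) auto

lemma before_rev: "before (rev xs) i j \<longleftrightarrow> before xs j i"
  by (induction xs) (auto simp: before_append)

lemma before_filter: "before (filter P xs) i j \<longleftrightarrow> before xs i j \<and> P i \<and> P j"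
  by (induction xs) (auto dest: before_in_set)

lemma before_asym: "distinct xs \<Longrightarrow> before xs i j \<Longrightarrow> \<not> before xs j i"
  by (induction xs) (auto dest: before_in_set)

lemma before_total: "i \<in> set xs \<Longrightarrow> j \<in> set xs \<Longrightarrow> i \<noteq> j \<Longrightarrow> before xs i j \<or> before xs j i"
  by (induction xs) auto

lemma before_swap:
  "distinct xs \<Longrightarrow> i \<in> set xs \<Longrightarrow> j \<in> set xs \<Longrightarrow> i \<noteq> j \<Longrightarrow> before xs j i \<longleftrightarrow> \<not> before xs i j"
  using before_asym before_total by metis

text \<open>If the heads differed, each would precede the other in its own list; so they agree, and
  the tails are compared by induction.\<close>

lemma list_eq_if_before_eq:
  assumes "distinct xs" "distinct ys" "set xs = set ys"
    and "\<And>i j. i \<in> set xs \<Longrightarrow> j \<in> set xs \<Longrightarrow> before xs i j \<longleftrightarrow> before ys i j"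
  shows "xs = ys"
  using assms
proof (induction xs arbitrary: ys)
  case (Cons x xs)
  then obtain y zs where ys: "ys = y # zs" by (cases ys) auto
  have "x = y"
  proof (rule ccontr)
    assume "x \<noteq> y"
    then have "before (x # xs) x y" "before ys y x" using Cons.prems(3) ys by auto
    then show False using Cons.prems before_asym[of ys] ys
      by (metis list.set_intros(1))
  qed
  moreover have "xs = zs"
  proof (rule Cons.IH)
    show s: "set xs = set zs" using Cons.prems ys \<open>x = y\<close> by (auto simp: insert_ident)
    fix i j assume "i \<in> set xs" "j \<in> set xs"
    then show "before xs i j \<longleftrightarrow> before zs i j"
      using Cons.prems(4)[of i j] Cons.prems(1,2) ys \<open>x = y\<close> by auto
  qed (use Cons.prems ys in auto)
  ultimately show ?case using ys by simp
qed simp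

text \<open>Once an entry outside \<open>P\<close> has occurred, no entry in \<open>P\<close> may
  follow, so the entries in \<open>P\<close> form an initial segment. In
  \<open>arrange_forest\<close> this cuts the leaves of one tree off a word.\<close>

lemma filter_split_if_not_before:
  assumes "\<And>a k. P a \<Longrightarrow> \<not> P k \<Longrightarrow> \<not> before xs k a"
  shows "xs = filter P xs @ filter (\<lambda>a. \<not> P a) xs"
  using assms
proof (induction xs)
  case (Cons x xs)
  then have *: "xs = filter P xs @ filter (\<lambda>a. \<not> P a) xs" by force
  show ?case
  proof (cases "P x")
    case True then show ?thesis using * by simp
  next
    case False
    have "\<not> P a" if "a \<in> set xs" for a
      using Cons.prems[of a x] False that by auto
    with False show ?thesis by (simp add: filter_empty_conv)
  qed
qed simp

section \<open>Forests\<close>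

definition flat :: "ptree list \<Rightarrow> nat list" where
  "flat \<tau> = concat (map leaf_list \<tau>)"

text \<open>A node with one ascending edge would be a vertex on exactly two edges; a node with none
  would be an unlabelled leaf.\<close>

definition branching :: "ptree list \<Rightarrow> bool" where
  "branching \<tau> \<longleftrightarrow> (\<forall>t\<in>set \<tau>. \<forall>ts. Node ts \<in> subtrees t \<longrightarrow> 2 \<le> length ts)"

text \<open>What lies above the root edge of \<open>Node ts\<close> is again a forest,
  \<open>ts\<close>. Passing to it keeps every induction at the level of forests and avoids a
  simultaneous induction on trees and lists of trees; the total size decreases.\<close>

lemma forest_induct [case_names Nil Leaf Node]:
  assumes "P []" "\<And>i \<tau>. P \<tau> \<Longrightarrow> P (Leaf i # \<tau>)"
    and "\<And>ts \<tau>. P ts \<Longrightarrow> P \<tau> \<Longrightarrow> P (Node ts # \<tau>)"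
  shows "P \<tau>"
proof (induction "size_list size \<tau>" arbitrary: \<tau> rule: less_induct)
  case less
  show ?case
  proof (cases \<tau>)
    case (Cons t \<sigma>)
    then have "P \<sigma>" using less by simp
    then show ?thesis using Cons less assms(2,3) by (cases t) auto
  qed (use assms in simp)
qed

lemma flat_simps [simp]:
  "flat [] = []" "flat (Leaf i # \<tau>) = i # flat \<tau>" "flat (Node ts # \<tau>) = flat ts @ flat \<tau>"
  by (auto simp: flat_def)

lemma flat_append [simp]: "flat (\<tau> @ \<sigma>) = flat \<tau> @ flat \<sigma>"
  by (simp add: flat_def)

lemma leaf_list_eq_flat: "leaf_list t = flat [t]"
  by (simp add: flat_def)

lemma flat_Cons: "flat (t # \<tau>) = leaf_list t @ flat \<tau>"
  by (simp add: flat_def)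

lemma set_flat: "set (flat \<tau>) = (\<Union>t\<in>set \<tau>. leaves t)"
  by (simp add: flat_def)

lemma branching_simps [simp]:
  "branching []" "branching (Leaf i # \<tau>) \<longleftrightarrow> branching \<tau>"
  "branching (Node ts # \<tau>) \<longleftrightarrow> 2 \<le> length ts \<and> branching ts \<and> branching \<tau>"
  by (auto simp: branching_def)

lemma branching_append [simp]: "branching (\<tau> @ \<sigma>) \<longleftrightarrow> branching \<tau> \<and> branching \<sigma>"
  by (auto simp: branching_def)

lemma branching_set: "branching \<tau> \<longleftrightarrow> (\<forall>t\<in>set \<tau>. branching [t])"
  by (auto simp: branching_def)

lemma internal_edges_append [simp]:
  "internal_edges (\<tau> @ \<sigma>) = internal_edges \<tau> \<union> internal_edges \<sigma>"
  by (auto simp: internal_edges_def)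

lemma internal_edges_simps [simp]:
  "internal_edges [] = {}" "internal_edges (Leaf i # \<tau>) = internal_edges \<tau>"
  "internal_edges (Node ts # \<tau>) = insert (set (flat ts)) (internal_edges ts \<union> internal_edges \<tau>)"
proof -
  show "internal_edges [] = {}" "internal_edges (Leaf i # \<tau>) = internal_edges \<tau>"
    by (auto simp: internal_edges_def)
  have "leaves (Node ts) = set (flat ts)" by (simp add: flat_def)
  then show "internal_edges (Node ts # \<tau>) = insert (set (flat ts)) (internal_edges ts \<union> internal_edges \<tau>)"
    unfolding internal_edges_def by auto
qed

lemma internal_edges_set: "internal_edges \<tau> = (\<Union>t\<in>set \<tau>. internal_edges [t])"
  by (auto simp: internal_edges_def)

lemma collapse_simps [simp]:
  "collapse e [] = []" "collapse e (Leaf i # \<tau>) = Leaf i # collapse e \<tau>"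
  "collapse e (Node ts # \<tau>) =
     (if set (flat ts) = e then ts else [Node (collapse e ts)]) @ collapse e \<tau>"
  by (auto simp: collapse_def flat_def)

lemma reverse_simps [simp]:
  "reverse e [] = []" "reverse e (Leaf i # \<tau>) = Leaf i # reverse e \<tau>"
  "reverse e (Node ts # \<tau>) =
     (if set (flat ts) = e then Node (rev (map mirror ts)) else Node (reverse e ts)) # reverse e \<tau>"
  by (auto simp: reverse_def flat_def)

lemma finite_internal_edges [simp]: "finite (internal_edges \<tau>)"
  by (induction \<tau> rule: forest_induct) auto

lemma internal_edge_subset: "e \<in> internal_edges \<tau> \<Longrightarrow> e \<subseteq> set (flat \<tau>)"
  by (induction \<tau> rule: forest_induct) auto

lemma flat_eq_Nil: "branching \<tau> \<Longrightarrow> flat \<tau> = [] \<longleftrightarrow> \<tau> = []"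
  by (induction \<tau> rule: forest_induct) auto

lemma length_le_flat: "branching \<tau> \<Longrightarrow> length \<tau> \<le> length (flat \<tau>)"
proof (induction \<tau> rule: forest_induct)
  case (Node ts \<tau>) then show ?case by simp
qed auto

lemma two_le_card_internal_edge:
  assumes "branching \<tau>" "distinct (flat \<tau>)" "e \<in> internal_edges \<tau>"
  shows "2 \<le> card e"
  using assms
proof (induction \<tau> rule: forest_induct)
  case (Node ts \<tau>)
  then show ?case
    using length_le_flat[of ts] distinct_card[of "flat ts"] by auto
qed auto

lemma internal_edge_nonempty:
  "branching \<tau> \<Longrightarrow> distinct (flat \<tau>) \<Longrightarrow> e \<in> internal_edges \<tau> \<Longrightarrow> e \<noteq> {}"
  using two_le_card_internal_edge by force

text \<open>An internal edge lies in a single tree of \<open>ts\<close>. If it had all leaves above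
  it, the other trees would have no leaves; but there is another tree, and every branching tree has
  a leaf. This is what allows edges to be named by their leaf sets.\<close>

lemma set_flat_notin_internal_edges:
  assumes "branching ts" "distinct (flat ts)" "2 \<le> length ts"
  shows "set (flat ts) \<notin> internal_edges ts"
proof
  assume "set (flat ts) \<in> internal_edges ts"
  then obtain t where t: "t \<in> set ts" "set (flat ts) \<in> internal_edges [t]"
    using internal_edges_set by blast
  then obtain us vs where ts: "ts = us @ t # vs" by (meson split_list)
  have "set (flat ts) \<subseteq> leaves t"
    using internal_edge_subset[OF t(2)] by (simp add: leaf_list_eq_flat)
  moreover have "set (flat us) \<inter> leaves t = {}" "leaves t \<inter> set (flat vs) = {}"
    using assms(2) ts by (auto simp: flat_Cons)
  moreover have "set (flat us) \<subseteq> set (flat ts)" "set (flat vs) \<subseteq> set (flat ts)"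
    using ts by (auto simp: flat_Cons)
  ultimately have "set (flat us) = {}" "set (flat vs) = {}"
    by (metis Int_absorb1 Int_absorb2 subset_trans)+
  then have "us = []" "vs = []"
    using ts assms(1) flat_eq_Nil[of us] flat_eq_Nil[of vs] branching_set[of ts] branching_set[of us]
      branching_set[of vs] by auto
  then show False using ts assms(3) by simp
qed

lemma disjoint_internal_edges:
  assumes "distinct (flat \<tau> @ flat \<sigma>)" "branching \<tau>" "e \<in> internal_edges \<tau>"
  shows "e \<notin> internal_edges \<sigma>"
proof
  assume "e \<in> internal_edges \<sigma>"
  then have "e \<subseteq> set (flat \<tau>) \<inter> set (flat \<sigma>)"
    using assms(3) internal_edge_subset by blast
  then show False using assms internal_edge_nonempty[of \<tau> e] by auto
qed

section \<open>Collapsing and reversing an edge\<close>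

lemma flat_collapse [simp]: "flat (collapse e \<tau>) = flat \<tau>"
  by (induction \<tau> rule: forest_induct) auto

lemma length_collapse: "branching \<tau> \<Longrightarrow> length \<tau> \<le> length (collapse e \<tau>)"
  by (induction \<tau> rule: forest_induct) auto

lemma branching_collapse: "branching \<tau> \<Longrightarrow> branching (collapse e \<tau>)"
proof (induction \<tau> rule: forest_induct)
  case (Node ts \<tau>) then show ?case using length_collapse[of ts e] by auto
qed auto

text \<open>Removing one node removes the name \<open>e\<close> altogether because no second edge
  bears it: the edges above this node have strictly fewer leaves above them, and those of the other
  trees have disjoint leaf sets.\<close>

lemma internal_edges_collapse:
  assumes "branching \<tau>" "distinct (flat \<tau>)"
  shows "internal_edges (collapse e \<tau>) = internal_edges \<tau> - {e}"
  using assms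
proof (induction \<tau> rule: forest_induct)
  case (Node ts \<tau>)
  show ?case
  proof (cases "set (flat ts) = e")
    case True
    moreover have "e \<notin> internal_edges \<tau>"
    proof
      assume "e \<in> internal_edges \<tau>"
      then have "e \<subseteq> set (flat \<tau>)" by (rule internal_edge_subset)
      with True have "set (flat ts) \<subseteq> set (flat \<tau>)" by simp
      moreover have "set (flat ts) \<inter> set (flat \<tau>) = {}" using Node.prems by simp
      ultimately have "set (flat ts) = {}" by (simp add: Int_absorb2)
      then have "ts = []" using flat_eq_Nil[of ts] Node.prems(1) by simp
      then show False using Node.prems(1) by simp
    qed
    moreover have "e \<notin> internal_edges ts"
      using set_flat_notin_internal_edges[of ts] Node.prems True by simp
    moreover have "internal_edges (collapse e \<tau>) = internal_edges \<tau> - {e}"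
      using Node by simp
    moreover have "collapse e (Node ts # \<tau>) = ts @ collapse e \<tau>"
      using True by simp
    ultimately show ?thesis using True by (simp add: insert_Diff_if)
  next
    case False
    then have "internal_edges (collapse e (Node ts # \<tau>)) =
      insert (set (flat ts)) (internal_edges (collapse e ts) \<union> internal_edges (collapse e \<tau>))"
      by simp
    with False Node show ?thesis by auto
  qed
qed auto

lemma flat_mirror: "flat (rev (map mirror \<tau>)) = rev (flat \<tau>)"
  by (induction \<tau> rule: forest_induct) auto

lemma branching_rev [simp]: "branching (rev \<tau>) = branching \<tau>"
  by (simp add: branching_def)

lemma branching_mirror: "branching (map mirror \<tau>) = branching \<tau>"
  by (induction \<tau> rule: forest_induct) auto

lemma internal_edges_rev [simp]: "internal_edges (rev \<tau>) = internal_edges \<tau>"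
  by (simp add: internal_edges_def)

lemma internal_edges_mirror: "internal_edges (map mirror \<tau>) = internal_edges \<tau>"
  by (induction \<tau> rule: forest_induct) (auto simp: flat_mirror)

lemma length_reverse [simp]: "length (reverse e \<tau>) = length \<tau>"
  by (simp add: reverse_def)

lemma branching_reverse: "branching (reverse e \<tau>) = branching \<tau>"
  by (induction \<tau> rule: forest_induct) (auto simp: branching_mirror)

lemma set_flat_reverse [simp]: "set (flat (reverse e \<tau>)) = set (flat \<tau>)"
  by (induction \<tau> rule: forest_induct) (auto simp: flat_mirror)

lemma distinct_flat_reverse: "distinct (flat (reverse e \<tau>)) = distinct (flat \<tau>)"
  by (induction \<tau> rule: forest_induct) (auto simp: flat_mirror)

lemma internal_edges_reverse [simp]: "internal_edges (reverse e \<tau>) = internal_edges \<tau>"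
  by (induction \<tau> rule: forest_induct) (auto simp: flat_mirror internal_edges_mirror)

lemma reverse_trivial: "e \<notin> internal_edges \<tau> \<Longrightarrow> reverse e \<tau> = \<tau>"
  by (induction \<tau> rule: forest_induct) auto

text \<open>Mirroring the part above \<open>e\<close> reverses a contiguous block of the leaf word,
  so pairs with a leaf outside the block keep their order. In the recursion at most one of
  \<open>ts\<close> and \<open>\<tau>\<close> contains \<open>e\<close>, and the other is left alone
  by \<open>reverse_trivial\<close>.\<close>

lemma before_flat_reverse:
  assumes "branching \<tau>" "distinct (flat \<tau>)" "e \<in> internal_edges \<tau>"
  shows "before (flat (reverse e \<tau>)) i j \<longleftrightarrow>
    (if i \<in> e \<and> j \<in> e then before (flat \<tau>) j i else before (flat \<tau>) i j)"
  using assms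
proof (induction \<tau> rule: forest_induct)
  case (Node ts \<tau>)
  have d: "set (flat ts) \<inter> set (flat \<tau>) = {}" using Node.prems by auto
  consider "e = set (flat ts)" | "e \<noteq> set (flat ts)" "e \<in> internal_edges ts"
    | "e \<noteq> set (flat ts)" "e \<in> internal_edges \<tau>" using Node.prems by auto
  then show ?case
  proof cases
    case 1
    have "e \<noteq> {}" using Node.prems internal_edge_nonempty by blast
    then have "e \<notin> internal_edges \<tau>" using internal_edge_subset[of e \<tau>] 1 d by blast
    then have "reverse e (Node ts # \<tau>) = Node (rev (map mirror ts)) # \<tau>"
      using 1 by (simp add: reverse_trivial)
    then show ?thesis using 1 d
      by (auto simp: flat_mirror before_append before_rev dest: before_in_set)
  next
    case 2
    then have "e \<notin> internal_edges \<tau>" using Node.prems disjoint_internal_edges[of ts \<tau>] by auto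
    then have "reverse e (Node ts # \<tau>) = Node (reverse e ts) # \<tau>"
      using 2 by (simp add: reverse_trivial)
    then show ?thesis using 2 d Node internal_edge_subset[of e ts]
      by (auto simp: before_append dest: before_in_set)
  next
    case 3
    then have "e \<notin> internal_edges ts" using Node.prems disjoint_internal_edges[of ts \<tau>] by auto
    then have "reverse e (Node ts # \<tau>) = Node ts # reverse e \<tau>"
      using 3 by (simp add: reverse_trivial)
    then show ?thesis using 3 d Node internal_edge_subset[of e \<tau>]
      by (auto simp: before_append dest: before_in_set)
  qed
next
  case (Leaf l \<tau>)
  then have "l \<notin> e" using internal_edge_subset[of e \<tau>] by auto
  with Leaf show ?case by (cases "i \<in> e \<and> j \<in> e") auto
qed simp

section \<open>Relative position of the leaf sets of internal edges\<close>

lemma internal_edges_laminar: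
  assumes "branching \<tau>" "distinct (flat \<tau>)" "e \<in> internal_edges \<tau>" "f \<in> internal_edges \<tau>"
  shows "e \<subseteq> f \<or> f \<subseteq> e \<or> e \<inter> f = {}"
  using assms
proof (induction \<tau> rule: forest_induct)
  case (Node ts \<tau>)
  have "e \<subseteq> set (flat ts)" if "e \<in> internal_edges ts" for e using that by (rule internal_edge_subset)
  moreover have "e \<subseteq> set (flat \<tau>)" if "e \<in> internal_edges \<tau>" for e
    using that by (rule internal_edge_subset)
  moreover have "set (flat ts) \<inter> set (flat \<tau>) = {}" using Node.prems by auto
  ultimately show ?case using Node by (simp; blast)
qed auto

text \<open>The leaves above an edge are consecutive in \<open>flat\<close>. This interval property
  decides whether nested ordered leaf sets fit into one forest, both for links and for
  inter-osculation.\<close>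

lemma internal_edge_convex:
  assumes "branching \<tau>" "distinct (flat \<tau>)" "e \<in> internal_edges \<tau>" "a \<in> e" "b \<in> e" "k \<notin> e"
  shows "before (flat \<tau>) k a \<longleftrightarrow> before (flat \<tau>) k b"
  using assms
proof (induction \<tau> rule: forest_induct)
  case (Node ts \<tau>)
  have "set (flat ts) \<inter> set (flat \<tau>) = {}" using Node.prems by auto
  then show ?case using Node internal_edge_subset[of e ts] internal_edge_subset[of e \<tau>]
    by (auto simp: before_append dest: before_in_set)
next
  case (Leaf l \<tau>)
  then have "a \<in> set (flat \<tau>)" "b \<in> set (flat \<tau>)" using internal_edge_subset[of e \<tau>] by auto
  with Leaf show ?case by simp
qed simp

text \<open>Take two leaves above different ascending edges at the upper end of \<open>e\<close>.\<close>

lemma internal_edge_split: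
  assumes "branching \<tau>" "distinct (flat \<tau>)" "e \<in> internal_edges \<tau>"
  shows "\<exists>a\<in>e. \<exists>b\<in>e. a \<noteq> b \<and> (\<forall>f\<in>internal_edges \<tau>. a \<in> f \<and> b \<in> f \<longrightarrow> e \<subseteq> f)"
  using assms
proof (induction \<tau> rule: forest_induct)
  case (Node ts \<tau>)
  have d: "set (flat ts) \<inter> set (flat \<tau>) = {}" using Node.prems by auto
  consider "e = set (flat ts)" | "e \<in> internal_edges ts" | "e \<in> internal_edges \<tau>"
    using Node.prems by auto
  then show ?case
  proof cases
    case 1
    obtain t u us where ts: "ts = t # u # us" using Node.prems
      by (cases ts; cases "tl ts") auto
    have nz: "leaf_list t \<noteq> []" "leaf_list u \<noteq> []"
      using Node.prems ts branching_set[of ts] flat_eq_Nil[of "[t]"] flat_eq_Nil[of "[u]"]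
      by (auto simp: leaf_list_eq_flat)
    then obtain a b where ab: "a \<in> leaves t" "b \<in> leaves u" by (meson hd_in_set)
    have "distinct (flat ts)" using Node.prems by simp
    then have sp: "distinct (leaf_list t @ flat (u # us))" by (simp only: ts flat_Cons)
    have "e \<subseteq> f" if f: "f \<in> internal_edges (Node ts # \<tau>)" "a \<in> f" "b \<in> f" for f
    proof (rule ccontr)
      assume "\<not> e \<subseteq> f"
      then have "f \<in> internal_edges ts \<union> internal_edges \<tau>" using 1 f by auto
      then have "f \<in> internal_edges ts"
        using internal_edge_subset[of f \<tau>] d f ab ts by (auto simp: flat_Cons)
      then have "f \<in> internal_edges [t] \<or> f \<in> internal_edges (u # us)"
        using ts internal_edges_append[of "[t]" "u # us"] by simp
      then have "f \<subseteq> leaves t \<or> f \<subseteq> set (flat (u # us))"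
        using internal_edge_subset[of f "[t]"] internal_edge_subset[of f "u # us"]
        by (auto simp: leaf_list_eq_flat)
      then show False using f ab sp by (auto simp: flat_Cons)
    qed
    moreover have "a \<in> e" "b \<in> e" "a \<noteq> b" using 1 ab ts sp by (auto simp: flat_Cons)
    ultimately show ?thesis by blast
  next
    case 2
    have b: "branching ts" "distinct (flat ts)" using Node.prems by auto
    obtain a b where ab: "a \<in> e" "b \<in> e" "a \<noteq> b" "\<forall>f\<in>internal_edges ts. a \<in> f \<and> b \<in> f \<longrightarrow> e \<subseteq> f"
      using Node.IH(1)[OF b 2] by (elim bexE conjE) (rule that)
    have "e \<subseteq> f" if f: "f \<in> internal_edges (Node ts # \<tau>)" "a \<in> f" "b \<in> f" for f
    proof -
      have "a \<in> set (flat ts)" using internal_edge_subset[OF 2] ab(1) by (rule subsetD)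
      then have "f \<notin> internal_edges \<tau>" using internal_edge_subset[of f \<tau>] f(2) d by auto
      then have "f = set (flat ts) \<or> f \<in> internal_edges ts"
        using f(1) by simp
      then show ?thesis
        using ab f internal_edge_subset[OF 2] \<open>a \<in> set (flat ts)\<close> d by auto
    qed
    with ab show ?thesis by blast
  next
    case 3
    have b: "branching \<tau>" "distinct (flat \<tau>)" using Node.prems by auto
    obtain a b where ab: "a \<in> e" "b \<in> e" "a \<noteq> b" "\<forall>f\<in>internal_edges \<tau>. a \<in> f \<and> b \<in> f \<longrightarrow> e \<subseteq> f"
      using Node.IH(2)[OF b 3] by (elim bexE conjE) (rule that)
    have "e \<subseteq> f" if f: "f \<in> internal_edges (Node ts # \<tau>)" "a \<in> f" "b \<in> f" for f
    proof -
      have "a \<in> set (flat \<tau>)" using internal_edge_subset[OF 3] ab(1) by (rule subsetD)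
      then have "f \<notin> internal_edges ts" using internal_edge_subset[of f ts] f(2) d by auto
      then have "f = set (flat ts) \<or> f \<in> internal_edges \<tau>"
        using f(1) by simp
      then show ?thesis
        using ab f internal_edge_subset[OF 3] \<open>a \<in> set (flat \<tau>)\<close> d by auto
    qed
    with ab show ?thesis by blast
  qed
qed auto

text \<open>Every internal node gathers at least two trees into one, so with each internal edge the
  number of trees drops by at least one, starting from the leaves. This puts every forest on
  \<open>n\<close> leaves into some \<open>PF_k n k\<close> with \<open>k \<le> n\<close>.\<close>

lemma card_internal_edges_le:
  "branching \<tau> \<Longrightarrow> card (internal_edges \<tau>) + length \<tau> \<le> length (flat \<tau>)"
proof (induction \<tau> rule: forest_induct)
  case (Node ts \<tau>)
  have "card (internal_edges (Node ts # \<tau>)) \<le> Suc (card (internal_edges ts \<union> internal_edges \<tau>))"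
    by (simp add: card_insert_le_m1 card_insert_if)
  also have "\<dots> \<le> Suc (card (internal_edges ts) + card (internal_edges \<tau>))"
    by (simp add: card_Un_le)
  finally show ?case using Node by simp
qed auto

lemma PF_iff:
  "\<tau> \<in> PF n \<longleftrightarrow> branching \<tau> \<and> distinct (flat \<tau>) \<and> set (flat \<tau>) = {1..n}"
proof -
  have "card (internal_edges \<tau>) \<le> n"
    if "branching \<tau>" "distinct (flat \<tau>)" "set (flat \<tau>) = {1..n}"
    using card_internal_edges_le[OF that(1)] distinct_card[OF that(2)] that(3) by simp
  then show ?thesis by (auto simp: PF_def PF_k_def branching_def flat_def)
qed

subsection \<open>A forest is determined by its internal edges and the order of its leaves\<close>

text \<open>Given the leaf set of the first tree, inclusion in it sorts the edges of the forest into
  those of \<open>ts\<close> and those of \<open>\<tau>\<close>. This lets the uniqueness proof pass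
  from equal edge sets of forests to equal edge sets of their parts.\<close>

lemma internal_edges_Node_split:
  assumes "branching (Node ts # \<tau>)" "distinct (flat (Node ts # \<tau>))"
  shows "internal_edges ts = {e \<in> internal_edges (Node ts # \<tau>). e \<subset> set (flat ts)}"
    and "internal_edges \<tau> = {e \<in> internal_edges (Node ts # \<tau>). \<not> e \<subseteq> set (flat ts)}"
proof -
  have d: "set (flat ts) \<inter> set (flat \<tau>) = {}" using assms by auto
  have b: "branching ts" "distinct (flat ts)" "2 \<le> length ts" "branching \<tau>" "distinct (flat \<tau>)"
    using assms by auto
  have 1: "e \<subset> set (flat ts)" if "e \<in> internal_edges ts" for e
    using internal_edge_subset[OF that] set_flat_notin_internal_edges[OF b(1-3)] that by auto
  have 2: "\<not> e \<subseteq> set (flat ts)" if "e \<in> internal_edges \<tau>" for e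
    using internal_edge_subset[OF that] internal_edge_nonempty[OF b(4,5) that] d by auto
  show "internal_edges ts = {e \<in> internal_edges (Node ts # \<tau>). e \<subset> set (flat ts)}"
    using 1 2 by auto
  show "internal_edges \<tau> = {e \<in> internal_edges (Node ts # \<tau>). \<not> e \<subseteq> set (flat ts)}"
    using 1 2 by auto
qed

text \<open>Compare the first trees. A leaf cannot face a node: the edge of the node contains the
  common first leaf, but would have to be an edge among the remaining trees of the other forest. If
  both are nodes, the same argument makes each leaf set contain the other, and the induction applies
  above the node and to the remaining trees.\<close>

lemma forest_eqI:
  assumes "branching \<tau>" "branching \<sigma>" "distinct (flat \<tau>)" "flat \<tau> = flat \<sigma>"
    and "internal_edges \<tau> = internal_edges \<sigma>"
  shows "\<tau> = \<sigma>"
  using assms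
proof (induction \<tau> arbitrary: \<sigma> rule: forest_induct)
  case Nil
  then show ?case using flat_eq_Nil[of \<sigma>] by simp
next
  case (Leaf i \<tau>)
  then obtain t \<rho> where s: "\<sigma> = t # \<rho>" by (cases \<sigma>) auto
  show ?case
  proof (cases t)
    case (Leaf j)
    then show ?thesis using Leaf.IH[of \<rho>] Leaf.prems s by simp
  next
    case (Node us)
    have "us \<noteq> []" "branching us" using Leaf.prems(2) s Node by auto
    then obtain x xs where x: "flat us = x # xs" using flat_eq_Nil[of us] by (cases "flat us") auto
    have "x = i" using Leaf.prems(4) s Node x by simp
    moreover have "set (flat us) \<in> internal_edges \<tau>" using Leaf.prems(5) s Node by simp
    then have "set (flat us) \<subseteq> set (flat \<tau>)" by (rule internal_edge_subset)
    ultimately show ?thesis using x Leaf.prems(3) by simp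
  qed
next
  case (Node ts \<tau>)
  have "ts \<noteq> []" "branching ts" using Node.prems(1) by auto
  then obtain x xs where x: "flat ts = x # xs" using flat_eq_Nil[of ts] by (cases "flat ts") auto
  then obtain t \<rho> where s: "\<sigma> = t # \<rho>" using Node.prems(4) by (cases \<sigma>) auto
  show ?case
  proof (cases t)
    case (Leaf j)
    then have "j = x" using Node.prems(4) s x by simp
    moreover have "set (flat ts) \<in> internal_edges \<rho>" using Node.prems(5) s Leaf by auto
    then have "set (flat ts) \<subseteq> set (flat \<rho>)" by (rule internal_edge_subset)
    moreover have "distinct (flat \<sigma>)" using Node.prems(3) unfolding Node.prems(4) .
    ultimately show ?thesis using x s Leaf by simp
  next
    case (Node us)
    have "distinct (flat \<sigma>)" using Node.prems(3) unfolding Node.prems(4) .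
    then have ds: "distinct (flat (Node us # \<rho>))" unfolding s Node .
    have bs: "branching (Node us # \<rho>)" using Node.prems s Node by simp
    have E: "internal_edges (Node ts # \<tau>) = internal_edges (Node us # \<rho>)"
      using Node.prems(5) unfolding s Node .
    have "us \<noteq> []" "branching us" using bs by auto
    then obtain y ys where y: "flat us = y # ys" using flat_eq_Nil[of us] by (cases "flat us") auto
    have fl: "flat ts @ flat \<tau> = flat us @ flat \<rho>" using Node.prems(4) s Node by simp
    have "y = x" using fl x y by simp
    have sub: "set (flat ts) \<subseteq> set (flat us)"
    proof (rule ccontr)
      assume "\<not> set (flat ts) \<subseteq> set (flat us)"
      moreover have "set (flat ts) \<in> internal_edges (Node us # \<rho>)"
        unfolding E[symmetric] by simp
      ultimately have "set (flat ts) \<in> internal_edges \<rho>"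
        unfolding internal_edges_Node_split(2)[OF bs ds] by (intro CollectI conjI)
      then have "set (flat ts) \<subseteq> set (flat \<rho>)" by (rule internal_edge_subset)
      then show False using ds x y \<open>y = x\<close> by simp
    qed
    have sub': "set (flat us) \<subseteq> set (flat ts)"
    proof (rule ccontr)
      assume "\<not> set (flat us) \<subseteq> set (flat ts)"
      moreover have "set (flat us) \<in> internal_edges (Node ts # \<tau>)"
        unfolding E by simp
      ultimately have "set (flat us) \<in> internal_edges \<tau>"
        unfolding internal_edges_Node_split(2)[OF Node.prems(1,3)] by (intro CollectI conjI)
      then have "set (flat us) \<subseteq> set (flat \<tau>)" by (rule internal_edge_subset)
      then show False using Node.prems(3) x y \<open>y = x\<close> by simp
    qed
    have eq: "set (flat ts) = set (flat us)" using sub sub' by simp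
    moreover have "length (flat ts) = card (set (flat ts))" "length (flat us) = card (set (flat us))"
      using Node.prems(3) ds by (simp_all add: distinct_card)
    ultimately have "length (flat ts) = length (flat us)" by simp
    then have fl2: "flat ts = flat us" "flat \<tau> = flat \<rho>" using fl by auto
    have "internal_edges ts = internal_edges us"
      unfolding internal_edges_Node_split(1)[OF Node.prems(1,3)] internal_edges_Node_split(1)[OF bs ds]
      using E eq by simp
    moreover have "internal_edges \<tau> = internal_edges \<rho>"
      unfolding internal_edges_Node_split(2)[OF Node.prems(1,3)] internal_edges_Node_split(2)[OF bs ds]
      using E eq by simp
    ultimately have "ts = us" "\<tau> = \<rho>"
      using Node.IH(1)[of us] Node.IH(2)[of \<rho>] Node.prems(1,3) bs fl2 by simp_all
    then show ?thesis using s Node by simp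
  qed
qed

lemma leaf_list_nonempty: "branching [t] \<Longrightarrow> leaf_list t \<noteq> []"
  using flat_eq_Nil[of "[t]"] by (simp add: leaf_list_eq_flat)

lemma distinct_if_distinct_flat: "branching \<tau> \<Longrightarrow> distinct (flat \<tau>) \<Longrightarrow> distinct \<tau>"
proof (induction \<tau>)
  case (Cons t \<tau>)
  have b: "branching [t]" "branching \<tau>"
    using Cons.prems(1) branching_set[of "t # \<tau>"] branching_set[of \<tau>] by auto
  then obtain x where x: "x \<in> leaves t" using leaf_list_nonempty[of t] by (cases "leaf_list t") auto
  have "t \<notin> set \<tau>"
  proof
    assume "t \<in> set \<tau>"
    then have "x \<in> set (flat \<tau>)" using x by (auto simp: set_flat)
    then show False using x Cons.prems(2) by (auto simp: flat_Cons)
  qed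
  then show ?case using Cons b by (simp add: flat_Cons)
qed simp

lemma tree_unique:
  assumes "distinct (flat \<tau>)" "t \<in> set \<tau>" "u \<in> set \<tau>" "a \<in> leaves t" "a \<in> leaves u"
  shows "t = u"
  using assms by (induction \<tau>) (auto simp: flat_Cons set_flat)

lemma before_flat_tree:
  assumes "distinct (flat \<tau>)" "t \<in> set \<tau>" "a \<in> leaves t" "b \<in> leaves t"
  shows "before (flat \<tau>) a b \<longleftrightarrow> before (leaf_list t) a b"
proof -
  obtain \<rho> \<sigma> where s: "\<tau> = \<rho> @ t # \<sigma>" using assms(2) by (meson split_list)
  have "a \<notin> set (flat \<rho>)" "a \<notin> set (flat \<sigma>)" "b \<notin> set (flat \<rho>)" "b \<notin> set (flat \<sigma>)"
    using assms s by (auto simp: flat_Cons)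
  then show ?thesis unfolding s by (auto simp: flat_Cons before_append dest: before_in_set)
qed

lemma internal_edges_tree:
  assumes "branching \<tau>" "distinct (flat \<tau>)" "t \<in> set \<tau>"
  shows "internal_edges [t] = {e \<in> internal_edges \<tau>. e \<subseteq> leaves t}"
proof -
  have "e \<subseteq> leaves t" if "e \<in> internal_edges [t]" for e
    using internal_edge_subset[OF that] by (simp add: leaf_list_eq_flat)
  moreover have "e \<in> internal_edges [t]" if e: "e \<in> internal_edges \<tau>" "e \<subseteq> leaves t" for e
  proof -
    obtain u where u: "u \<in> set \<tau>" "e \<in> internal_edges [u]" using e(1) internal_edges_set by blast
    obtain a where "a \<in> e" using internal_edge_nonempty[OF assms(1,2) e(1)] by auto
    then have "a \<in> leaves u" "a \<in> leaves t"
      using e(2) internal_edge_subset[OF u(2)] by (auto simp: leaf_list_eq_flat)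
    then have "t = u" by (intro tree_unique[OF assms(2) assms(3) u(1)])
    then show ?thesis using u(2) by simp
  qed
  moreover have "internal_edges [t] \<subseteq> internal_edges \<tau>" using assms(3) internal_edges_set[of \<tau>] by auto
  ultimately show ?thesis by auto
qed

lemma Node_in_forest: "Node ts \<in> set \<tau> \<Longrightarrow> leaves (Node ts) \<in> internal_edges \<tau>"
  using internal_edges_set[of \<tau>] by (force simp: flat_def)

text \<open>The leaf sets of the nontrivial trees are the maximal internal edges, so a tree
  \<open>t\<close> of \<open>\<tau>\<close> has the same leaves as some tree \<open>u\<close> of
  \<open>\<sigma>\<close>. The orders are known only below common edges, hence only within trees;
  this suffices to apply \<open>forest_eqI\<close> to \<open>[t]\<close> and
  \<open>[u]\<close>.\<close>

lemma mset_forest_subset: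
  assumes \<tau>: "\<tau> \<in> PF n" and \<sigma>: "\<sigma> \<in> PF n" and E: "internal_edges \<tau> = internal_edges \<sigma>"
    and before: "\<And>e a b. e \<in> internal_edges \<tau> \<Longrightarrow> a \<in> e \<Longrightarrow> b \<in> e \<Longrightarrow>
      before (flat \<tau>) a b \<longleftrightarrow> before (flat \<sigma>) a b"
  shows "set \<tau> \<subseteq> set \<sigma>"
proof
  fix t assume t: "t \<in> set \<tau>"
  have b: "branching \<tau>" "distinct (flat \<tau>)" "branching \<sigma>" "distinct (flat \<sigma>)"
    and fl: "set (flat \<tau>) = set (flat \<sigma>)"
    using \<tau> \<sigma> by (auto simp: PF_iff)
  have bt: "branching [t]" using b(1) t branching_set by blast
  show "t \<in> set \<sigma>"
  proof (cases t)
    case (Leaf i)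
    then have "i \<in> set (flat \<tau>)" using t by (force simp: set_flat)
    then obtain u where u: "u \<in> set \<sigma>" "i \<in> leaves u" using fl by (auto simp: set_flat)
    show ?thesis
    proof (cases u)
      case (Leaf j)
      then show ?thesis using u \<open>t = Leaf i\<close> by auto
    next
      case (Node us)
      then have "leaves u \<in> internal_edges \<tau>" using E Node_in_forest u(1) by simp
      then obtain t' where t': "t' \<in> set \<tau>" "leaves u \<in> internal_edges [t']"
        using internal_edges_set by blast
      then have "i \<in> leaves t'" using internal_edge_subset[OF t'(2)] u(2) by (auto simp: leaf_list_eq_flat)
      then have "t' = t" using tree_unique[OF b(2) t'(1) t] Leaf by simp
      then show ?thesis using t'(2) Leaf by simp
    qed
  next
    case (Node ts)
    then have A: "leaves t \<in> internal_edges \<tau>" using Node_in_forest t by simp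
    then obtain u where u: "u \<in> set \<sigma>" "leaves t \<in> internal_edges [u]"
      using E internal_edges_set by blast
    have sub: "leaves t \<subseteq> leaves u" using internal_edge_subset[OF u(2)] by (simp add: leaf_list_eq_flat)
    obtain us where us: "u = Node us" using u(2) by (cases u) auto
    then have "leaves u \<in> internal_edges \<tau>" using E Node_in_forest u(1) by simp
    then obtain t' where t': "t' \<in> set \<tau>" "leaves u \<in> internal_edges [t']"
      using internal_edges_set by blast
    have sub': "leaves u \<subseteq> leaves t'" using internal_edge_subset[OF t'(2)] by (simp add: leaf_list_eq_flat)
    obtain a where "a \<in> leaves t" using leaf_list_nonempty[OF bt] by (cases "leaf_list t") auto
    then have "t = t'" using tree_unique[OF b(2) t t'(1)] sub sub' by auto
    then have eq: "leaves t = leaves u" using sub sub' by auto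
    have "leaf_list t = leaf_list u"
    proof (rule list_eq_if_before_eq[OF _ _ eq])
      show "distinct (leaf_list t)" "distinct (leaf_list u)"
        using b(2,4) t u(1) by (auto simp: flat_def distinct_concat_iff)
      fix i j assume ij: "i \<in> leaves t" "j \<in> leaves t"
      then show "before (leaf_list t) i j \<longleftrightarrow> before (leaf_list u) i j"
        using before_flat_tree[OF b(2) t ij] before_flat_tree[OF b(4) u(1)] before[OF A ij] eq by simp
    qed
    then have fl: "flat [t] = flat [u]" by (simp add: leaf_list_eq_flat)
    have d: "distinct (flat [t])" using b(2) t by (auto simp: flat_def distinct_concat_iff)
    have bu: "branching [u]" using b(3) u branching_set by blast
    have "internal_edges [t] = internal_edges [u]"
      using internal_edges_tree[OF b(1,2) t] internal_edges_tree[OF b(3,4) u(1)] E eq by simp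
    then have "[t] = [u]" using forest_eqI[OF bt bu d fl] by simp
    then show ?thesis using u(1) by simp
  qed
qed

lemma mset_forest_eqI:
  assumes \<tau>: "\<tau> \<in> PF n" and \<sigma>: "\<sigma> \<in> PF n" and E: "internal_edges \<tau> = internal_edges \<sigma>"
    and before: "\<And>e a b. e \<in> internal_edges \<tau> \<Longrightarrow> a \<in> e \<Longrightarrow> b \<in> e \<Longrightarrow>
      before (flat \<tau>) a b \<longleftrightarrow> before (flat \<sigma>) a b"
  shows "mset \<tau> = mset \<sigma>"
proof -
  have "set \<tau> = set \<sigma>"
  proof
    show "set \<tau> \<subseteq> set \<sigma>" using mset_forest_subset[OF assms] .
    show "set \<sigma> \<subseteq> set \<tau>"
      by (rule mset_forest_subset[OF \<sigma> \<tau> E[symmetric]]) (use E before in auto)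
  qed
  moreover have "distinct \<tau>" "distinct \<sigma>"
    using \<tau> \<sigma> distinct_if_distinct_flat by (auto simp: PF_iff)
  ultimately show ?thesis by (simp add: set_eq_iff_mset_eq_distinct)
qed

lemma finite_PF: "finite (PF n)"
proof (rule inj_on_finite)
  show "inj_on (\<lambda>\<tau>. (flat \<tau>, internal_edges \<tau>)) (PF n)"
    by (rule inj_onI) (auto simp: PF_iff intro: forest_eqI)
  show "(\<lambda>\<tau>. (flat \<tau>, internal_edges \<tau>)) ` PF n \<subseteq>
      {xs. set xs \<subseteq> {1..n} \<and> length xs = n} \<times> Pow (Pow {1..n})"
  proof (clarsimp simp: PF_iff, intro conjI)
    fix \<tau> :: "ptree list" assume \<tau>: "distinct (flat \<tau>)" "set (flat \<tau>) = {Suc 0..n}"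
    then show "length (flat \<tau>) = n" using distinct_card[of "flat \<tau>"] by simp
    show "internal_edges \<tau> \<subseteq> Pow {Suc 0..n}" using \<tau>(2) internal_edge_subset[of _ \<tau>] by auto
  qed
  show "finite ({xs::nat list. set xs \<subseteq> {1..n} \<and> length xs = n} \<times> Pow (Pow {1..n}))"
    using finite_lists_length_eq[of "{1..n}" n] by simp
qed

subsection \<open>Forests with prescribed internal edges and leaf orders\<close>

lemma branching_subset: "branching \<tau> \<Longrightarrow> set \<sigma> \<subseteq> set \<tau> \<Longrightarrow> branching \<sigma>"
  by (auto simp: branching_def)

lemma distinct_flat_filter: "distinct (flat \<tau>) \<Longrightarrow> distinct (flat (filter P \<tau>))"
  by (induction \<tau>) (auto simp: flat_Cons set_flat)

text \<open>Let \<open>t\<close> be the tree with the first letter \<open>x\<close> of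
  \<open>w\<close>. No letter outside \<open>t\<close> precedes \<open>x\<close>, so by the interval
  condition none precedes any leaf of \<open>t\<close>, and the leaves of \<open>t\<close> form an
  initial segment. Put \<open>t\<close> first and continue with the rest of the word.\<close>

lemma arrange_forest:
  assumes "distinct w" "distinct (flat ts)" "branching ts" "set (flat ts) = set w"
    and "\<And>t a b. t \<in> set ts \<Longrightarrow> a \<in> leaves t \<Longrightarrow> b \<in> leaves t \<Longrightarrow>
      before (leaf_list t) a b \<longleftrightarrow> before w a b"
    and "\<And>t a b k. t \<in> set ts \<Longrightarrow> a \<in> leaves t \<Longrightarrow> b \<in> leaves t \<Longrightarrow> k \<notin> leaves t \<Longrightarrow>
      before w k a \<longleftrightarrow> before w k b"
  shows "\<exists>ts'. mset ts' = mset ts \<and> flat ts' = w"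
  using assms
proof (induction "length w" arbitrary: w ts rule: less_induct)
  case less
  show ?case
  proof (cases w)
    case Nil
    then show ?thesis using less.prems by auto
  next
    case (Cons x w')
    then obtain t where t: "t \<in> set ts" "x \<in> leaves t" using less.prems(4) by (auto simp: set_flat)
    obtain p q where pq: "ts = p @ t # q" using t(1) by (meson split_list)
    let ?P = "\<lambda>a. a \<in> leaves t"
    let ?v = "filter (\<lambda>a. \<not> ?P a) w"
    have split: "w = filter ?P w @ ?v"
    proof (rule filter_split_if_not_before)
      fix a k assume "a \<in> leaves t" "k \<notin> leaves t"
      then have "before w k a \<longleftrightarrow> before w k x" using less.prems(6)[OF t(1)] t(2) by blast
      moreover have "\<not> before w k x" using Cons less.prems(1) \<open>k \<notin> leaves t\<close> t(2)
        by (auto dest: before_in_set)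
      ultimately show "\<not> before w k a" by simp
    qed
    have "leaves t \<subseteq> set w" using less.prems(4) t(1) by (auto simp: set_flat)
    have lt: "leaf_list t = filter ?P w"
    proof (rule list_eq_if_before_eq)
      show "distinct (leaf_list t)" using less.prems(2) t(1) by (auto simp: flat_def distinct_concat_iff)
      show "set (leaf_list t) = set (filter ?P w)" using \<open>leaves t \<subseteq> set w\<close> by auto
    qed (use less.prems(1,5) t(1) in \<open>auto simp: before_filter\<close>)
    have d: "set (flat (p @ q)) \<inter> leaves t = {}" using less.prems(2) pq by (auto simp: flat_Cons)
    have "\<exists>r. mset r = mset (p @ q) \<and> flat r = ?v"
    proof (rule less.hyps)
      show "length ?v < length w" using t(2) Cons by (simp add: le_imp_less_Suc)
      show "distinct ?v" using less.prems(1) by simp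
      show "distinct (flat (p @ q))" using less.prems(2) pq by (auto simp: flat_Cons)
      show "branching (p @ q)" by (rule branching_subset[OF less.prems(3)]) (auto simp: pq)
      have "set w = leaves t \<union> set (flat (p @ q))" using less.prems(4) pq by (auto simp: flat_Cons)
      then show "set (flat (p @ q)) = set ?v" using d by auto
    next
      fix u a b assume u: "u \<in> set (p @ q)" and ab: "a \<in> leaves u" "b \<in> leaves u"
      then have n: "a \<notin> leaves t" "b \<notin> leaves t" using d by (auto simp: set_flat)
      have u': "u \<in> set ts" using u pq by auto
      show "before (leaf_list u) a b \<longleftrightarrow> before ?v a b"
        using less.prems(5)[OF u' ab] n by (simp add: before_filter)
      show "before ?v k a \<longleftrightarrow> before ?v k b" if "k \<notin> leaves u" for k
        using less.prems(6)[OF u' ab that] n by (simp add: before_filter)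
    qed
    then obtain r where "mset r = mset (p @ q)" "flat r = ?v" by blast
    then have "mset (t # r) = mset ts" "flat (t # r) = w"
      using pq lt split by (simp_all add: flat_Cons)
    then show ?thesis by blast
  qed
qed

text \<open>Remove a maximal \<open>e\<close> and take a forest for the remaining sets. Its trees
  with leaves in \<open>e\<close> are arranged by \<open>arrange_forest\<close> so as to spell
  \<open>w e\<close>, and are then placed above one new node; the hypotheses on nested sets are
  exactly what the arrangement requires.\<close>

lemma forest_exists:
  fixes w :: "nat set \<Rightarrow> nat list"
  assumes "finite \<E>" and "\<And>e. e \<in> \<E> \<Longrightarrow> e \<subseteq> {1..n} \<and> 2 \<le> card e"
    and "\<And>e. e \<in> \<E> \<Longrightarrow> distinct (w e) \<and> set (w e) = e"
    and "\<And>e f. e \<in> \<E> \<Longrightarrow> f \<in> \<E> \<Longrightarrow> e \<subseteq> f \<or> f \<subseteq> e \<or> e \<inter> f = {}"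
    and "\<And>e f a b. e \<in> \<E> \<Longrightarrow> f \<in> \<E> \<Longrightarrow> e \<subset> f \<Longrightarrow> a \<in> e \<Longrightarrow> b \<in> e \<Longrightarrow>
      before (w e) a b \<longleftrightarrow> before (w f) a b"
    and "\<And>e f a b k. e \<in> \<E> \<Longrightarrow> f \<in> \<E> \<Longrightarrow> e \<subset> f \<Longrightarrow> a \<in> e \<Longrightarrow> b \<in> e \<Longrightarrow> k \<in> f - e \<Longrightarrow>
      before (w f) k a \<longleftrightarrow> before (w f) k b"
  shows "\<exists>\<tau>\<in>PF n. internal_edges \<tau> = \<E> \<and>
    (\<forall>e\<in>\<E>. \<forall>a\<in>e. \<forall>b\<in>e. before (flat \<tau>) a b \<longleftrightarrow> before (w e) a b)"
  using assms
proof (induction \<E> rule: finite_psubset_induct)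
  case (psubset \<E>)
  note size = psubset.prems(1) and words = psubset.prems(2) and laminar = psubset.prems(3)
    and agree = psubset.prems(4) and convex = psubset.prems(5)
  show ?case
  proof (cases "\<E> = {}")
    case True
    have "flat (map Leaf xs) = xs \<and> internal_edges (map Leaf xs) = {} \<and> branching (map Leaf xs)" for xs
      by (induction xs) auto
    moreover have "set [1..<Suc n] = {1..n}" by auto
    ultimately have "map Leaf [1..<Suc n] \<in> PF n \<and> internal_edges (map Leaf [1..<Suc n]) = \<E>"
      using True by (simp add: PF_iff)
    then show ?thesis using True by blast
  next
    case False
    then obtain e where e: "e \<in> \<E>" and max: "\<And>f. f \<in> \<E> \<Longrightarrow> e \<subseteq> f \<Longrightarrow> e = f"
      using finite_has_maximal[OF psubset.hyps(1)] by blast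
    have "\<E> - {e} \<subset> \<E>" using e by auto
    then have "\<exists>\<tau>\<in>PF n. internal_edges \<tau> = \<E> - {e} \<and>
        (\<forall>e\<in>\<E> - {e}. \<forall>a\<in>e. \<forall>b\<in>e. before (flat \<tau>) a b \<longleftrightarrow> before (w e) a b)"
    proof (rule psubset.IH)
      fix f g a b k assume f: "f \<in> \<E> - {e}"
      show "f \<subseteq> {1..n} \<and> 2 \<le> card f" "distinct (w f) \<and> set (w f) = f"
        using size words f by auto
      assume g: "g \<in> \<E> - {e}"
      show "f \<subseteq> g \<or> g \<subseteq> f \<or> f \<inter> g = {}" using laminar f g by simp
      assume fg: "f \<subset> g" "a \<in> f" "b \<in> f"
      show "before (w f) a b \<longleftrightarrow> before (w g) a b" using agree[OF _ _ fg] f g by simp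
      assume k: "k \<in> g - f"
      show "before (w g) k a \<longleftrightarrow> before (w g) k b" using convex[OF _ _ fg k] f g by simp
    qed
    then obtain \<tau> where \<tau>: "\<tau> \<in> PF n" and E: "internal_edges \<tau> = \<E> - {e}"
      and bef0: "\<forall>f\<in>\<E> - {e}. \<forall>a\<in>f. \<forall>b\<in>f. before (flat \<tau>) a b \<longleftrightarrow> before (w f) a b"
      by (elim bexE conjE) (rule that)
    note bef = bef0[rule_format]
    have b: "branching \<tau>" "distinct (flat \<tau>)" and fl: "set (flat \<tau>) = {1..n}"
      using \<tau> by (auto simp: PF_iff)
    define ts where "ts = filter (\<lambda>t. leaves t \<subseteq> e) \<tau>"
    define us where "us = filter (\<lambda>t. \<not> leaves t \<subseteq> e) \<tau>"
    \<comment> \<open>The leaf set of a nontrivial tree is a member other than \<open>e\<close>; it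
      cannot contain \<open>e\<close>, as \<open>e\<close> is maximal.\<close>
    have in_or_out: "leaves t \<subseteq> e \<or> leaves t \<inter> e = {}" if t: "t \<in> set \<tau>" for t
    proof (cases t)
      case (Node rs)
      then have "leaves t \<in> \<E> - {e}" using Node_in_forest[of rs \<tau>] E t by simp
      then show ?thesis using laminar[of "leaves t" e] max[of "leaves t"] e by auto
    qed auto
    have ts: "set ts \<subseteq> set \<tau>" "set us \<subseteq> set \<tau>" "set \<tau> = set ts \<union> set us"
      by (auto simp: ts_def us_def)
    have us_e: "set (flat us) \<inter> e = {}"
      using in_or_out by (force simp: us_def set_flat)
    have d: "distinct (flat ts)" "distinct (flat us)"
      using b(2) by (simp_all add: ts_def us_def distinct_flat_filter)
    have fts: "set (flat ts) = e"
    proof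
      show "set (flat ts) \<subseteq> e" by (auto simp: ts_def set_flat)
      show "e \<subseteq> set (flat ts)"
      proof
        fix a assume a: "a \<in> e"
        then have "a \<in> set (flat \<tau>)" using size[OF e] fl by auto
        then have "a \<in> set (flat ts) \<or> a \<in> set (flat us)" using ts(3) by (auto simp: set_flat)
        then show "a \<in> set (flat ts)" using a us_e by auto
      qed
    qed
    have tree: "f = leaves t \<Longrightarrow> f \<in> \<E> \<and> f \<subset> e" if "t \<in> set ts" "t = Node rs" for t rs f
    proof -
      assume f: "f = leaves t"
      have "leaves (Node rs) \<in> internal_edges \<tau>" using that ts(1) by (intro Node_in_forest) auto
      then have "f \<in> \<E> - {e}" unfolding E f that(2) .
      moreover have "f \<subseteq> e" using f that(1) by (simp add: ts_def)
      ultimately show ?thesis by auto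
    qed
    have "\<exists>ts'. mset ts' = mset ts \<and> flat ts' = w e"
    proof (rule arrange_forest)
      show "distinct (w e)" "set (flat ts) = set (w e)" using words[OF e] fts by auto
      show "branching ts" using branching_subset[OF b(1) ts(1)] .
    next
      fix t i j assume t: "t \<in> set ts" and ij: "i \<in> leaves t" "j \<in> leaves t"
      show "before (leaf_list t) i j \<longleftrightarrow> before (w e) i j"
      proof (cases t)
        case (Leaf l)
        then show ?thesis using ij before_asym[of "w e" l l] words[OF e] by auto
      next
        case (Node rs)
        have f: "leaves t \<in> \<E>" "leaves t \<subset> e" using tree[OF t Node refl] by auto
        have "before (leaf_list t) i j \<longleftrightarrow> before (flat \<tau>) i j"
          using before_flat_tree[OF b(2) _ ij] t ts(1) by auto
        also have "\<dots> \<longleftrightarrow> before (w (leaves t)) i j" using bef[OF _ ij] f by auto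
        also have "\<dots> \<longleftrightarrow> before (w e) i j" using agree[OF f(1) e f(2) ij] .
        finally show ?thesis .
      qed
      show "before (w e) k i \<longleftrightarrow> before (w e) k j" if k: "k \<notin> leaves t" for k
      proof (cases t)
        case (Leaf l)
        then show ?thesis using ij by simp
      next
        case (Node rs)
        have f: "leaves t \<in> \<E>" "leaves t \<subset> e" using tree[OF t Node refl] by auto
        show ?thesis
        proof (cases "k \<in> e")
          case True
          then show ?thesis using convex[OF f(1) e f(2) ij] k by simp
        next
          case False
          then show ?thesis using words[OF e] before_in_set[of "w e" k] by blast
        qed
      qed
    qed (use d in auto)
    then obtain ts' where ts': "mset ts' = mset ts" "flat ts' = w e" by blast
    have set': "set ts' = set ts" using ts'(1) by (metis set_mset_mset)
    have E': "internal_edges ts' = internal_edges ts"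
      using set' internal_edges_set[of ts] internal_edges_set[of ts'] by simp
    have bts: "branching ts'" using branching_subset[OF b(1)] ts(1) set' by simp
    \<comment> \<open>A single tree with leaf set \<open>e\<close> would be a leaf, although
      \<open>e\<close> has two elements, or a node with root edge \<open>e\<close>, which the forest
      does not contain.\<close>
    have len: "2 \<le> length ts'"
    proof (rule ccontr)
      assume "\<not> 2 \<le> length ts'"
      then have "length ts' = 0 \<or> length ts' = 1" by linarith
      moreover have "ts' \<noteq> []" using ts'(2) words[OF e] size[OF e] by auto
      ultimately obtain t where t: "ts' = [t]" by (auto simp: length_Suc_conv)
      have lt: "leaves t = e" using ts'(2) words[OF e] t by (simp add: flat_def)
      show False
      proof (cases t)
        case (Leaf l)
        then show False using lt size[OF e] by auto
      next
        case (Node rs)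
        then show False using tree[of t rs "leaves t"] lt t set' by auto
      qed
    qed
    define \<tau>' where "\<tau>' = Node ts' # us"
    have "set (flat \<tau>) = set (flat ts) \<union> set (flat us)" using ts(3) by (auto simp: set_flat)
    then have "set (flat \<tau>') = {1..n}" using fl fts ts'(2) words[OF e] by (simp add: \<tau>'_def)
    moreover have d': "distinct (flat \<tau>')" using ts'(2) words[OF e] d us_e by (auto simp: \<tau>'_def)
    moreover have "branching \<tau>'" using len bts branching_subset[OF b(1) ts(2)] by (simp add: \<tau>'_def)
    ultimately have "\<tau>' \<in> PF n" by (simp add: PF_iff)
    moreover have "internal_edges \<tau>' = \<E>"
    proof -
      have "internal_edges \<tau> = internal_edges ts \<union> internal_edges us"
        using ts(3) internal_edges_set[of \<tau>] internal_edges_set[of ts] internal_edges_set[of us] by auto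
      then have "internal_edges \<tau>' = insert e (\<E> - {e})"
        using E E' ts'(2) words[OF e] by (simp add: \<tau>'_def)
      then show ?thesis using e by auto
    qed
    moreover have "before (flat \<tau>') i j \<longleftrightarrow> before (w f) i j" if f: "f \<in> \<E>" and ij: "i \<in> f" "j \<in> f" for f i j
    proof (cases "f = e")
      case True
      then have "i \<notin> set (flat us)" "j \<notin> set (flat us)" using us_e ij by auto
      then show ?thesis using True ts'(2) by (auto simp: \<tau>'_def before_append dest: before_in_set)
    next
      case False
      then have fE: "f \<in> internal_edges \<tau>" using E f by simp
      then obtain t where t: "t \<in> set \<tau>" "f \<in> internal_edges [t]" using internal_edges_set by blast
      then have ijt: "i \<in> leaves t" "j \<in> leaves t"
        using internal_edge_subset[OF t(2)] ij by (auto simp: leaf_list_eq_flat)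
      have "before (flat \<tau>') i j \<longleftrightarrow> before (leaf_list t) i j"
      proof (cases "t \<in> set ts")
        case True
        then have "i \<in> e" "j \<in> e" using ijt by (auto simp: ts_def)
        then have "i \<notin> set (flat us)" "j \<notin> set (flat us)" using us_e by auto
        moreover have "before (flat ts') i j \<longleftrightarrow> before (leaf_list t) i j"
          using before_flat_tree[of ts', OF _ _ ijt] True set' ts'(2) words[OF e] by simp
        ultimately show ?thesis by (auto simp: \<tau>'_def before_append dest: before_in_set)
      next
        case False
        then have "t \<in> set \<tau>'" using t(1) ts(3) by (simp add: \<tau>'_def)
        then show ?thesis using before_flat_tree[OF d' _ ijt] by simp
      qed
      also have "\<dots> \<longleftrightarrow> before (flat \<tau>) i j" using before_flat_tree[OF b(2) t(1) ijt] by simp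
      also have "\<dots> \<longleftrightarrow> before (w f) i j" using bef[OF _ ij] f False by simp
      finally show ?thesis .
    qed
    ultimately show ?thesis by blast
  qed
qed

section \<open>Quotients and coverings\<close>

lemma openin_quotient_space:
  "openin (quotient_space T g) U \<longleftrightarrow>
     U \<subseteq> topspace T // gen_equiv (topspace T) g \<and> openin T (\<Union>U)"
  unfolding quotient_space_def by (simp add: topology_inverse'[OF istopology_quotient_space])

lemma gen_class_eq_iff:
  assumes "x \<in> topspace T" "y \<in> topspace T"
  shows "gen_class T g x = gen_class T g y \<longleftrightarrow> (x, y) \<in> (g \<union> g\<inverse>)\<^sup>*"
  using eq_equiv_class_iff[OF equiv_gen_equiv assms, of g] assms
  by (simp add: gen_class_def gen_equiv_def)

lemma quotient_eq_gen_class: "topspace T // gen_equiv (topspace T) g = gen_class T g ` topspace T"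
  by (auto simp: quotient_def gen_class_def)

lemma gen_class_self: "x \<in> topspace T \<Longrightarrow> x \<in> gen_class T g x"
  by (simp add: gen_class_def gen_equiv_def)

lemma mem_gen_class:
  "x \<in> topspace T \<Longrightarrow> y \<in> gen_class T g x \<longleftrightarrow> y \<in> topspace T \<and> (x, y) \<in> (g \<union> g\<inverse>)\<^sup>*"
  by (auto simp: gen_class_def gen_equiv_def)

lemma Union_quotient_space:
  assumes "U \<subseteq> gen_class T g ` topspace T"
  shows "\<Union>U = {x \<in> topspace T. gen_class T g x \<in> U}"
proof
  show "\<Union>U \<subseteq> {x \<in> topspace T. gen_class T g x \<in> U}"
  proof
    fix x assume "x \<in> \<Union>U"
    then obtain y where y: "y \<in> topspace T" "gen_class T g y \<in> U" "x \<in> gen_class T g y"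
      using assms by blast
    then have "x \<in> topspace T" "gen_class T g y = gen_class T g x"
      using mem_gen_class[OF y(1)] gen_class_eq_iff[OF y(1)] by auto
    then show "x \<in> {x \<in> topspace T. gen_class T g x \<in> U}" using y(2) by simp
  qed
qed (auto simp: gen_class_self)

lemma topspace_quotient_space: "topspace (quotient_space T g) = gen_class T g ` topspace T"
proof
  show "topspace (quotient_space T g) \<subseteq> gen_class T g ` topspace T"
    using openin_quotient_space[of T g "topspace (quotient_space T g)"]
    by (simp add: quotient_eq_gen_class)
  have "\<Union>(gen_class T g ` topspace T) = topspace T" by (subst Union_quotient_space) auto
  then have "openin (quotient_space T g) (gen_class T g ` topspace T)"
    by (simp add: openin_quotient_space quotient_eq_gen_class)
  then show "gen_class T g ` topspace T \<subseteq> topspace (quotient_space T g)" by (rule openin_subset)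
qed

lemma quotient_map_gen_class: "quotient_map T (quotient_space T g) (gen_class T g)"
  unfolding quotient_map_def
  by (auto simp: topspace_quotient_space openin_quotient_space quotient_eq_gen_class
      Union_quotient_space)

lemma rtrancl_invariant:
  assumes "(x, y) \<in> (g \<union> g\<inverse>)\<^sup>*" "\<And>a b. (a, b) \<in> g \<Longrightarrow> f a = f b"
  shows "f x = f y"
  using assms(1) by induction (use assms(2) in force)+

text \<open>The quotient by a finite group acting freely, where all that is required of the group is
  that its orbits are the fibres of \<open>p\<close>. The preimage of the image of an open set
  \<open>W\<close> is the union of its translates, so \<open>p\<close> is open; for \<open>W\<close>
  with disjoint translates these are the sheets over the image of \<open>W\<close>. The degree is
  \<open>card G\<close>.\<close>

lemma finite_degree_covering_map_orbits:
  fixes act :: "'g \<Rightarrow> 'a \<Rightarrow> 'a"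
  assumes G: "finite G" "e \<in> G" "\<And>x. x \<in> topspace X \<Longrightarrow> act e x = x"
    and p: "quotient_map X Y p"
    and homeo: "\<And>g. g \<in> G \<Longrightarrow> homeomorphic_map X X (act g)"
    and fibres: "\<And>x y. x \<in> topspace X \<Longrightarrow> y \<in> topspace X \<Longrightarrow>
      p x = p y \<longleftrightarrow> (\<exists>g\<in>G. y = act g x)"
    and free: "\<And>x. x \<in> topspace X \<Longrightarrow> \<exists>W. openin X W \<and> x \<in> W \<and>
      (\<forall>g\<in>G. \<forall>h\<in>G. g \<noteq> h \<longrightarrow> disjnt (act g ` W) (act h ` W))"
  shows "finite_degree_covering_map X Y p"
proof -
  have onto: "p ` topspace X = topspace Y" using p by (simp add: quotient_map_def)
  have cont: "continuous_map X Y p" using p by (rule quotient_imp_continuous_map)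
  have act_in: "act g x \<in> topspace X" if "g \<in> G" "x \<in> topspace X" for g x
    using homeomorphic_imp_surjective_map[OF homeo[OF that(1)]] that(2) by blast
  have p_act: "p (act g x) = p x" if "g \<in> G" "x \<in> topspace X" for g x
    using fibres[OF that(2) act_in[OF that]] that(1) by metis
  have act_open: "openin X (act g ` W)" if "g \<in> G" "openin X W" for g W
    using homeomorphic_imp_open_map[OF homeo[OF that(1)]] that(2) by (simp add: open_map_def)
  have preimage: "{x \<in> topspace X. p x \<in> p ` W} = (\<Union>g\<in>G. act g ` W)" if W: "W \<subseteq> topspace X" for W
  proof (intro equalityI subsetI)
    fix x assume "x \<in> {x \<in> topspace X. p x \<in> p ` W}"
    then obtain w where "x \<in> topspace X" "w \<in> W" "p w = p x" by auto
    then show "x \<in> (\<Union>g\<in>G. act g ` W)" using fibres[of w x] W by auto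
  next
    fix x assume "x \<in> (\<Union>g\<in>G. act g ` W)"
    then obtain g w where "g \<in> G" "w \<in> W" "x = act g w" by auto
    then show "x \<in> {x \<in> topspace X. p x \<in> p ` W}" using act_in p_act W by auto
  qed
  have p_open: "openin Y (p ` W)" if W: "openin X W" for W
  proof -
    have sub: "W \<subseteq> topspace X" using W by (rule openin_subset)
    have "openin X (\<Union>g\<in>G. act g ` W)" using act_open W by auto
    moreover have "p ` W \<subseteq> topspace Y" using sub onto by auto
    ultimately show ?thesis using p preimage[OF sub] unfolding quotient_map_def by auto
  qed
  have "covering_map X Y p"
    unfolding covering_map_def
  proof (intro conjI ballI)
    show "continuous_map X Y p" "p ` topspace X = topspace Y" by fact+
    fix y assume "y \<in> topspace Y"
    then have "y \<in> p ` topspace X" using onto by simp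
    then obtain x where x: "x \<in> topspace X" "p x = y" by (elim imageE) simp
    obtain W where W: "openin X W" "x \<in> W"
      and disj: "\<forall>g\<in>G. \<forall>h\<in>G. g \<noteq> h \<longrightarrow> disjnt (act g ` W) (act h ` W)"
      using free[OF x(1)] by (elim exE conjE) (rule that)
    have sub: "W \<subseteq> topspace X" using W(1) by (rule openin_subset)
    have "homeomorphic_map (subtopology X V) (subtopology Y (p ` W)) p" if V: "V \<in> (\<lambda>g. act g ` W) ` G" for V
    proof (rule bijective_open_imp_homeomorphic_map)
      obtain g where g: "g \<in> G" "V = act g ` W" using V by auto
      have VX: "openin X V" using act_open[OF g(1) W(1)] g(2) by simp
      have VX': "V \<subseteq> topspace X" using openin_subset[OF VX] .
      have "p ` V = (\<lambda>w. p (act g w)) ` W" using g(2) by (simp add: image_image)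
      also have "\<dots> = p ` W" using p_act[OF g(1)] sub by (intro image_cong) auto
      finally have pV: "p ` V = p ` W" .
      have pW: "p ` W \<subseteq> topspace Y" using image_mono[OF sub, of p] onto by simp
      show "p ` topspace (subtopology X V) = topspace (subtopology Y (p ` W))"
        using pV topspace_subtopology_subset[OF VX'] topspace_subtopology_subset[OF pW] by simp
      show "continuous_map (subtopology X V) (subtopology Y (p ` W)) p"
        using cont pV by (auto simp: continuous_map_in_subtopology continuous_map_from_subtopology)
      show "open_map (subtopology X V) (subtopology Y (p ` W)) p"
        unfolding open_map_def
      proof (intro allI impI)
        fix O' assume O': "openin (subtopology X V) O'"
        then have "openin X O'" using VX by (simp add: openin_open_subtopology)
        then have "openin Y (p ` O')" by (rule p_open)
        moreover have "O' \<subseteq> V" using openin_subset[OF O'] by simp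
        then have "p ` O' \<subseteq> p ` W" using pV image_mono[of O' V p] by simp
        ultimately show "openin (subtopology Y (p ` W)) (p ` O')"
          using p_open[OF W(1)] by (simp add: openin_open_subtopology)
      qed
      show "inj_on p (topspace (subtopology X V))"
      proof (rule inj_onI)
        fix a b assume ab: "a \<in> topspace (subtopology X V)" "b \<in> topspace (subtopology X V)" "p a = p b"
        then obtain u v where uv: "u \<in> W" "v \<in> W" "a = act g u" "b = act g v" using g(2) by auto
        then have "u \<in> topspace X" "v \<in> topspace X" using sub by auto
        then have "p u = p v" using ab(3) p_act[OF g(1)] uv by simp
        then obtain h where h: "h \<in> G" "v = act h u"
          using fibres \<open>u \<in> topspace X\<close> \<open>v \<in> topspace X\<close> by metis
        \<comment> \<open>The point \<open>v\<close> lies in the translate of \<open>W\<close> by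
          \<open>h\<close> and also in \<open>W\<close> itself, the translate by \<open>e\<close>;
          so \<open>h = e\<close> by disjointness.\<close>
        have "v \<in> act h ` W" "v \<in> act e ` W"
          using h uv G(3)[OF \<open>v \<in> topspace X\<close>] by (auto intro: rev_image_eqI)
        then have "h = e" using disj h(1) G(2) by (metis disjnt_iff)
        then show "a = b" using uv h G(3)[OF \<open>u \<in> topspace X\<close>] by simp
      qed
    qed
    moreover have "pairwise disjnt ((\<lambda>g. act g ` W) ` G)"
    proof (rule pairwiseI)
      fix A B assume "A \<in> (\<lambda>g. act g ` W) ` G" "B \<in> (\<lambda>g. act g ` W) ` G" "A \<noteq> B"
      then obtain g h where "g \<in> G" "h \<in> G" "A = act g ` W" "B = act h ` W" by (elim imageE) simp
      then show "disjnt A B" using disj \<open>A \<noteq> B\<close> by metis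
    qed
    moreover have "\<Union>((\<lambda>g. act g ` W) ` G) = {x \<in> topspace X. p x \<in> p ` W}"
      using preimage[OF sub] by auto
    ultimately show "\<exists>U. openin Y U \<and> y \<in> U \<and>
        (\<exists>\<V>. \<Union>\<V> = {x \<in> topspace X. p x \<in> U} \<and> pairwise disjnt \<V> \<and>
             (\<forall>V \<in> \<V>. openin X V \<and> homeomorphic_map (subtopology X V) (subtopology Y U) p))"
      using p_open[OF W(1)] W(2) x(2) act_open[OF _ W(1)]
      by (intro exI[of _ "p ` W"] conjI exI[of _ "(\<lambda>g. act g ` W) ` G"]) auto
  qed
  moreover have "card {x \<in> topspace X. p x = y} = card G" if "y \<in> topspace Y" for y
  proof -
    have "y \<in> p ` topspace X" using onto that by simp
    then obtain x where x: "x \<in> topspace X" "p x = y" by (elim imageE) simp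
    have "{x' \<in> topspace X. p x' = y} = (\<lambda>g. act g x) ` G"
    proof (intro equalityI subsetI)
      fix x' assume "x' \<in> {x' \<in> topspace X. p x' = y}"
      then have "\<exists>g\<in>G. x' = act g x" using fibres[OF x(1), of x'] x(2) by simp
      then show "x' \<in> (\<lambda>g. act g x) ` G" by blast
    next
      fix x' assume "x' \<in> (\<lambda>g. act g x) ` G"
      then show "x' \<in> {x' \<in> topspace X. p x' = y}" using x act_in[OF _ x(1)] p_act[OF _ x(1)] by force
    qed
    moreover have "inj_on (\<lambda>g. act g x) G"
    proof (rule inj_onI)
      fix g h assume gh: "g \<in> G" "h \<in> G" "act g x = act h x"
      obtain W where "x \<in> W" "\<forall>g\<in>G. \<forall>h\<in>G. g \<noteq> h \<longrightarrow> disjnt (act g ` W) (act h ` W)"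
        using free[OF x(1)] by (elim exE conjE) (rule that)
      then show "g = h" using gh by (metis disjnt_iff image_eqI)
    qed
    ultimately show ?thesis by (simp add: card_image)
  qed
  moreover have "card G > 0" using G by (auto simp: card_gt_0_iff)
  ultimately show ?thesis unfolding finite_degree_covering_map_def by blast
qed

section \<open>The coordinates of a point of the complex\<close>

definition sg :: "bit \<Rightarrow> real" where
  "sg b = (if b = 0 then 1 else -1)"

lemma sg_simps [simp]: "sg 0 = 1" "sg 1 = -1" "\<bar>sg b\<bar> = 1" "sg b \<noteq> 0" "sg b * sg b = 1"
  by (auto simp: sg_def)

lemma sg_mult_self [simp]: "sg b * (sg b * r) = r"
  by (simp add: sg_def)

lemma sg_add: "sg (a + b) = sg a * sg b"
  by (cases a; cases b) (auto simp: sg_def)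

lemma sg_inject: "sg a = sg b \<longleftrightarrow> a = b"
  by (cases a; cases b) (auto simp: sg_def)

abbreviation labels :: "M_index \<Rightarrow> nat set set" where
  "labels i \<equiv> internal_edges (fst i)"

abbreviation M_cells :: "nat \<Rightarrow> M_index set" where
  "M_cells n \<equiv> PF n \<times> Z2L n"

text \<open>Outside \<open>L\<close> the value of \<open>posn\<close> is the same for all cells, as elements of \<^term>\<open>Z2L n\<close> are extensional.\<close>

definition posn :: "M_index \<Rightarrow> (nat set \<Rightarrow> real) \<Rightarrow> nat set \<Rightarrow> real" where
  "posn i x T = sg (snd i T) * (if T \<in> labels i then x T else 1)"

text \<open>The sum is taken modulo 2 over all labels, whether or not they are edges of the forest,
  which makes it insensitive to collapsing.\<close>

definition ordn :: "nat \<Rightarrow> M_index \<Rightarrow> nat \<Rightarrow> nat \<Rightarrow> bit" where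
  "ordn n i a b =
     of_bool (before (flat (fst i)) a b) + (\<Sum>T | T \<in> Lsets n \<and> a \<in> T \<and> b \<in> T. snd i T)"

text \<open>Labels are required to satisfy \<open>\<bar>posn i x e\<bar> < 1\<close>, which forces
  \<open>e\<close> to be an internal edge; thus the set of recorded pairs is itself a function of
  the position. All other pairs get the value 0, so that the invariants can be compared as
  functions.\<close>

definition inv_pt ::
  "nat \<Rightarrow> M_index \<times> (nat set \<Rightarrow> real) \<Rightarrow> (nat set \<Rightarrow> real) \<times> (nat \<Rightarrow> nat \<Rightarrow> bit)" where
  "inv_pt n = (\<lambda>(i, x). (posn i x,
     \<lambda>a b. if a \<noteq> b \<and> (\<exists>e. \<bar>posn i x e\<bar> < 1 \<and> a \<in> e \<and> b \<in> e) then ordn n i a b else 0))"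

lemma inv_pt_eq_iff:
  "inv_pt n (i, x) = inv_pt n (j, y) \<longleftrightarrow> posn i x = posn j y \<and>
    (\<forall>e a b. \<bar>posn i x e\<bar> < 1 \<longrightarrow> a \<in> e \<longrightarrow> b \<in> e \<longrightarrow> a \<noteq> b \<longrightarrow> ordn n i a b = ordn n j a b)"
  (is "?l \<longleftrightarrow> ?r")
proof
  assume l: ?l
  then have p: "posn i x = posn j y" by (simp add: inv_pt_def)
  moreover have "ordn n i a b = ordn n j a b"
    if "\<bar>posn i x e\<bar> < 1" "a \<in> e" "b \<in> e" "a \<noteq> b" for e a b
  proof -
    have ex: "\<exists>e. \<bar>posn j y e\<bar> < 1 \<and> a \<in> e \<and> b \<in> e" using that p by auto
    have "snd (inv_pt n (i, x)) a b = snd (inv_pt n (j, y)) a b" using l by simp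
    then show ?thesis using that(4) ex p by (simp add: inv_pt_def)
  qed
  ultimately show ?r by blast
next
  assume r: ?r
  then have p: "posn i x = posn j y" by simp
  have "(if a \<noteq> b \<and> (\<exists>e. \<bar>posn i x e\<bar> < 1 \<and> a \<in> e \<and> b \<in> e) then ordn n i a b else 0) =
     (if a \<noteq> b \<and> (\<exists>e. \<bar>posn i x e\<bar> < 1 \<and> a \<in> e \<and> b \<in> e) then ordn n j a b else 0)" for a b
    using r by auto
  then show ?l using p unfolding inv_pt_def by auto
qed

lemma finite_Lsets [simp]: "finite (Lsets n)"
  by (rule finite_subset[of _ "Pow {1..n}"]) (auto simp: Lsets_def)

lemma internal_edges_Lsets: "\<tau> \<in> PF n \<Longrightarrow> internal_edges \<tau> \<subseteq> Lsets n"
  using internal_edge_subset[of _ \<tau>] two_le_card_internal_edge[of \<tau>]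
  by (auto simp: PF_iff Lsets_def)

lemma Z2L_fun_upd: "s \<in> Z2L n \<Longrightarrow> e \<in> Lsets n \<Longrightarrow> s(e := b) \<in> Z2L n"
  by (auto simp: Z2L_def PiE_def extensional_def)

lemma Z2L_eqI: "s \<in> Z2L n \<Longrightarrow> s' \<in> Z2L n \<Longrightarrow> (\<And>T. T \<in> Lsets n \<Longrightarrow> s T = s' T) \<Longrightarrow> s = s'"
  unfolding Z2L_def by (rule PiE_ext)

lemma restrict_Z2L [simp]: "restrict f (Lsets n) \<in> Z2L n"
  by (simp add: Z2L_def)

lemma finite_Z2L: "finite (Z2L n)"
  unfolding Z2L_def
proof (rule finite_PiE)
  have "(UNIV :: bit set) = {0, 1}" using bit.exhaust by blast
  then show "finite (UNIV :: bit set)" by (metis finite.emptyI finite.insertI)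
qed simp

lemma reverse_PF: "\<tau> \<in> PF n \<Longrightarrow> reverse e \<tau> \<in> PF n"
  by (simp add: PF_iff branching_reverse distinct_flat_reverse)

lemma collapse_PF: "\<tau> \<in> PF n \<Longrightarrow> collapse e \<tau> \<in> PF n"
  by (simp add: PF_iff branching_collapse)

lemma internal_edges_collapse_PF:
  "\<tau> \<in> PF n \<Longrightarrow> internal_edges (collapse e \<tau>) = internal_edges \<tau> - {e}"
  by (simp add: PF_iff internal_edges_collapse)

lemma internal_edges_permute: "mset \<tau>' = mset \<tau> \<Longrightarrow> internal_edges \<tau>' = internal_edges \<tau>"
  using internal_edges_set[of \<tau>] internal_edges_set[of \<tau>'] by (metis set_mset_mset)

lemma mset_flat: "mset (flat \<tau>) = \<Sum>\<^sub># (image_mset (mset \<circ> leaf_list) (mset \<tau>))"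
  by (induction \<tau>) (auto simp: flat_Cons)

lemma permute_PF: "\<tau> \<in> PF n \<Longrightarrow> mset \<tau>' = mset \<tau> \<Longrightarrow> \<tau>' \<in> PF n"
proof -
  assume \<tau>: "\<tau> \<in> PF n" and m: "mset \<tau>' = mset \<tau>"
  then have "mset (flat \<tau>') = mset (flat \<tau>)" by (simp add: mset_flat)
  then have "distinct (flat \<tau>') = distinct (flat \<tau>)" "set (flat \<tau>') = set (flat \<tau>)"
    using mset_eq_imp_distinct_iff mset_eq_setD by blast+
  moreover have "branching \<tau>'"
    using \<tau> mset_eq_setD[OF m] branching_subset[of \<tau> \<tau>'] by (simp add: PF_iff)
  ultimately show ?thesis using \<tau> by (simp add: PF_iff)
qed

section \<open>Invariance under the gluings\<close>

lemma ordn_reverse: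
  assumes "\<tau> \<in> PF n" "e \<in> internal_edges \<tau>" "a \<noteq> b"
  shows "ordn n (reverse e \<tau>, s(e := s e + 1)) a b = ordn n (\<tau>, s) a b"
proof -
  let ?A = "{T \<in> Lsets n. a \<in> T \<and> b \<in> T}"
  have b: "branching \<tau>" "distinct (flat \<tau>)" using assms(1) by (auto simp: PF_iff)
  have e: "e \<in> Lsets n" "e \<subseteq> set (flat \<tau>)"
    using assms(1,2) internal_edges_Lsets internal_edge_subset by auto
  show ?thesis
  proof (cases "a \<in> e \<and> b \<in> e")
    case True
    then have "e \<in> ?A" using e by simp
    have fin: "finite ?A" by simp
    have r: "sum s ?A = s e + sum s (?A - {e})" by (rule sum.remove[OF fin \<open>e \<in> ?A\<close>])
    have "sum (s(e := s e + 1)) ?A = (s e + 1) + sum (s(e := s e + 1)) (?A - {e})"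
      using sum.remove[OF fin \<open>e \<in> ?A\<close>, of "s(e := s e + 1)"] by simp
    also have "sum (s(e := s e + 1)) (?A - {e}) = sum s (?A - {e})" by (rule sum.cong) auto
    also have "(s e + 1) + sum s (?A - {e}) = 1 + sum s ?A"
      unfolding r by (simp only: add.assoc add.left_commute add.commute)
    finally have 1: "sum (s(e := s e + 1)) ?A = 1 + sum s ?A" .
    have "before (flat (reverse e \<tau>)) a b \<longleftrightarrow> \<not> before (flat \<tau>) a b"
      using before_flat_reverse[OF b assms(2), of a b] before_swap[OF b(2) _ _ assms(3)] True e(2) by auto
    then show ?thesis using 1 by (cases "before (flat \<tau>) a b") (simp_all add: ordn_def del: fun_upd_apply)
  next
    case False
    then have "sum (s(e := s e + 1)) ?A = sum s ?A" by (intro sum.cong) auto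
    moreover have "before (flat (reverse e \<tau>)) a b \<longleftrightarrow> before (flat \<tau>) a b"
      using before_flat_reverse[OF b assms(2), of a b] unfolding if_not_P[OF False] .
    ultimately show ?thesis by (simp only: ordn_def fst_conv snd_conv)
  qed
qed

lemma posn_reverse:
  "e \<in> internal_edges \<tau> \<Longrightarrow> posn (reverse e \<tau>, s(e := s e + 1)) (t(e := - t e)) = posn (\<tau>, s) t"
  by (rule ext) (auto simp: posn_def sg_add)

lemma ordn_collapse [simp]: "ordn n (collapse e \<tau>, s) a b = ordn n (\<tau>, s) a b"
  by (simp add: ordn_def)

lemma posn_collapse:
  "\<tau> \<in> PF n \<Longrightarrow> e \<in> internal_edges \<tau> \<Longrightarrow> t e = 1 \<Longrightarrow>
    posn (collapse e \<tau>, s) (restrict t (internal_edges \<tau> - {e})) = posn (\<tau>, s) t"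
  using internal_edges_collapse_PF[of \<tau> n e] by (simp add: posn_def fun_eq_iff restrict_apply)

lemma posn_permute: "mset \<tau>' = mset \<tau> \<Longrightarrow> posn (\<tau>', s) t = posn (\<tau>, s) t"
  using internal_edges_permute[of \<tau>' \<tau>] by (simp add: posn_def fun_eq_iff)

lemma posn_less_1: "\<bar>posn i x e\<bar> < 1 \<longleftrightarrow> e \<in> labels i \<and> \<bar>x e\<bar> < 1"
  by (auto simp: posn_def abs_mult)

text \<open>Leaves above a common internal edge belong to one tree, and permuting whole trees does
  not touch the order inside it.\<close>

lemma ordn_permute:
  assumes "\<tau> \<in> PF n" "mset \<tau>' = mset \<tau>" "e \<in> internal_edges \<tau>" "a \<in> e" "b \<in> e"
  shows "ordn n (\<tau>', s) a b = ordn n (\<tau>, s) a b"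
proof -
  obtain t where t: "t \<in> set \<tau>" "e \<in> internal_edges [t]" using assms(3) internal_edges_set by blast
  then have ab: "a \<in> leaves t" "b \<in> leaves t"
    using internal_edge_subset[OF t(2)] assms(4,5) by (auto simp: leaf_list_eq_flat)
  have "t \<in> set \<tau>'" using t(1) mset_eq_setD[OF assms(2)] by simp
  moreover have "distinct (flat \<tau>)" "distinct (flat \<tau>')"
    using assms(1) permute_PF[OF assms(1,2)] by (auto simp: PF_iff)
  ultimately have "before (flat \<tau>') a b \<longleftrightarrow> before (flat \<tau>) a b"
    using before_flat_tree[OF _ _ ab] t(1) by blast
  then show ?thesis by (simp add: ordn_def)
qed

text \<open>At \<open>t e = 0\<close> the reflected point is \<open>t\<close> itself and this is the
  third gluing of \<open>M_glue\<close>. The case of arbitrary \<open>t\<close> serves to lift the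
  reflections in \<open>Dhat_glue\<close>.\<close>

lemma inv_pt_reverse:
  assumes "\<tau> \<in> PF n" "e \<in> internal_edges \<tau>"
  shows "inv_pt n ((reverse e \<tau>, s(e := s e + 1)), t(e := - t e)) = inv_pt n ((\<tau>, s), t)"
  unfolding inv_pt_eq_iff using ordn_reverse[OF assms] posn_reverse[OF assms(2)] by simp

lemma inv_pt_collapse:
  assumes "\<tau> \<in> PF n" "e \<in> internal_edges \<tau>" "t e = 1"
  shows "inv_pt n ((collapse e \<tau>, s), restrict t (internal_edges \<tau> - {e})) = inv_pt n ((\<tau>, s), t)"
  unfolding inv_pt_eq_iff using posn_collapse[of \<tau> n e t s, OF assms] by simp

lemma inv_pt_permute:
  assumes "\<tau> \<in> PF n" "mset \<tau>' = mset \<tau>"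
  shows "inv_pt n ((\<tau>', s), t) = inv_pt n ((\<tau>, s), t)"
  unfolding inv_pt_eq_iff using posn_permute[OF assms(2)] ordn_permute[OF assms]
  by (auto simp: posn_less_1)

lemma topspace_cube_topology [simp]: "topspace (cube_topology E) = cube E"
  by (simp add: cube_topology_def cube_def)

lemma pos_cube_subset: "pos_cube E \<subseteq> cube E"
  unfolding pos_cube_def cube_def by (rule PiE_mono) auto

lemma topspace_M_sum:
  "topspace (M_sum n) = (SIGMA i : M_cells n. pos_cube (labels i))"
proof -
  have "cube E \<inter> pos_cube E = pos_cube E" for E :: "nat set set"
    using pos_cube_subset[of E] by (rule Int_absorb1)
  then show ?thesis by (auto simp: M_sum_def)
qed

lemma pos_cube_restrict: "t \<in> pos_cube E \<Longrightarrow> restrict t (E - D) \<in> pos_cube (E - D)"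
  unfolding pos_cube_def restrict_PiE_iff by (auto dest: PiE_mem)

lemma M_glue_D:
  assumes "(x, y) \<in> M_glue n"
  shows "x \<in> topspace (M_sum n)" "y \<in> topspace (M_sum n)" "inv_pt n x = inv_pt n y"
proof -
  have "x \<in> topspace (M_sum n) \<and> y \<in> topspace (M_sum n) \<and> inv_pt n x = inv_pt n y"
    using assms unfolding M_glue_def
  proof (elim UnE CollectE exE conjE, goal_cases)
    case c: (1 \<tau> s t e)
    have "restrict t (internal_edges \<tau> - {e}) \<in> pos_cube (internal_edges (collapse e \<tau>))"
      unfolding internal_edges_collapse_PF[OF c(2)] using pos_cube_restrict[OF c(4)] .
    then show ?case
      using c(1-4) inv_pt_collapse[OF c(2,5), where t = t and s = s, OF c(6)] collapse_PF[OF c(2), of e]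
      by (simp add: topspace_M_sum)
  next
    case p: (2 \<tau> \<tau>' s t)
    then show ?case
      using inv_pt_permute[OF p(2,5), of s t] permute_PF[OF p(2,5)] internal_edges_permute[OF p(5)]
      by (simp add: topspace_M_sum)
  next
    case r: (3 \<tau> s t e)
    have t: "t(e := - t e) = t" using r(6) by auto
    have "e \<in> Lsets n" using r(5) internal_edges_Lsets[OF r(2)] by blast
    then have "s(e := s e + 1) \<in> Z2L n" using Z2L_fun_upd r(3) by blast
    then show ?case
      using r(1-4) inv_pt_reverse[OF r(2,5), of s t] reverse_PF[OF r(2), of e] unfolding t
      by (simp add: topspace_M_sum del: fun_upd_apply)
  qed
  then show "x \<in> topspace (M_sum n)" "y \<in> topspace (M_sum n)" "inv_pt n x = inv_pt n y" by auto
qed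

lemma M_glue_collapse:
  assumes "\<tau> \<in> PF n" "s \<in> Z2L n" "t \<in> pos_cube (internal_edges \<tau>)" "e \<in> internal_edges \<tau>" "t e = 1"
  shows "(((\<tau>, s), t), ((collapse e \<tau>, s), restrict t (internal_edges \<tau> - {e}))) \<in> M_glue n"
  unfolding M_glue_def
  by (rule UnI1, rule UnI1, rule CollectI, intro exI conjI, rule refl) (rule assms)+

lemma M_glue_permute:
  assumes "\<tau> \<in> PF n" "s \<in> Z2L n" "t \<in> pos_cube (internal_edges \<tau>)" "mset \<tau>' = mset \<tau>"
  shows "(((\<tau>, s), t), ((\<tau>', s), t)) \<in> M_glue n"
  unfolding M_glue_def
  by (rule UnI1, rule UnI2, rule CollectI, intro exI conjI, rule refl) (rule assms)+

lemma M_glue_reverse: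
  assumes "\<tau> \<in> PF n" "s \<in> Z2L n" "t \<in> pos_cube (internal_edges \<tau>)" "e \<in> internal_edges \<tau>" "t e = 0"
  shows "(((\<tau>, s), t), ((reverse e \<tau>, s(e := s e + 1)), t)) \<in> M_glue n"
  unfolding M_glue_def
  by (rule UnI2, rule CollectI, intro exI conjI, rule refl) (rule assms)+

section \<open>Completeness of the invariants\<close>

abbreviation M_rel :: "nat \<Rightarrow> (M_index \<times> (nat set \<Rightarrow> real)) rel" where
  "M_rel n \<equiv> (M_glue n \<union> (M_glue n)\<inverse>)\<^sup>*"

lemma M_rel_sym: "(x, y) \<in> M_rel n \<Longrightarrow> (y, x) \<in> M_rel n"
  by (metis converse_Un converse_converse rtrancl_converseD sup_commute)

lemma M_rel_inv: "(x, y) \<in> M_rel n \<Longrightarrow> inv_pt n x = inv_pt n y"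
  using rtrancl_invariant[of x y "M_glue n" "inv_pt n"] M_glue_D(3) by blast

text \<open>A normal form: when no coordinate is 1, the internal edges are precisely the labels
  whose position has absolute value less than 1, so they can be read off from the
  invariants.\<close>

lemma M_rel_collapse_all:
  assumes "\<tau> \<in> PF n" "s \<in> Z2L n" "t \<in> pos_cube (internal_edges \<tau>)"
  shows "\<exists>\<sigma> u. (((\<tau>, s), t), ((\<sigma>, s), u)) \<in> M_rel n \<and> \<sigma> \<in> PF n \<and>
    u \<in> pos_cube (internal_edges \<sigma>) \<and> (\<forall>e\<in>internal_edges \<sigma>. u e < 1)"
  using assms
proof (induction "card (internal_edges \<tau>)" arbitrary: \<tau> t rule: less_induct)
  case less
  show ?case
  proof (cases "\<forall>e\<in>internal_edges \<tau>. t e < 1")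
    case True
    then show ?thesis using less.prems by blast
  next
    case False
    then obtain e where e: "e \<in> internal_edges \<tau>" "\<not> t e < 1" by blast
    have "t e \<in> {0..1}" using less.prems(3) e(1) unfolding pos_cube_def by (rule PiE_mem)
    then have te: "t e = 1" using e(2) by simp
    let ?y = "((collapse e \<tau>, s), restrict t (internal_edges \<tau> - {e}))"
    have "(((\<tau>, s), t), ?y) \<in> M_glue n"
      using M_glue_collapse[OF less.prems e(1) te] .
    then have step: "(((\<tau>, s), t), ?y) \<in> M_rel n" by blast
    have E: "internal_edges (collapse e \<tau>) = internal_edges \<tau> - {e}"
      by (rule internal_edges_collapse_PF[OF less.prems(1)])
    have "card (internal_edges (collapse e \<tau>)) < card (internal_edges \<tau>)"
      unfolding E using e(1) by (intro card_Diff1_less) auto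
    moreover have "restrict t (internal_edges \<tau> - {e}) \<in> pos_cube (internal_edges (collapse e \<tau>))"
      unfolding E using pos_cube_restrict[OF less.prems(3)] .
    ultimately obtain \<sigma> u where "(?y, ((\<sigma>, s), u)) \<in> M_rel n" "\<sigma> \<in> PF n"
      "u \<in> pos_cube (internal_edges \<sigma>)" "\<forall>e\<in>internal_edges \<sigma>. u e < 1"
      using less.hyps[OF _ collapse_PF[OF less.prems(1)] less.prems(2)] by blast
    then show ?thesis using rtrancl_trans[OF step] by blast
  qed
qed

text \<open>The bits are corrected one at a time: where the coordinate is 0, the third gluing
  changes one bit and keeps both the point \<open>t\<close> and the set of edges.\<close>

lemma M_rel_reverse_all:
  assumes "\<tau> \<in> PF n" "s \<in> Z2L n" "s' \<in> Z2L n" "t \<in> pos_cube (internal_edges \<tau>)"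
    and "\<And>e. s e \<noteq> s' e \<Longrightarrow> e \<in> internal_edges \<tau> \<and> t e = 0"
  shows "\<exists>\<sigma>\<in>PF n. (((\<tau>, s), t), ((\<sigma>, s'), t)) \<in> M_rel n \<and> internal_edges \<sigma> = internal_edges \<tau>"
  using assms
proof (induction "card {e. s e \<noteq> s' e}" arbitrary: \<tau> s rule: less_induct)
  case less
  have fin: "finite {e. s e \<noteq> s' e}"
    by (rule finite_subset[OF _ finite_internal_edges[of \<tau>]]) (use less.prems(5) in auto)
  show ?case
  proof (cases "s = s'")
    case True
    then show ?thesis using less.prems by blast
  next
    case False
    then obtain e where e: "s e \<noteq> s' e" by auto
    have e': "e \<in> internal_edges \<tau>" "t e = 0" using less.prems(5)[OF e] by auto
    let ?s = "s(e := s e + 1)"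
    have "(((\<tau>, s), t), ((reverse e \<tau>, ?s), t)) \<in> M_glue n"
      using M_glue_reverse[OF less.prems(1,2,4) e'] .
    then have step: "(((\<tau>, s), t), ((reverse e \<tau>, ?s), t)) \<in> M_rel n" by blast
    have se: "?s e = s' e" using e by (cases "s e"; cases "s' e") auto
    then have "{f. ?s f \<noteq> s' f} \<subset> {f. s f \<noteq> s' f}" using e by auto
    then have "card {f. ?s f \<noteq> s' f} < card {f. s f \<noteq> s' f}" by (rule psubset_card_mono[OF fin])
    moreover have "e \<in> Lsets n" using e' internal_edges_Lsets[OF less.prems(1)] by auto
    then have "?s \<in> Z2L n" using Z2L_fun_upd less.prems(2) by blast
    moreover have "f \<in> internal_edges (reverse e \<tau>) \<and> t f = 0" if "?s f \<noteq> s' f" for f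
    proof -
      have "s f \<noteq> s' f" using that se by (cases "f = e") auto
      then show ?thesis using less.prems(5)[of f] by simp
    qed
    moreover have "t \<in> pos_cube (internal_edges (reverse e \<tau>))" using less.prems(4) by simp
    ultimately obtain \<sigma> where \<sigma>: "\<sigma> \<in> PF n" "(((reverse e \<tau>, ?s), t), ((\<sigma>, s'), t)) \<in> M_rel n"
      "internal_edges \<sigma> = internal_edges (reverse e \<tau>)"
      using less.hyps[of ?s "reverse e \<tau>", OF _ reverse_PF[OF less.prems(1)] _ less.prems(3)] by blast
    have "(((\<tau>, s), t), ((\<sigma>, s'), t)) \<in> M_rel n" using rtrancl_trans[OF step \<sigma>(2)] .
    then show ?thesis using \<sigma>(1,3) by auto
  qed
qed

text \<open>In normal form the position determines the edges and, as coordinates are nonnegative,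
  the coordinates. The bits can differ only where the position is 0, and there they are made equal
  by reversals. With equal bits the twisted orders give the actual orders below each edge, so the
  forests agree up to a permutation.\<close>

lemma M_rel_complete:
  assumes "x \<in> topspace (M_sum n)" "y \<in> topspace (M_sum n)" "inv_pt n x = inv_pt n y"
  shows "(x, y) \<in> M_rel n"
proof -
  obtain \<tau> s t where x: "x = ((\<tau>, s), t)" "\<tau> \<in> PF n" "s \<in> Z2L n" "t \<in> pos_cube (internal_edges \<tau>)"
    using assms(1) by (auto simp: topspace_M_sum)
  obtain \<tau>' s' t' where y: "y = ((\<tau>', s'), t')" "\<tau>' \<in> PF n" "s' \<in> Z2L n"
      "t' \<in> pos_cube (internal_edges \<tau>')"
    using assms(2) by (auto simp: topspace_M_sum)
  obtain \<sigma> u where u: "(x, ((\<sigma>, s), u)) \<in> M_rel n" "\<sigma> \<in> PF n" "u \<in> pos_cube (internal_edges \<sigma>)"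
      "\<forall>e\<in>internal_edges \<sigma>. u e < 1"
    using M_rel_collapse_all[OF x(2-4)] x(1) by blast
  obtain \<sigma>' u' where u': "(y, ((\<sigma>', s'), u')) \<in> M_rel n" "\<sigma>' \<in> PF n" "u' \<in> pos_cube (internal_edges \<sigma>')"
      "\<forall>e\<in>internal_edges \<sigma>'. u' e < 1"
    using M_rel_collapse_all[OF y(2-4)] y(1) by blast
  have inv: "inv_pt n ((\<sigma>, s), u) = inv_pt n ((\<sigma>', s'), u')"
    using M_rel_inv[OF u(1)] M_rel_inv[OF u'(1)] assms(3) by simp
  then have pos: "posn (\<sigma>, s) u = posn (\<sigma>', s') u'" by (simp add: inv_pt_eq_iff)
  have nonneg: "0 \<le> u e" if "e \<in> internal_edges \<sigma>" for e
    using u(3) that by (auto simp: pos_cube_def)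
  have nonneg': "0 \<le> u' e" if "e \<in> internal_edges \<sigma>'" for e
    using u'(3) that by (auto simp: pos_cube_def)
  have E: "internal_edges \<sigma>' = internal_edges \<sigma>"
  proof -
    have "e \<in> internal_edges \<sigma> \<longleftrightarrow> \<bar>posn (\<sigma>, s) u e\<bar> < 1" for e
      using u(4) nonneg by (auto simp: posn_less_1)
    moreover have "e \<in> internal_edges \<sigma>' \<longleftrightarrow> \<bar>posn (\<sigma>', s') u' e\<bar> < 1" for e
      using u'(4) nonneg' by (auto simp: posn_less_1)
    ultimately show ?thesis using pos by auto
  qed
  have abs: "u e = \<bar>posn (\<sigma>, s) u e\<bar>" "u' e = \<bar>posn (\<sigma>', s') u' e\<bar>" if "e \<in> internal_edges \<sigma>" for e
    using nonneg nonneg' that E by (auto simp: posn_def abs_mult)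
  have tt: "u = u'"
  proof (rule PiE_ext)
    show "u \<in> (\<Pi>\<^sub>E e\<in>internal_edges \<sigma>. {0..1})" using u(3) by (simp add: pos_cube_def)
    show "u' \<in> (\<Pi>\<^sub>E e\<in>internal_edges \<sigma>. {0..1})" using u'(3) E by (simp add: pos_cube_def)
  qed (use abs pos in simp)
  \<comment> \<open>Different bits give opposite signs, so the common position is 0; on a label that
    is not an edge the position is the sign itself, which is never 0.\<close>
  have diff: "e \<in> internal_edges \<sigma> \<and> u e = 0" if ne: "s e \<noteq> s' e" for e
  proof -
    have eq: "posn (\<sigma>, s) u e = posn (\<sigma>', s') u' e" using pos by simp
    show ?thesis
    proof (cases "e \<in> internal_edges \<sigma>")
      case True
      then have "sg (s e) * u e = sg (s' e) * u e" using eq E tt by (simp add: posn_def)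
      then show ?thesis using ne True by (simp add: sg_inject)
    next
      case False
      then show ?thesis using eq E ne by (simp add: posn_def sg_inject)
    qed
  qed
  obtain \<rho> where \<rho>: "\<rho> \<in> PF n" "(((\<sigma>, s), u), ((\<rho>, s'), u)) \<in> M_rel n"
      "internal_edges \<rho> = internal_edges \<sigma>"
    using M_rel_reverse_all[OF u(2) x(3) y(3) u(3) diff] by blast
  have inv': "inv_pt n ((\<rho>, s'), u) = inv_pt n ((\<sigma>', s'), u')"
    using M_rel_inv[OF \<rho>(2)] inv by simp
  have "mset \<rho> = mset \<sigma>'"
  proof (rule mset_forest_eqI[OF \<rho>(1) u'(2)])
    show "internal_edges \<rho> = internal_edges \<sigma>'" using E \<rho>(3) by simp
    fix e a b assume e: "e \<in> internal_edges \<rho>" and ab: "a \<in> e" "b \<in> e"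
    show "before (flat \<rho>) a b \<longleftrightarrow> before (flat \<sigma>') a b"
    proof (cases "a = b")
      case True
      have "distinct (flat \<rho>)" "distinct (flat \<sigma>')" using \<rho>(1) u'(2) by (auto simp: PF_iff)
      then show ?thesis using True before_asym by metis
    next
      case False
      have "\<bar>posn (\<rho>, s') u e\<bar> < 1"
        using e \<rho>(3) u(4) nonneg[of e] by (simp add: posn_less_1)
      then have "ordn n (\<rho>, s') a b = ordn n (\<sigma>', s') a b"
        using inv' ab False unfolding inv_pt_eq_iff by blast
      then show ?thesis unfolding ordn_def fst_conv snd_conv add_right_cancel
        by (cases "before (flat \<rho>) a b"; cases "before (flat \<sigma>') a b") simp_all
    qed
  qed
  then have "(((\<rho>, s'), u), ((\<sigma>', s'), u)) \<in> M_glue n"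
    using M_glue_permute[OF \<rho>(1) y(3)] u(3) \<rho>(3) by simp
  then have "(((\<rho>, s'), u), ((\<sigma>', s'), u')) \<in> M_rel n" using tt by blast
  then have "(x, ((\<sigma>', s'), u')) \<in> M_rel n" using u(1) \<rho>(2) by (meson rtrancl_trans)
  then show ?thesis using M_rel_sym[OF u'(1)] by (meson rtrancl_trans)
qed

abbreviation M_class :: "nat \<Rightarrow> M_index \<times> (nat set \<Rightarrow> real) \<Rightarrow> (M_index \<times> (nat set \<Rightarrow> real)) set" where
  "M_class n \<equiv> gen_class (M_sum n) (M_glue n)"

lemma M_class_eq_iff:
  assumes "x \<in> topspace (M_sum n)" "y \<in> topspace (M_sum n)"
  shows "M_class n x = M_class n y \<longleftrightarrow>
    inv_pt n x = inv_pt n y"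
  using gen_class_eq_iff[OF assms, of "M_glue n"] M_rel_inv M_rel_complete[OF assms] by blast

lemma M_class_eq:
  assumes "x \<in> topspace (M_sum n)"
  shows "M_class n x = {y \<in> topspace (M_sum n). inv_pt n y = inv_pt n x}"
proof (rule set_eqI)
  fix y
  show "y \<in> M_class n x \<longleftrightarrow> y \<in> {y \<in> topspace (M_sum n). inv_pt n y = inv_pt n x}"
    using mem_gen_class[OF assms, of y "M_glue n"] M_rel_inv[of x y n] M_rel_complete[OF assms, of y]
    by auto
qed

subsection \<open>Characteristic maps\<close>

lemma reverse_all_insert:
  "finite N \<Longrightarrow> e \<notin> N \<Longrightarrow> reverse_all (insert e N) \<tau> = reverse e (reverse_all N \<tau>)"
proof -
  interpret comp_fun_commute reverse by (rule comp_fun_commute_reverse)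
  show "finite N \<Longrightarrow> e \<notin> N \<Longrightarrow> reverse_all (insert e N) \<tau> = reverse e (reverse_all N \<tau>)"
    by (simp add: reverse_all_def)
qed

text \<open>The index of the positive subcube that \<open>M_chart\<close> uses for the orthant with
  negative coordinates \<open>N\<close>.\<close>

definition flip :: "nat \<Rightarrow> nat set set \<Rightarrow> M_index \<Rightarrow> M_index" where
  "flip n N i = (reverse_all N (fst i), \<lambda>S\<in>Lsets n. snd i S + of_bool (S \<in> N))"

lemma flip_props:
  assumes "finite N" "N \<subseteq> internal_edges \<tau>" "\<tau> \<in> PF n" "s \<in> Z2L n"
  shows "reverse_all N \<tau> \<in> PF n \<and> internal_edges (reverse_all N \<tau>) = internal_edges \<tau> \<and>
    (\<forall>a b. a \<noteq> b \<longrightarrow> ordn n (flip n N (\<tau>, s)) a b = ordn n (\<tau>, s) a b)"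
  using assms
proof (induction N rule: finite_induct)
  case empty
  have "(\<lambda>S\<in>Lsets n. s S + of_bool (S \<in> {})) = s"
    by (rule Z2L_eqI[OF restrict_Z2L assms(4)]) simp
  then have "flip n {} (\<tau>, s) = (\<tau>, s)"
    by (simp only: flip_def fst_conv snd_conv reverse_all_def Finite_Set.fold_empty)
  then show ?case using empty by (simp add: reverse_all_def)
next
  case (insert e N)
  then have IH: "reverse_all N \<tau> \<in> PF n" "internal_edges (reverse_all N \<tau>) = internal_edges \<tau>"
    "\<forall>a b. a \<noteq> b \<longrightarrow> ordn n (flip n N (\<tau>, s)) a b = ordn n (\<tau>, s) a b" by auto
  let ?s = "\<lambda>S\<in>Lsets n. s S + of_bool (S \<in> N)"
  have e: "e \<in> internal_edges (reverse_all N \<tau>)" using insert.prems(1) IH(2) by simp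
  then have "e \<in> Lsets n" using internal_edges_Lsets[OF IH(1)] by auto
  then have "?s(e := ?s e + 1) = (\<lambda>S\<in>Lsets n. s S + of_bool (S \<in> insert e N))"
    using insert.hyps(2) by (auto simp: fun_eq_iff restrict_def)
  then have "flip n (insert e N) (\<tau>, s) = (reverse e (reverse_all N \<tau>), ?s(e := ?s e + 1))"
    by (simp add: flip_def reverse_all_insert[OF insert.hyps])
  moreover have "flip n N (\<tau>, s) = (reverse_all N \<tau>, ?s)" by (simp add: flip_def)
  ultimately have "ordn n (flip n (insert e N) (\<tau>, s)) a b = ordn n (flip n N (\<tau>, s)) a b"
    if "a \<noteq> b" for a b
    using ordn_reverse[OF IH(1) e that, of ?s] by simp
  then show ?case using IH reverse_PF[OF IH(1), of e] by (simp add: reverse_all_insert[OF insert.hyps])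
qed

lemma flip_index:
  assumes "i \<in> M_cells n" "N \<subseteq> labels i"
  shows "flip n N i \<in> M_cells n" "labels (flip n N i) = labels i"
    "a \<noteq> b \<Longrightarrow> ordn n (flip n N i) a b = ordn n i a b"
    "posn (flip n N i) (\<lambda>e\<in>labels i. if e \<in> N then - x e else x e) = posn i x"
proof -
  obtain \<tau> s where i: "i = (\<tau>, s)" "\<tau> \<in> PF n" "s \<in> Z2L n" using assms(1) by auto
  have fin: "finite N" using assms(2) finite_subset finite_internal_edges by blast
  have props: "reverse_all N \<tau> \<in> PF n" "internal_edges (reverse_all N \<tau>) = internal_edges \<tau>"
    "\<forall>a b. a \<noteq> b \<longrightarrow> ordn n (flip n N (\<tau>, s)) a b = ordn n (\<tau>, s) a b"
    using flip_props[OF fin _ i(2,3)] assms(2) i(1) by auto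
  show "flip n N i \<in> M_cells n" "labels (flip n N i) = labels i"
    "a \<noteq> b \<Longrightarrow> ordn n (flip n N i) a b = ordn n i a b"
    using props i(1) by (auto simp: flip_def)
  have L: "internal_edges \<tau> \<subseteq> Lsets n" by (rule internal_edges_Lsets[OF i(2)])
  show "posn (flip n N i) (\<lambda>e\<in>labels i. if e \<in> N then - x e else x e) = posn i x"
  proof
    fix T
    consider "T \<in> internal_edges \<tau>" | "T \<notin> internal_edges \<tau>" "T \<in> Lsets n" | "T \<notin> Lsets n" by blast
    then show "posn (flip n N i) (\<lambda>e\<in>labels i. if e \<in> N then - x e else x e) T = posn i x T"
    proof cases
      case 1
      then have "T \<in> Lsets n" using L by auto
      then show ?thesis using 1 props(2) i(1) by (simp add: posn_def flip_def sg_add)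
    next
      case 2
      then have "T \<notin> N" using assms(2) i(1) by auto
      then show ?thesis using 2 props(2) i(1) by (simp add: posn_def flip_def)
    next
      \<comment> \<open>Outside \<open>Lsets n\<close> both bit functions take the value
        \<open>undefined\<close> by extensionality, so the signs agree there too.\<close>
      case 3
      then have "T \<notin> internal_edges \<tau>" using L by auto
      moreover have "s T = undefined" using 3 i(3) by (auto simp: Z2L_def PiE_def extensional_def)
      ultimately show ?thesis using 3 props(2) i(1) by (simp add: posn_def flip_def)
    qed
  qed
qed

text \<open>The chart moves a point to a positive subcube by reflecting its negative coordinates,
  which preserves position and twisted orders. Hence the invariants of a point of \<open>M_n\<close>
  can be computed in the assembled cube, without choosing an orthant.\<close>

lemma M_chart_eq_class:
  assumes "i \<in> M_cells n" "x \<in> cube (labels i)"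
  shows "\<exists>j u. (j, u) \<in> topspace (M_sum n) \<and> inv_pt n (j, u) = inv_pt n (i, x) \<and>
    M_chart n i x = M_class n (j, u)"
proof -
  define N where "N = {e \<in> labels i. x e < 0}"
  have N: "N \<subseteq> labels i" by (auto simp: N_def)
  let ?u = "\<lambda>e\<in>labels i. \<bar>x e\<bar>"
  have u: "?u = (\<lambda>e\<in>labels i. if e \<in> N then - x e else x e)"
    by (auto simp: N_def fun_eq_iff)
  have M: "M_chart n i x = M_class n (flip n N i, ?u)"
    by (cases i) (simp add: M_chart_def M_pt_def flip_def N_def Let_def)
  have "?u \<in> pos_cube (labels i)"
    using assms(2) by (auto simp: cube_def pos_cube_def PiE_def Pi_def abs_le_iff)
  then have "(flip n N i, ?u) \<in> topspace (M_sum n)"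
    using flip_index(1,2)[OF assms(1) N] by (simp add: topspace_M_sum)
  moreover have "inv_pt n (flip n N i, ?u) = inv_pt n (i, x)"
    unfolding inv_pt_eq_iff u using flip_index(3,4)[OF assms(1) N] by simp
  ultimately show ?thesis using M by blast
qed

lemma M_chart_eq_iff:
  assumes "i \<in> M_cells n" "x \<in> cube (labels i)"
    and "j \<in> M_cells n" "y \<in> cube (labels j)"
  shows "M_chart n i x = M_chart n j y \<longleftrightarrow> inv_pt n (i, x) = inv_pt n (j, y)"
proof -
  obtain i' x' where x: "(i', x') \<in> topspace (M_sum n)" "inv_pt n (i', x') = inv_pt n (i, x)"
      "M_chart n i x = M_class n (i', x')"
    using M_chart_eq_class[OF assms(1,2)] by blast
  obtain j' y' where y: "(j', y') \<in> topspace (M_sum n)" "inv_pt n (j', y') = inv_pt n (j, y)"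
      "M_chart n j y = M_class n (j', y')"
    using M_chart_eq_class[OF assms(3,4)] by blast
  show ?thesis using M_class_eq_iff[OF x(1) y(1)] x y by simp
qed

lemma M_pt_eq_chart:
  assumes "i \<in> M_cells n" "t \<in> pos_cube (labels i)"
  shows "M_class n (i, t) = M_chart n i t"
proof -
  have "t \<in> cube (labels i)" using assms(2) pos_cube_subset by blast
  then obtain j u where "(j, u) \<in> topspace (M_sum n)" "inv_pt n (j, u) = inv_pt n (i, t)"
      "M_chart n i t = M_class n (j, u)"
    using M_chart_eq_class[OF assms(1)] by blast
  then show ?thesis using M_class_eq_iff[of "(i, t)" n "(j, u)"] assms by (simp add: topspace_M_sum)
qed

section \<open>The complexes are cube complexes\<close>

lemma corners_subset: "corners E \<subseteq> cube E"
  unfolding corners_def cube_def by (rule PiE_mono) auto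

lemma corners_D: "v \<in> corners E \<Longrightarrow> e \<in> E \<Longrightarrow> v e = -1 \<or> v e = 1"
  unfolding corners_def by (drule (1) PiE_mem) auto

lemma cube_D: "x \<in> cube E \<Longrightarrow> e \<in> E \<Longrightarrow> \<bar>x e\<bar> \<le> 1"
  unfolding cube_def by (drule (1) PiE_mem) auto

lemma cube_I: "x \<in> extensional E \<Longrightarrow> (\<And>e. e \<in> E \<Longrightarrow> \<bar>x e\<bar> \<le> 1) \<Longrightarrow> x \<in> cube E"
  unfolding cube_def by (force intro: PiE_I simp: abs_le_iff extensional_def)

lemma corners_I: "x \<in> extensional E \<Longrightarrow> (\<And>e. e \<in> E \<Longrightarrow> \<bar>x e\<bar> = 1) \<Longrightarrow> x \<in> corners E"
  unfolding corners_def by (force intro: PiE_I simp: extensional_def)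

lemma corners_abs: "v \<in> corners E \<Longrightarrow> e \<in> E \<Longrightarrow> \<bar>v e\<bar> = 1"
  using corners_D by fastforce

lemma cube_extensional: "x \<in> cube E \<Longrightarrow> x \<in> extensional E"
  by (simp add: cube_def PiE_def)

lemma face_subset: "face E v F \<subseteq> cube E"
  by (auto simp: face_def)

lemma L2_set_eq_support:
  assumes "finite A" "finite B" "F \<subseteq> A" "F \<subseteq> B"
    and "\<And>e. e \<in> A - F \<Longrightarrow> f e = 0" "\<And>e. e \<in> B - F \<Longrightarrow> g e = 0"
    and "\<And>e. e \<in> F \<Longrightarrow> (f e)\<^sup>2 = (g e)\<^sup>2"
  shows "L2_set f A = L2_set g B"
proof -
  have "(\<Sum>e\<in>A. (f e)\<^sup>2) = (\<Sum>e\<in>F. (f e)\<^sup>2)"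
    using assms by (intro sum.mono_neutral_right) auto
  also have "\<dots> = (\<Sum>e\<in>F. (g e)\<^sup>2)" using assms(7) by (rule sum.cong[OF refl])
  also have "\<dots> = (\<Sum>e\<in>B. (g e)\<^sup>2)"
    using assms by (intro sum.mono_neutral_left) auto
  finally show ?thesis by (simp add: L2_set_def)
qed

section \<open>Gluings of faces in \<open>M_n\<close>\<close>

lemma M_cx_simps [simp]:
  "space_of (M_cx n) = quotient_space (M_sum n) (M_glue n)" "cells (M_cx n) = M_cells n"
  "coords (M_cx n) i = labels i" "chart (M_cx n) = M_chart n"
  by (simp_all add: M_cx_def case_prod_beta)

text \<open>The map between two faces with free labels \<open>F\<close> that preserves positions: on
  \<open>F\<close> it is multiplication by the quotient of the two signs, and elsewhere it is forced
  to the values of the corner \<open>w\<close>.\<close>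

definition transfer ::
  "M_index \<Rightarrow> M_index \<Rightarrow> nat set set \<Rightarrow> (nat set \<Rightarrow> real) \<Rightarrow> (nat set \<Rightarrow> real) \<Rightarrow> nat set \<Rightarrow> real" where
  "transfer i j F w x =
     (\<lambda>T\<in>labels j. if T \<in> F then sg (snd i T) * sg (snd j T) * x T else w T)"

context
  fixes n i j v w F
  assumes ij: "i \<in> M_cells n" "j \<in> M_cells n"
    and vw: "v \<in> corners (labels i)" "w \<in> corners (labels j)"
    and F: "F \<subseteq> labels i" "F \<subseteq> labels j"
    and pos: "\<And>T. T \<notin> F \<Longrightarrow> posn i v T = posn j w T"
begin

lemma transfer_face:
  assumes x: "x \<in> face (labels i) v F"
  shows "transfer i j F w x \<in> face (labels j) w F"
    and "posn j (transfer i j F w x) = posn i x"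
proof -
  have xc: "x \<in> cube (labels i)" "\<And>e. e \<in> labels i - F \<Longrightarrow> x e = v e"
    using x by (auto simp: face_def)
  have "transfer i j F w x \<in> cube (labels j)"
  proof (rule cube_I)
    fix e assume e: "e \<in> labels j"
    show "\<bar>transfer i j F w x e\<bar> \<le> 1"
    proof (cases "e \<in> F")
      case True
      then show ?thesis using e F(1) cube_D[OF xc(1), of e] by (auto simp: transfer_def abs_mult)
    next
      case False
      then show ?thesis using e corners_abs[OF vw(2) e] by (simp add: transfer_def)
    qed
  qed (simp add: transfer_def)
  then show "transfer i j F w x \<in> face (labels j) w F"
    by (simp add: face_def transfer_def)
  show "posn j (transfer i j F w x) = posn i x"
  proof
    fix T
    show "posn j (transfer i j F w x) T = posn i x T"
    proof (cases "T \<in> F")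
      case True
      then have "T \<in> labels i" "T \<in> labels j" using F by auto
      then show ?thesis using True by (simp add: posn_def transfer_def sg_def)
    next
      case False
      then have "posn j (transfer i j F w x) T = posn j w T" by (simp add: posn_def transfer_def)
      also have "\<dots> = posn i v T" using pos[OF False] by simp
      also have "\<dots> = posn i x T" using xc(2)[of T] False by (simp add: posn_def)
      finally show ?thesis .
    qed
  qed
qed

lemma transfer_transfer:
  assumes y: "y \<in> face (labels j) w F"
  shows "transfer i j F w (transfer j i F v y) = y"
proof
  fix T
  have yc: "y \<in> extensional (labels j)"
      "\<And>e. e \<in> labels j - F \<Longrightarrow> y e = w e"
    using y cube_extensional by (auto simp: face_def)
  consider "T \<in> F" | "T \<notin> F" "T \<in> labels j" | "T \<notin> labels j" by blast
  then show "transfer i j F w (transfer j i F v y) T = y T"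
  proof cases
    case 1
    then have "T \<in> labels i" "T \<in> labels j" using F by auto
    then show ?thesis using 1 by (simp add: transfer_def sg_def)
  next
    case 2
    then show ?thesis using yc(2)[of T] by (simp add: transfer_def)
  next
    case 3
    then show ?thesis using yc(1) by (simp add: transfer_def extensional_def)
  qed
qed

end

text \<open>On a face only the free coordinates can lie strictly between -1 and 1, so agreement of
  positions off \<open>F\<close> and of twisted orders below labels in \<open>F\<close> gives equal
  invariants along the whole face. The map only changes signs of free coordinates, hence is an
  isometry.\<close>

lemma M_gluing:
  assumes ij: "i \<in> M_cells n" "j \<in> M_cells n"
    and vw: "v \<in> corners (labels i)" "w \<in> corners (labels j)"
    and F: "F \<subseteq> labels i" "F \<subseteq> labels j"
    and pos: "\<And>T. T \<notin> F \<Longrightarrow> posn i v T = posn j w T"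
    and ordn: "\<And>e a b. e \<in> F \<Longrightarrow> a \<in> e \<Longrightarrow> b \<in> e \<Longrightarrow> a \<noteq> b \<Longrightarrow> ordn n i a b = ordn n j a b"
  shows "gluing (M_cx n) i (face (labels i) v F) j (face (labels j) w F)
    (transfer i j F w)"
proof -
  let ?A = "face (labels i) v F" and ?B = "face (labels j) w F"
  let ?h = "transfer i j F w"
  have tf: "?h x \<in> ?B" "posn j (?h x) = posn i x" if "x \<in> ?A" for x
    by (rule transfer_face[OF ij vw F pos that]; assumption)+
  have tb: "transfer j i F v y \<in> ?A" if "y \<in> ?B" for y
    by (rule transfer_face(1)[OF ij(2,1) vw(2,1) F(2,1) _ that]) (simp add: pos)
  have "?h ` ?A = ?B"
  proof
    show "?h ` ?A \<subseteq> ?B" using tf(1) by auto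
    show "?B \<subseteq> ?h ` ?A"
    proof
      fix y assume y: "y \<in> ?B"
      have "y = ?h (transfer j i F v y)" by (rule transfer_transfer[OF ij vw F pos y, symmetric])
      then show "y \<in> ?h ` ?A" using tb[OF y] by (rule image_eqI)
    qed
  qed
  moreover have "L2_set (\<lambda>e. ?h x e - ?h y e) (labels j) =
      L2_set (\<lambda>e. x e - y e) (labels i)" if xy: "x \<in> ?A" "y \<in> ?A" for x y
  proof (rule L2_set_eq_support[OF _ _ F(2,1)])
    fix e
    show "?h x e - ?h y e = 0" if "e \<in> labels j - F"
      using that by (simp add: transfer_def)
    show "x e - y e = 0" if "e \<in> labels i - F"
      using that xy by (simp add: face_def)
    assume e: "e \<in> F"
    then have "e \<in> labels j" using F by auto
    then show "(?h x e - ?h y e)\<^sup>2 = (x e - y e)\<^sup>2"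
      using e by (auto simp: transfer_def sg_def power2_commute)
  qed simp_all
  moreover have "M_chart n j (?h x) = M_chart n i x" if x: "x \<in> ?A" for x
  proof -
    have "ordn n i a b = ordn n j a b" if e: "\<bar>posn i x e\<bar> < 1" "a \<in> e" "b \<in> e" "a \<noteq> b" for e a b
    proof (rule ordn[OF _ e(2-4)])
      have "e \<in> labels i" "\<bar>x e\<bar> < 1" using e(1) by (auto simp: posn_less_1)
      then show "e \<in> F" using x corners_abs[OF vw(1), of e] by (cases "e \<in> F") (auto simp: face_def)
    qed
    then have "inv_pt n (i, x) = inv_pt n (j, ?h x)"
      unfolding inv_pt_eq_iff tf(2)[OF x] by (intro conjI allI impI refl)
    then show ?thesis
      using M_chart_eq_iff[OF ij(1) subsetD[OF face_subset x] ij(2) subsetD[OF face_subset tf(1)[OF x]]]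
      by simp
  qed
  moreover have "is_face (labels i) ?A" "is_face (labels j) ?B"
    unfolding is_face_def using vw F by blast+
  ultimately show ?thesis unfolding gluing_def using ij by simp
qed

text \<open>Each of the points lies in the interior of a face whose free labels are the
  \<open>e\<close> with \<open>\<bar>posn i x e\<bar> < 1\<close>. These labels agree for the two
  points, and a single gluing of the two faces identifies them.\<close>

lemma M_chart_eq_imp_glue:
  assumes ij: "i \<in> M_cells n" "j \<in> M_cells n"
    and x: "x \<in> cube (labels i)" and y: "y \<in> cube (labels j)"
    and eq: "M_chart n i x = M_chart n j y"
  shows "((i, x), (j, y)) \<in> glue (M_cx n)"
proof -
  have inv: "inv_pt n (i, x) = inv_pt n (j, y)" using eq M_chart_eq_iff[OF ij(1) x ij(2) y] by simp
  then have pos: "posn i x = posn j y" by (simp add: inv_pt_eq_iff)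
  define F where "F = {e. \<bar>posn i x e\<bar> < 1}"
  have "F \<subseteq> labels i" by (auto simp: F_def posn_less_1)
  moreover have "F \<subseteq> labels j" unfolding F_def pos by (auto simp: posn_less_1)
  ultimately have F: "F \<subseteq> labels i" "F \<subseteq> labels j" by auto
  \<comment> \<open>Any corner of the face would do: it is compared with its counterpart only off
    \<open>F\<close>, so the value 1 on \<open>F\<close> is an arbitrary choice.\<close>
  define v where "v = (\<lambda>e\<in>labels i. if e \<in> F then 1 else x e)"
  define w where "w = (\<lambda>e\<in>labels j. if e \<in> F then 1 else y e)"
  have v: "v \<in> corners (labels i)"
  proof (rule corners_I)
    fix e assume "e \<in> labels i"
    then show "\<bar>v e\<bar> = 1" using cube_D[OF x, of e] by (auto simp: v_def F_def posn_less_1)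
  qed (simp add: v_def)
  have w: "w \<in> corners (labels j)"
  proof (rule corners_I)
    fix e assume "e \<in> labels j"
    then show "\<bar>w e\<bar> = 1" using cube_D[OF y, of e] by (auto simp: w_def F_def pos posn_less_1)
  qed (simp add: w_def)
  have "posn i v T = posn j w T" if "T \<notin> F" for T
  proof -
    have "posn i v T = posn i x T" "posn j w T = posn j y T" using that by (auto simp: posn_def v_def w_def)
    then show ?thesis using pos by simp
  qed
  moreover have "ordn n i a b = ordn n j a b" if "e \<in> F" "a \<in> e" "b \<in> e" "a \<noteq> b" for e a b
    using inv that unfolding inv_pt_eq_iff F_def by blast
  ultimately have g: "gluing (M_cx n) i (face (labels i) v F) j
      (face (labels j) w F) (transfer i j F w)"
    by (rule M_gluing[OF ij v w F])
  have xf: "x \<in> face (labels i) v F" using x by (simp add: face_def v_def)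
  have "transfer i j F w x = y"
  proof
    fix T
    consider "T \<in> F" | "T \<notin> F" "T \<in> labels j" | "T \<notin> labels j" by blast
    then show "transfer i j F w x T = y T"
    proof cases
      case 1
      then have T: "T \<in> labels i" "T \<in> labels j" using F by auto
      then have "sg (snd i T) * x T = sg (snd j T) * y T" using fun_cong[OF pos, of T] by (simp add: posn_def)
      then have "sg (snd j T) * (sg (snd i T) * x T) = y T" by simp
      then show ?thesis using 1 T by (simp add: transfer_def ac_simps)
    next
      case 2
      then show ?thesis by (simp add: transfer_def w_def)
    next
      case 3
      then show ?thesis using cube_extensional[OF y] by (simp add: transfer_def extensional_def)
    qed
  qed
  then show ?thesis unfolding glue_def using g xf by blast
qed

section \<open>The topology of \<open>M_n\<close>\<close>

lemma quotient_map_M: "quotient_map (M_sum n) (space_of (M_cx n)) (M_class n)"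
  unfolding M_cx_simps by (rule quotient_map_gen_class)

text \<open>On each closed orthant \<open>C N\<close> the chart is a composite of continuous maps:
  absolute values, the inclusion of one positive subcube, and the quotient map. The finitely many
  orthants are pasted together.\<close>

lemma continuous_map_M_chart:
  assumes i: "i \<in> M_cells n"
  shows "continuous_map (cube_topology (labels i)) (space_of (M_cx n)) (M_chart n i)"
proof -
  define E where "E = labels i"
  define u where "u = (\<lambda>x::nat set \<Rightarrow> real. \<lambda>e\<in>E. \<bar>x e\<bar>)"
  define C where "C N = (\<Pi>\<^sub>E e\<in>E. if e \<in> N then {-1..0} else {0..1::real})" for N
  have fl: "flip n N i \<in> M_cells n" "labels (flip n N i) = E" if "N \<subseteq> E" for N
    using flip_index(1,2)[OF i, of N] that by (auto simp: E_def)
  have u_pos: "u x \<in> pos_cube E" if "x \<in> cube E" for x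
    unfolding pos_cube_def u_def restrict_PiE_iff using cube_D[OF that] by auto
  have "continuous_map (cube_topology E) (cube_topology E) u"
    unfolding cube_topology_def continuous_map_componentwise
  proof (intro conjI ballI)
    fix k assume k: "k \<in> E"
    have "continuous_map (product_topology (\<lambda>_. top_of_set {- 1..1}) E) euclideanreal (\<lambda>x. \<bar>x k\<bar>)"
      using continuous_map_product_projection[OF k, of "\<lambda>_. top_of_set {- 1..1::real}"]
      by (intro continuous_map_real_abs) (simp add: continuous_map_in_subtopology)
    then show "continuous_map (product_topology (\<lambda>_. top_of_set {- 1..1}) E) (top_of_set {- 1..1}) (\<lambda>x. u x k)"
      using k by (auto simp: u_def continuous_map_in_subtopology PiE_def Pi_def abs_le_iff)
  qed (auto simp: u_def intro!: image_subsetI)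
  then have u_cont: "continuous_map (cube_topology E) (subtopology (cube_topology E) (pos_cube E)) u"
    using u_pos by (simp add: continuous_map_in_subtopology)
  have cont: "continuous_map (cube_topology E) (space_of (M_cx n))
      (\<lambda>x. M_class n (flip n N i, u x))" if N: "N \<subseteq> E" for N
  proof -
    have "continuous_map (subtopology (cube_topology E) (pos_cube E)) (M_sum n) (\<lambda>x. (flip n N i, x))"
      using continuous_map_component_injection[OF fl(1)[OF N], of
          "\<lambda>(\<tau>, s). subtopology (cube_topology (internal_edges \<tau>)) (pos_cube (internal_edges \<tau>))"] fl(2)[OF N]
      by (simp add: M_sum_def case_prod_beta)
    from continuous_map_compose[OF continuous_map_compose[OF u_cont this]
        quotient_imp_continuous_map[OF quotient_map_M]]
    show ?thesis by (simp add: o_def)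
  qed
  \<comment> \<open>Here \<open>N\<close> may contain labels of vanishing coordinates, so it need
    not be the set of strictly negative coordinates used by \<open>M_chart\<close>. Equality of the
    invariants shows that the class is nevertheless the same, which also gives agreement on
    overlaps.\<close>
  have chart: "M_chart n i x = M_class n (flip n N i, u x)"
    if N: "N \<subseteq> E" and x: "x \<in> C N" for N x
  proof -
    have sgn: "x e \<in> (if e \<in> N then {-1..0} else {0..1})" if "e \<in> E" for e
      using x that unfolding C_def by (rule PiE_mem)
    have "\<bar>x e\<bar> \<le> 1" if "e \<in> E" for e using sgn[OF that] by (auto split: if_splits)
    then have xc: "x \<in> cube E" using x by (intro cube_I) (auto simp: C_def PiE_def)
    have "u x = (\<lambda>e\<in>E. if e \<in> N then - x e else x e)"
    proof
      fix e show "u x e = (\<lambda>e\<in>E. if e \<in> N then - x e else x e) e"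
        using sgn[of e] by (auto simp: u_def)
    qed
    then have pos: "posn (flip n N i) (u x) = posn i x"
      using flip_index(4)[OF i, of N x] N by (simp add: E_def)
    have "inv_pt n (flip n N i, u x) = inv_pt n (i, x)"
      unfolding inv_pt_eq_iff using pos flip_index(3)[OF i, of N] N by (simp add: E_def)
    moreover have "M_chart n (flip n N i) (u x) = M_class n (flip n N i, u x)"
      using M_pt_eq_chart[OF fl(1)[OF N], of "u x"] u_pos[OF xc] fl(2)[OF N] by simp
    moreover have "u x \<in> cube (labels (flip n N i))"
      using u_pos[OF xc] pos_cube_subset fl(2)[OF N] by auto
    ultimately show ?thesis
      using M_chart_eq_iff[OF i _ fl(1)[OF N], of x "u x"] xc by (simp add: E_def)
  qed
  show ?thesis unfolding E_def[symmetric]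
  proof (rule pasting_lemma_closed)
    show "finite (Pow E)" by (simp add: E_def)
    show "closedin (cube_topology E) (C N)" if "N \<in> Pow E" for N
    proof -
      have "closedin (top_of_set {-1..1::real}) {-1..0}" "closedin (top_of_set {-1..1::real}) {0..1}"
        by (auto intro!: closed_subset)
      then show ?thesis
        unfolding cube_topology_def C_def closedin_product_topology by auto
    qed
    show "continuous_map (subtopology (cube_topology E) (C N)) (space_of (M_cx n))
        (\<lambda>x. M_class n (flip n N i, u x))" if "N \<in> Pow E" for N
      using cont[of N] that by (intro continuous_map_from_subtopology) auto
    show "M_class n (flip n N i, u x) =
        M_class n (flip n N' i, u x)"
      if "N \<in> Pow E" "N' \<in> Pow E" "x \<in> topspace (cube_topology E) \<inter> C N \<inter> C N'" for N N' x
      using chart[of N x] chart[of N' x] that by simp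
    show "\<exists>N. N \<in> Pow E \<and> x \<in> C N \<and>
        M_chart n i x = M_class n (flip n N i, u x)"
      if "x \<in> topspace (cube_topology E)" for x
    proof -
      have x: "x \<in> cube E" using that by simp
      define N where "N = {e \<in> E. x e < 0}"
      have N: "N \<subseteq> E" by (auto simp: N_def)
      have "x \<in> C N"
        unfolding C_def
      proof (rule PiE_I)
        fix e assume e: "e \<in> E"
        then show "x e \<in> (if e \<in> N then {-1..0} else {0..1})"
          using cube_D[OF x e] by (auto simp: N_def)
      next
        fix e assume "e \<notin> E"
        then show "x e = undefined" using cube_extensional[OF x] by (simp add: extensional_def)
      qed
      then show ?thesis using chart[OF N] N by blast
    qed
  qed
qed

lemma continuous_map_from_sum:
  assumes "\<And>i. i \<in> I \<Longrightarrow> continuous_map (X i) Y (f i)"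
  shows "continuous_map (sum_topology X I) Y (\<lambda>(i, x). f i x)"
  unfolding continuous_map_def openin_sum_topology
proof (intro conjI allI impI ballI)
  have "f i x \<in> topspace Y" if "i \<in> I" "x \<in> topspace (X i)" for i x
    using continuous_map_image_subset_topspace[OF assms[OF that(1)]] that(2) by auto
  then show "(\<lambda>(i, x). f i x) \<in> topspace (sum_topology X I) \<rightarrow> topspace Y" by auto
  fix U assume "openin Y U"
  show "{x \<in> topspace (sum_topology X I). (case x of (i, x) \<Rightarrow> f i x) \<in> U} \<subseteq> Sigma I (topspace \<circ> X)"
    by auto
  fix i assume "i \<in> I"
  then show "openin (X i) {x. (i, x) \<in> {x \<in> topspace (sum_topology X I). (case x of (i, x) \<Rightarrow> f i x) \<in> U}}"
    using assms[OF \<open>i \<in> I\<close>] \<open>openin Y U\<close> by (simp add: continuous_map_def)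
qed

text \<open>The quotient map from the positive subcubes factors through their inclusion into the
  full cubes, and a continuous second factor of a quotient map is a quotient map.\<close>

lemma quotient_map_M_charts:
  "quotient_map (sum_topology (\<lambda>i. cube_topology (labels i)) (M_cells n))
    (space_of (M_cx n)) (\<lambda>(i, x). M_chart n i x)"
proof (rule quotient_map_from_composition)
  let ?S = "sum_topology (\<lambda>i. cube_topology (labels i)) (M_cells n)"
  show "continuous_map ?S (space_of (M_cx n)) (\<lambda>(i, x). M_chart n i x)"
    by (rule continuous_map_from_sum[OF continuous_map_M_chart])
  have "continuous_map (M_sum n) ?S (\<lambda>(i, x). (i, x))"
    unfolding M_sum_def
  proof (rule continuous_map_from_sum)
    fix i assume i: "i \<in> M_cells n"
    have "continuous_map (cube_topology (labels i)) ?S (\<lambda>x. (i, x))"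
      using continuous_map_component_injection[OF i, of "\<lambda>i. cube_topology (labels i)"] .
    then show "continuous_map (case i of (\<tau>, s) \<Rightarrow>
        subtopology (cube_topology (internal_edges \<tau>)) (pos_cube (internal_edges \<tau>))) ?S (\<lambda>x. (i, x))"
      by (simp add: case_prod_beta continuous_map_from_subtopology)
  qed
  then show "continuous_map (M_sum n) ?S (\<lambda>z. z)" by (simp add: case_prod_beta id_def)
  show "quotient_map (M_sum n) (space_of (M_cx n)) ((\<lambda>(i, x). M_chart n i x) \<circ> (\<lambda>z. z))"
  proof (rule quotient_map_eq[OF quotient_map_M])
    fix z assume "z \<in> topspace (M_sum n)"
    then show "M_class n z = ((\<lambda>(i, x). M_chart n i x) \<circ> (\<lambda>z. z)) z"
      using M_pt_eq_chart[of "fst z" n "snd z"] by (auto simp: topspace_M_sum)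
  qed
qed

lemma cube_complex_M: "cube_complex (M_cx n)"
  unfolding cube_complex_def
proof (intro conjI ballI impI)
  show "finite (coords (M_cx n) i)" for i by simp
  show "quotient_map (sum_topology (\<lambda>i. cube_topology (coords (M_cx n) i)) (cells (M_cx n)))
      (space_of (M_cx n)) (\<lambda>(i, x). chart (M_cx n) i x)"
    using quotient_map_M_charts[of n] by simp
  fix i j x y assume "i \<in> cells (M_cx n)" "j \<in> cells (M_cx n)" "x \<in> cube (coords (M_cx n) i)"
    "y \<in> cube (coords (M_cx n) j)" "chart (M_cx n) i x = chart (M_cx n) j y"
  then have "((i, x), (j, y)) \<in> glue (M_cx n)" using M_chart_eq_imp_glue[of i n j x y] by simp
  then show "((i, x), (j, y)) \<in> (glue (M_cx n) \<union> (glue (M_cx n))\<inverse>)\<^sup>*" by blast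
qed

lemma compact_space_M: "compact_space (space_of (M_cx n))"
proof -
  have cpt: "compactin (space_of (M_cx n)) (M_chart n i ` cube (labels i))"
    if "i \<in> M_cells n" for i
  proof (rule image_compactin[OF _ continuous_map_M_chart[OF that]])
    have "compact_space (cube_topology (labels i))"
      unfolding cube_topology_def compact_space_product_topology
      by (simp add: compact_space_subtopology)
    then show "compactin (cube_topology (labels i)) (cube (labels i))"
      by (simp add: compact_space_def)
  qed
  have "topspace (space_of (M_cx n)) =
      (\<lambda>(i, x). M_chart n i x) ` (SIGMA i : M_cells n. cube (labels i))"
    using quotient_imp_surjective_map[OF quotient_map_M_charts[of n]] by (simp add: comp_def)
  also have "\<dots> = \<Union>((\<lambda>i. M_chart n i ` cube (labels i)) ` (M_cells n))"
    by force
  finally have "topspace (space_of (M_cx n)) =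
      \<Union>((\<lambda>i. M_chart n i ` cube (labels i)) ` (M_cells n))" .
  moreover have "compactin (space_of (M_cx n))
      (\<Union>((\<lambda>i. M_chart n i ` cube (labels i)) ` (M_cells n)))"
    by (rule compactin_Union) (use cpt finite_PF finite_Z2L in auto)
  ultimately show ?thesis by (simp only: compact_space_def)
qed

section \<open>The complex of forests\<close>

lemma Dhat_simps [simp]:
  "space_of (Dhat n) = quotient_space (Dhat_sum n) (Dhat_glue n)" "cells (Dhat n) = PF n"
  "coords (Dhat n) = internal_edges" "chart (Dhat n) = Dhat_pt n"
  by (simp_all add: Dhat_def)

lemma topspace_Dhat_sum: "topspace (Dhat_sum n) = (SIGMA \<tau> : PF n. cube (internal_edges \<tau>))"
  by (simp add: Dhat_sum_def comp_def)

lemma Dhat_glue_reverse: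
  assumes "\<tau> \<in> PF n" "t \<in> cube (internal_edges \<tau>)" "e \<in> internal_edges \<tau>"
  shows "((\<tau>, t), (reverse e \<tau>, t(e := - t e))) \<in> Dhat_glue n"
  unfolding Dhat_glue_def
  by (rule UnI1, rule UnI1, rule CollectI, intro exI conjI, rule refl) (rule assms)+

lemma Dhat_glue_collapse:
  assumes "\<tau> \<in> PF n" "t \<in> cube (internal_edges \<tau>)" "e \<in> internal_edges \<tau>" "t e = 1"
  shows "((\<tau>, t), (collapse e \<tau>, restrict t (internal_edges \<tau> - {e}))) \<in> Dhat_glue n"
  unfolding Dhat_glue_def
  by (rule UnI1, rule UnI2, rule CollectI, intro exI conjI, rule refl) (rule assms)+

lemma Dhat_glue_permute:
  assumes "\<tau> \<in> PF n" "t \<in> cube (internal_edges \<tau>)" "mset \<tau>' = mset \<tau>"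
  shows "((\<tau>, t), (\<tau>', t)) \<in> Dhat_glue n"
  unfolding Dhat_glue_def
  by (rule UnI2, rule CollectI, intro exI conjI, rule refl) (rule assms)+

lemma cube_flip: "t \<in> cube E \<Longrightarrow> e \<in> E \<Longrightarrow> t(e := - t e) \<in> cube E"
  by (rule cube_I) (auto simp: cube_D extensional_def cube_def PiE_def)

lemma cube_restrict: "t \<in> cube E \<Longrightarrow> restrict t (E - D) \<in> cube (E - D)"
  by (rule cube_I) (auto simp: cube_D)

lemma Dhat_glue_D:
  assumes "(x, y) \<in> Dhat_glue n"
  shows "x \<in> topspace (Dhat_sum n) \<and> y \<in> topspace (Dhat_sum n)"
  using assms unfolding Dhat_glue_def
proof (elim UnE CollectE exE conjE, goal_cases)
  case c: (1 \<tau> t e)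
  then show ?case using reverse_PF[OF c(2)] cube_flip[OF c(3,4)] by (simp add: topspace_Dhat_sum)
next
  case c: (2 \<tau> t e)
  then show ?case using collapse_PF[OF c(2)] cube_restrict[OF c(3)]
    by (simp add: topspace_Dhat_sum internal_edges_collapse_PF[OF c(2)])
next
  case c: (3 \<tau> \<tau>' t)
  then show ?case using permute_PF[OF c(2,4)]
    by (simp add: topspace_Dhat_sum internal_edges_permute[OF c(4)])
qed

lemma Dhat_pt_glue: "((\<tau>, t), (\<sigma>, u)) \<in> Dhat_glue n \<Longrightarrow> Dhat_pt n \<sigma> u = Dhat_pt n \<tau> t"
  unfolding Dhat_pt_def
  using gen_class_eq_iff[of "(\<sigma>, u)" "Dhat_sum n" "(\<tau>, t)" "Dhat_glue n"]
    Dhat_glue_D[of "(\<tau>, t)" "(\<sigma>, u)" n] by blast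

lemma face_full: "face E v E = cube E"
  by (auto simp: face_def)

lemma is_face_face: "v \<in> corners E \<Longrightarrow> F \<subseteq> E \<Longrightarrow> is_face E (face E v F)"
  by (auto simp: is_face_def)

lemma ones_corner: "(\<lambda>e\<in>E. 1) \<in> corners E"
  by (rule corners_I) auto

lemma is_face_cube: "is_face E (cube E)"
  using is_face_face[OF ones_corner, of E E] by (simp add: face_full)

lemma glueI: "gluing K i A j B h \<Longrightarrow> x \<in> A \<Longrightarrow> ((i, x), (j, h x)) \<in> glue K"
  unfolding glue_def by blast

text \<open>Each generating identification is the restriction to a point of an isometry of faces: a
  reflection of the whole cube, the projection of the face with \<open>e\<close>-coordinate 1 onto
  the cube of the collapsed forest, or the identity.\<close>

lemma Dhat_glue_subset_glue: "Dhat_glue n \<subseteq> glue (Dhat n)"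
proof (rule subrelI)
  fix x y assume "(x, y) \<in> Dhat_glue n"
  then show "(x, y) \<in> glue (Dhat n)"
    unfolding Dhat_glue_def
  proof (elim UnE CollectE exE conjE, goal_cases)
    case c: (1 \<tau> t e)
    let ?E = "internal_edges \<tau>" and ?h = "\<lambda>t. t(e := - t e)"
    have "?h ` cube ?E = cube ?E"
    proof
      show "?h ` cube ?E \<subseteq> cube ?E" using cube_flip c(4) by auto
      show "cube ?E \<subseteq> ?h ` cube ?E"
      proof
        fix u assume "u \<in> cube ?E"
        then show "u \<in> ?h ` cube ?E" by (intro image_eqI[of _ _ "?h u"] cube_flip c(4)) auto
      qed
    qed
    moreover have "L2_set (\<lambda>f. ?h x f - ?h y f) ?E = L2_set (\<lambda>f. x f - y f) ?E" for x y :: "nat set \<Rightarrow> real"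
      by (rule L2_set_eq_support[of _ _ ?E]) (auto simp: power2_commute)
    moreover have "Dhat_pt n (reverse e \<tau>) (?h x) = Dhat_pt n \<tau> x" if "x \<in> cube ?E" for x
      by (rule Dhat_pt_glue[OF Dhat_glue_reverse[OF c(2) that c(4)]])
    ultimately have "gluing (Dhat n) \<tau> (cube ?E) (reverse e \<tau>) (cube ?E) ?h"
      unfolding gluing_def using c(2) reverse_PF[OF c(2)] is_face_cube by simp
    then show ?case unfolding c(1) by (rule glueI) (rule c(3))
  next
    case c: (2 \<tau> t e)
    let ?E = "internal_edges \<tau>" and ?h = "\<lambda>t. restrict t (internal_edges \<tau> - {e})"
    let ?A = "face ?E (\<lambda>e\<in>?E. 1) (?E - {e})"
    have E: "internal_edges (collapse e \<tau>) = ?E - {e}" by (rule internal_edges_collapse_PF[OF c(2)])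
    have A: "x \<in> ?A \<longleftrightarrow> x \<in> cube ?E \<and> x e = 1" for x using c(4) by (auto simp: face_def)
    have "?h ` ?A = cube (?E - {e})"
    proof
      show "?h ` ?A \<subseteq> cube (?E - {e})"
        using cube_restrict[of _ ?E "{e}"] A by auto
      show "cube (?E - {e}) \<subseteq> ?h ` ?A"
      proof
        fix u assume u: "u \<in> cube (?E - {e})"
        have "u(e := 1) \<in> cube ?E"
          by (rule cube_I) (use u cube_D[OF u] cube_extensional[OF u] c(4) in \<open>auto simp: extensional_def\<close>)
        moreover have "?h (u(e := 1)) = u"
          using cube_extensional[OF u] by (auto simp: extensional_def restrict_def fun_eq_iff)
        ultimately show "u \<in> ?h ` ?A" using A by (intro image_eqI[of _ _ "u(e := 1)"]) auto
      qed
    qed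
    moreover have "L2_set (\<lambda>f. ?h x f - ?h y f) (?E - {e}) = L2_set (\<lambda>f. x f - y f) ?E"
      if "x \<in> ?A" "y \<in> ?A" for x y
      by (rule L2_set_eq_support[of _ _ "?E - {e}"]) (use that A in auto)
    moreover have "Dhat_pt n (collapse e \<tau>) (?h x) = Dhat_pt n \<tau> x" if "x \<in> ?A" for x
      using that A by (intro Dhat_pt_glue Dhat_glue_collapse c(2,4)) auto
    moreover have "is_face ?E ?A" by (rule is_face_face[OF ones_corner]) auto
    ultimately have "gluing (Dhat n) \<tau> ?A (collapse e \<tau>) (cube (?E - {e})) ?h"
      unfolding gluing_def using c(2) collapse_PF[OF c(2)] is_face_cube E by simp
    moreover have "t \<in> ?A" using A c(3,5) by simp
    ultimately show ?case unfolding c(1) by (rule glueI)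
  next
    case c: (3 \<tau> \<tau>' t)
    let ?E = "internal_edges \<tau>"
    have E: "internal_edges \<tau>' = ?E" by (rule internal_edges_permute[OF c(4)])
    have "Dhat_pt n \<tau>' x = Dhat_pt n \<tau> x" if "x \<in> cube ?E" for x
      by (rule Dhat_pt_glue[OF Dhat_glue_permute[OF c(2) that c(4)]])
    then have "gluing (Dhat n) \<tau> (cube ?E) \<tau>' (cube ?E) (\<lambda>t. t)"
      unfolding gluing_def using c(2) permute_PF[OF c(2,4)] is_face_cube E by simp
    then show ?case unfolding c(1) by (rule glueI) (rule c(3))
  qed
qed

lemma quotient_map_Dhat:
  "quotient_map (Dhat_sum n) (space_of (Dhat n)) (\<lambda>(\<tau>, t). Dhat_pt n \<tau> t)"
  using quotient_map_gen_class[of "Dhat_sum n" "Dhat_glue n"] unfolding Dhat_simps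
  by (rule quotient_map_eq) (auto simp: Dhat_pt_def)

lemma cube_complex_Dhat: "cube_complex (Dhat n)"
  unfolding cube_complex_def
proof (intro conjI ballI impI)
  show "finite (coords (Dhat n) i)" for i by simp
  show "quotient_map (sum_topology (\<lambda>i. cube_topology (coords (Dhat n) i)) (cells (Dhat n)))
      (space_of (Dhat n)) (\<lambda>(i, x). chart (Dhat n) i x)"
    using quotient_map_Dhat[of n] by (simp add: Dhat_sum_def)
  fix i j x y assume "i \<in> cells (Dhat n)" "j \<in> cells (Dhat n)" "x \<in> cube (coords (Dhat n) i)"
    "y \<in> cube (coords (Dhat n) j)" "chart (Dhat n) i x = chart (Dhat n) j y"
  then have "((i, x), (j, y)) \<in> (Dhat_glue n \<union> (Dhat_glue n)\<inverse>)\<^sup>*"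
    using gen_class_eq_iff[of "(i, x)" "Dhat_sum n" "(j, y)" "Dhat_glue n"]
    by (simp add: topspace_Dhat_sum Dhat_pt_def)
  moreover have "Dhat_glue n \<union> (Dhat_glue n)\<inverse> \<subseteq> glue (Dhat n) \<union> (glue (Dhat n))\<inverse>"
    using Dhat_glue_subset_glue by (intro Un_mono) (simp_all add: converse_mono)
  ultimately show "((i, x), (j, y)) \<in> (glue (Dhat n) \<union> (glue (Dhat n))\<inverse>)\<^sup>*"
    using rtrancl_mono by blast
qed

section \<open>The covering map\<close>

text \<open>The choice of representative is immaterial by \<open>proj_class\<close>: after
  forgetting the bits, each gluing of \<open>M_glue\<close> becomes one of \<open>Dhat_glue\<close>,
  a reversal at \<open>t e = 0\<close> being a reflection that fixes \<open>t\<close>.\<close>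

definition proj :: "nat \<Rightarrow> (M_index \<times> (nat set \<Rightarrow> real)) set \<Rightarrow> (ptree list \<times> (nat set \<Rightarrow> real)) set" where
  "proj n C = (let z = SOME z. z \<in> C in Dhat_pt n (fst (fst z)) (snd z))"

lemma Dhat_pt_M_glue:
  "(x, y) \<in> M_glue n \<Longrightarrow> Dhat_pt n (fst (fst x)) (snd x) = Dhat_pt n (fst (fst y)) (snd y)"
  unfolding M_glue_def
proof (elim UnE CollectE exE conjE, goal_cases)
  case c: (1 \<tau> s t e)
  have "t \<in> cube (internal_edges \<tau>)" using c(4) pos_cube_subset by blast
  then show ?case using Dhat_pt_glue[OF Dhat_glue_collapse[where t = t and e = e and \<tau> = \<tau>, OF c(2) _ c(5,6)]] c(1) by simp
next
  case c: (2 \<tau> \<tau>' s t)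
  have "t \<in> cube (internal_edges \<tau>)" using c(4) pos_cube_subset by blast
  then show ?case using Dhat_pt_glue[OF Dhat_glue_permute[OF c(2) _ c(5)]] c(1) by simp
next
  case c: (3 \<tau> s t e)
  have "t \<in> cube (internal_edges \<tau>)" using c(4) pos_cube_subset by blast
  moreover have "t(e := - t e) = t" using c(6) by auto
  ultimately show ?case using Dhat_pt_glue[OF Dhat_glue_reverse[where t = t and e = e and \<tau> = \<tau>, OF c(2) _ c(5)]] c(1) by simp
qed

lemma proj_class:
  assumes z: "z \<in> topspace (M_sum n)"
  shows "proj n (M_class n z) = Dhat_pt n (fst (fst z)) (snd z)"
proof -
  let ?C = "M_class n z"
  have "(SOME w. w \<in> ?C) \<in> ?C" using gen_class_self[OF z] by (rule someI)
  then have "(z, SOME w. w \<in> ?C) \<in> M_rel n" using mem_gen_class[OF z] by blast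
  then show ?thesis
    using rtrancl_invariant[of z "SOME w. w \<in> ?C" "M_glue n" "\<lambda>z. Dhat_pt n (fst (fst z)) (snd z)"]
      Dhat_pt_M_glue by (simp add: proj_def Let_def)
qed

lemma Dhat_pt_reverse_all:
  assumes "finite N" "N \<subseteq> internal_edges \<tau>" "\<tau> \<in> PF n" "x \<in> cube (internal_edges \<tau>)" "s \<in> Z2L n"
  shows "Dhat_pt n (reverse_all N \<tau>) (\<lambda>e\<in>internal_edges \<tau>. if e \<in> N then - x e else x e) = Dhat_pt n \<tau> x"
  using assms
proof (induction N rule: finite_induct)
  case empty
  have "(\<lambda>e\<in>internal_edges \<tau>. x e) = x" using cube_extensional[OF empty(3)] by (simp add: extensional_restrict)
  then show ?case by (simp add: reverse_all_def)
next
  case (insert f N)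
  let ?E = "internal_edges \<tau>"
  let ?x = "\<lambda>e\<in>?E. if e \<in> N then - x e else x e"
  have f: "f \<in> ?E" "N \<subseteq> ?E" using insert.prems(1) by auto
  have R: "reverse_all N \<tau> \<in> PF n" "internal_edges (reverse_all N \<tau>) = ?E"
    using flip_props[OF insert.hyps(1) f(2) insert.prems(2,4)] by auto
  have "?x \<in> cube ?E" using cube_D[OF insert.prems(3)] by (intro cube_I) auto
  then have "Dhat_pt n (reverse f (reverse_all N \<tau>)) (?x(f := - ?x f)) = Dhat_pt n (reverse_all N \<tau>) ?x"
    using f R by (intro Dhat_pt_glue Dhat_glue_reverse) auto
  moreover have "?x(f := - ?x f) = (\<lambda>e\<in>?E. if e \<in> insert f N then - x e else x e)"
    using f insert.hyps(2) by (auto simp: fun_eq_iff)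
  moreover have "Dhat_pt n (reverse_all N \<tau>) ?x = Dhat_pt n \<tau> x"
    using insert.IH insert.prems f(2) by blast
  ultimately show ?case unfolding reverse_all_insert[OF insert.hyps] by (simp only:)
qed

lemma proj_chart:
  assumes i: "i \<in> M_cells n" and x: "x \<in> cube (labels i)"
  shows "proj n (M_chart n i x) = Dhat_pt n (fst i) x"
proof -
  define N where "N = {e \<in> labels i. x e < 0}"
  have N: "N \<subseteq> labels i" by (auto simp: N_def)
  let ?u = "\<lambda>e\<in>labels i. \<bar>x e\<bar>"
  have u: "?u = (\<lambda>e\<in>labels i. if e \<in> N then - x e else x e)"
    by (auto simp: N_def fun_eq_iff)
  have M: "M_chart n i x = M_class n (flip n N i, ?u)"
    by (cases i) (simp add: M_chart_def M_pt_def flip_def N_def Let_def)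
  have "?u \<in> pos_cube (labels i)"
    using cube_D[OF x] unfolding pos_cube_def restrict_PiE_iff by auto
  then have "(flip n N i, ?u) \<in> topspace (M_sum n)"
    using flip_index(1,2)[OF i N] by (simp add: topspace_M_sum)
  then have "proj n (M_chart n i x) = Dhat_pt n (reverse_all N (fst i)) ?u"
    using proj_class M by (simp add: flip_def)
  also have "\<dots> = Dhat_pt n (fst i) x"
    unfolding u using finite_subset[OF N] N i x by (intro Dhat_pt_reverse_all[where s = "snd i"]) auto
  finally show ?thesis .
qed

lemma Z2L_nonempty: "(\<lambda>S\<in>Lsets n. 0) \<in> Z2L n"
  by simp

text \<open>Forgetting the bits is a continuous open surjection between the disjoint unions of
  cubes. Composed with the quotient map of the target it equals the charts of \<open>M_n\<close>
  followed by \<open>proj n\<close>, so \<open>proj n\<close> is a quotient map too.\<close>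

lemma quotient_map_proj: "quotient_map (space_of (M_cx n)) (space_of (Dhat n)) (proj n)"
proof -
  let ?S = "sum_topology (\<lambda>i. cube_topology (labels i)) (M_cells n)"
  let ?f = "\<lambda>z::M_index \<times> (nat set \<Rightarrow> real). (fst (fst z), snd z)"
  have tS: "topspace ?S = (SIGMA i : M_cells n. cube (labels i))"
    by (simp add: comp_def)
  have "quotient_map ?S (Dhat_sum n) ?f"
  proof (rule continuous_open_imp_quotient_map)
    have "continuous_map ?S (Dhat_sum n) (\<lambda>(i, x). (fst i, x))"
      unfolding Dhat_sum_def
    proof (rule continuous_map_from_sum)
      fix i assume "i \<in> M_cells n"
      then show "continuous_map (cube_topology (labels i))
          (sum_topology (\<lambda>\<tau>. cube_topology (internal_edges \<tau>)) (PF n)) (\<lambda>x. (fst i, x))"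
        using continuous_map_component_injection[of "fst i" "PF n" "\<lambda>\<tau>. cube_topology (internal_edges \<tau>)"]
        by auto
    qed
    then show "continuous_map ?S (Dhat_sum n) ?f" by (simp add: case_prod_unfold)
    show "?f ` topspace ?S = topspace (Dhat_sum n)"
      unfolding tS topspace_Dhat_sum
    proof (intro equalityI subsetI)
      fix z assume "z \<in> (SIGMA \<tau> : PF n. cube (internal_edges \<tau>))"
      then show "z \<in> ?f ` (SIGMA i : M_cells n. cube (labels i))"
        using Z2L_nonempty[of n]
        by (intro image_eqI[of _ _ "((fst z, \<lambda>S\<in>Lsets n. 0), snd z)"]) auto
    qed auto
    show "open_map ?S (Dhat_sum n) ?f"
      unfolding open_map_def
    proof (intro allI impI)
      fix U assume U: "openin ?S U"
      have sub: "U \<subseteq> (SIGMA i : M_cells n. cube (labels i))"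
        using openin_subset[OF U] tS by simp
      show "openin (Dhat_sum n) (?f ` U)"
        unfolding Dhat_sum_def openin_sum_topology
      proof (intro conjI ballI)
        show "?f ` U \<subseteq> Sigma (PF n) (topspace \<circ> (\<lambda>\<tau>. cube_topology (internal_edges \<tau>)))"
          using sub by auto
        fix \<tau> assume \<tau>: "\<tau> \<in> PF n"
        have "{x. (\<tau>, x) \<in> ?f ` U} = (\<Union>s\<in>Z2L n. {x. ((\<tau>, s), x) \<in> U})"
        proof (intro equalityI subsetI)
          fix x assume "x \<in> {x. (\<tau>, x) \<in> ?f ` U}"
          then obtain z where z: "z \<in> U" "fst (fst z) = \<tau>" "snd z = x" by auto
          then have "z = ((\<tau>, snd (fst z)), x)" by (metis prod.collapse)
          then have "((\<tau>, snd (fst z)), x) \<in> U" using z(1) by simp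
          moreover have "snd (fst z) \<in> Z2L n" using sub z(1) by auto
          ultimately show "x \<in> (\<Union>s\<in>Z2L n. {x. ((\<tau>, s), x) \<in> U})" by blast
        qed force
        moreover have "openin (cube_topology (internal_edges \<tau>)) {x. ((\<tau>, s), x) \<in> U}" if "s \<in> Z2L n" for s
        proof -
          have "(\<tau>, s) \<in> M_cells n" using \<tau> that by simp
          then have "openin (cube_topology (labels (\<tau>, s))) {x. ((\<tau>, s), x) \<in> U}"
            using U unfolding openin_sum_topology by blast
          then show ?thesis by simp
        qed
        ultimately show "openin (cube_topology (internal_edges \<tau>)) {x. (\<tau>, x) \<in> ?f ` U}" by auto
      qed
    qed
  qed
  then have "quotient_map ?S (space_of (Dhat n)) ((\<lambda>(\<tau>, t). Dhat_pt n \<tau> t) \<circ> ?f)"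
    by (rule quotient_map_compose[OF _ quotient_map_Dhat])
  then have "quotient_map ?S (space_of (Dhat n)) (proj n \<circ> (\<lambda>(i, x). M_chart n i x))"
  proof (rule quotient_map_eq)
    fix z assume "z \<in> topspace ?S"
    then show "((\<lambda>(\<tau>, t). Dhat_pt n \<tau> t) \<circ> ?f) z = (proj n \<circ> (\<lambda>(i, x). M_chart n i x)) z"
      using proj_chart[of "fst z" n "snd z"] by (auto simp: case_prod_beta)
  qed
  then show ?thesis using quotient_map_compose_eq[OF quotient_map_M_charts] by blast
qed

subsection \<open>The action of the group of deck transformations\<close>

definition shift_index :: "nat \<Rightarrow> (nat set \<Rightarrow> bit) \<Rightarrow> M_index \<Rightarrow> M_index" where
  "shift_index n g i = (fst i, \<lambda>S\<in>Lsets n. snd i S + g S)"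

text \<open>Translating all representatives of a class yields a whole class again by
  \<open>act_class\<close>, so no representative has to be chosen.\<close>

definition act :: "nat \<Rightarrow> (nat set \<Rightarrow> bit) \<Rightarrow> (M_index \<times> (nat set \<Rightarrow> real)) set \<Rightarrow>
    (M_index \<times> (nat set \<Rightarrow> real)) set" where
  "act n g C = (\<lambda>(i, x). (shift_index n g i, x)) ` C"

lemma shift_index_cells [simp]: "i \<in> M_cells n \<Longrightarrow> shift_index n g i \<in> M_cells n"
  by (auto simp: shift_index_def)

lemma fst_shift_index [simp]: "fst (shift_index n g i) = fst i"
  by (simp add: shift_index_def)

lemma bit_add_cancel [simp]: "(b::bit) + (b + c) = c" "b + c + c = b"
  by (cases b; cases c; simp)+

lemma shift_shift_index:
  "shift_index n h (shift_index n g i) = shift_index n (\<lambda>S\<in>Lsets n. g S + h S) i"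
  by (auto simp: shift_index_def fun_eq_iff restrict_def add.assoc)

lemma shift_index_self [simp]:
  "i \<in> M_cells n \<Longrightarrow> shift_index n g (shift_index n g i) = i"
  by (cases i) (auto simp: shift_index_def intro!: Z2L_eqI)

lemma posn_shift:
  assumes "i \<in> M_cells n"
  shows "posn (shift_index n g i) x T = (if T \<in> Lsets n then sg (g T) else 1) * posn i x T"
proof (cases "T \<in> Lsets n")
  case False
  then have "snd i T = undefined" using assms by (auto simp: Z2L_def PiE_def extensional_def)
  then show ?thesis using False by (simp add: posn_def shift_index_def)
qed (cases "g T"; cases "snd i T"; simp add: posn_def shift_index_def)

lemma ordn_shift:
  "ordn n (shift_index n g i) a b = ordn n i a b + (\<Sum>T | T \<in> Lsets n \<and> a \<in> T \<and> b \<in> T. g T)"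
proof -
  have "(\<Sum>T | T \<in> Lsets n \<and> a \<in> T \<and> b \<in> T. (\<lambda>S\<in>Lsets n. snd i S + g S) T) =
      (\<Sum>T | T \<in> Lsets n \<and> a \<in> T \<and> b \<in> T. snd i T + g T)"
    by (rule sum.cong) auto
  then show ?thesis by (simp only: ordn_def shift_index_def fst_conv snd_conv sum.distrib add.assoc)
qed

text \<open>Translation by \<open>g\<close> multiplies positions by signs and adds to the twisted
  order of \<open>a\<close> and \<open>b\<close> a bit; both depend only on \<open>g\<close> and the
  labels, not on the representative.\<close>

lemma inv_pt_shift:
  assumes ij: "i \<in> M_cells n" "j \<in> M_cells n" and inv: "inv_pt n (i, x) = inv_pt n (j, y)"
  shows "inv_pt n (shift_index n g i, x) = inv_pt n (shift_index n g j, y)"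
  unfolding inv_pt_eq_iff
proof (intro conjI allI impI)
  have pos: "posn i x = posn j y" using inv by (simp add: inv_pt_eq_iff)
  then show "posn (shift_index n g i) x = posn (shift_index n g j) y"
    by (simp add: fun_eq_iff posn_shift[OF ij(1)] posn_shift[OF ij(2)])
  fix e a b assume "\<bar>posn (shift_index n g i) x e\<bar> < 1" and ab: "a \<in> e" "b \<in> e" "a \<noteq> b"
  then have "\<bar>posn i x e\<bar> < 1" by (simp add: posn_less_1)
  then have "ordn n i a b = ordn n j a b" using inv ab unfolding inv_pt_eq_iff by blast
  then show "ordn n (shift_index n g i) a b = ordn n (shift_index n g j) a b"
    by (simp only: ordn_shift)
qed

lemma act_class:
  assumes "(i, x) \<in> topspace (M_sum n)"
  shows "act n g (M_class n (i, x)) =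
    M_class n (shift_index n g i, x)"
proof -
  have i: "i \<in> M_cells n" using assms by (simp add: topspace_M_sum)
  have top: "(shift_index n g j, y) \<in> topspace (M_sum n)" if "(j, y) \<in> topspace (M_sum n)" for j y
    using that by (simp add: topspace_M_sum)
  show ?thesis
    unfolding M_class_eq[OF assms] M_class_eq[OF top[OF assms]] act_def
  proof (intro equalityI subsetI)
    fix z assume "z \<in> (\<lambda>(i, x). (shift_index n g i, x)) `
      {z \<in> topspace (M_sum n). inv_pt n z = inv_pt n (i, x)}"
    then obtain j y where z: "(j, y) \<in> topspace (M_sum n)" "inv_pt n (j, y) = inv_pt n (i, x)"
        "z = (shift_index n g j, y)" by auto
    have "j \<in> M_cells n" using z(1) by (simp add: topspace_M_sum)
    then show "z \<in> {z \<in> topspace (M_sum n). inv_pt n z = inv_pt n (shift_index n g i, x)}"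
      using inv_pt_shift[OF _ i z(2), of g] top[OF z(1)] z(3) by simp
  next
    fix z assume z: "z \<in> {z \<in> topspace (M_sum n). inv_pt n z = inv_pt n (shift_index n g i, x)}"
    obtain j y where jy: "z = (j, y)" by (cases z)
    have j: "j \<in> M_cells n" using z jy by (simp add: topspace_M_sum)
    have "inv_pt n (j, y) = inv_pt n (shift_index n g i, x)" using z jy by simp
    from inv_pt_shift[OF j _ this, of g]
    have "inv_pt n (shift_index n g j, y) = inv_pt n (i, x)" using i by simp
    moreover have "(shift_index n g j, y) \<in> topspace (M_sum n)" using top z jy by simp
    moreover have "z = (\<lambda>(i, x). (shift_index n g i, x)) (shift_index n g j, y)" using jy j by simp
    ultimately show "z \<in> (\<lambda>(i, x). (shift_index n g i, x)) `
      {z \<in> topspace (M_sum n). inv_pt n z = inv_pt n (i, x)}" by blast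
  qed
qed

lemma topspace_M: "topspace (space_of (M_cx n)) = M_class n ` topspace (M_sum n)"
  by (simp add: topspace_quotient_space)

lemma act_act: "act n h (act n g C) = act n (\<lambda>S\<in>Lsets n. g S + h S) C"
  by (simp add: act_def image_image case_prod_beta shift_shift_index)

lemma act_in:
  "C \<in> topspace (space_of (M_cx n)) \<Longrightarrow> act n g C \<in> topspace (space_of (M_cx n))"
  unfolding topspace_M by (auto simp: act_class topspace_M_sum)

lemma act_act_self: "C \<in> topspace (space_of (M_cx n)) \<Longrightarrow> act n g (act n g C) = C"
  unfolding topspace_M by (auto simp: act_class topspace_M_sum)

lemma act_zero: "C \<in> topspace (space_of (M_cx n)) \<Longrightarrow> act n (\<lambda>S\<in>Lsets n. 0) C = C"
proof -
  have "shift_index n (\<lambda>S\<in>Lsets n. 0) i = i" if "i \<in> M_cells n" for i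
    using that by (cases i) (auto simp: shift_index_def intro!: Z2L_eqI)
  then show "C \<in> topspace (space_of (M_cx n)) \<Longrightarrow> ?thesis"
    unfolding topspace_M by (auto simp: act_class topspace_M_sum)
qed

lemma continuous_map_act: "continuous_map (space_of (M_cx n)) (space_of (M_cx n)) (act n g)"
proof (rule continuous_compose_quotient_map[OF quotient_map_M])
  have "continuous_map (M_sum n) (M_sum n) (\<lambda>(i, x). (shift_index n g i, x))"
    unfolding M_sum_def
  proof (rule continuous_map_from_sum)
    fix i assume "i \<in> M_cells n"
    then have "shift_index n g i \<in> M_cells n" by simp
    from continuous_map_component_injection[OF this, of "\<lambda>(\<tau>, s).
        subtopology (cube_topology (internal_edges \<tau>)) (pos_cube (internal_edges \<tau>))"]
    show "continuous_map (case i of (\<tau>, s) \<Rightarrow>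
          subtopology (cube_topology (internal_edges \<tau>)) (pos_cube (internal_edges \<tau>)))
        (sum_topology (\<lambda>(\<tau>, s). subtopology (cube_topology (internal_edges \<tau>)) (pos_cube (internal_edges \<tau>)))
          (M_cells n)) (\<lambda>x. (shift_index n g i, x))"
      by (simp add: case_prod_beta)
  qed
  then have "continuous_map (M_sum n) (space_of (M_cx n))
      (M_class n \<circ> (\<lambda>(i, x). (shift_index n g i, x)))"
    by (rule continuous_map_compose[OF _ quotient_imp_continuous_map[OF quotient_map_M]])
  then show "continuous_map (M_sum n) (space_of (M_cx n)) (act n g \<circ> M_class n)"
    by (rule continuous_map_eq) (auto simp: act_class)
qed

lemma homeomorphic_map_act: "homeomorphic_map (space_of (M_cx n)) (space_of (M_cx n)) (act n g)"
proof -
  have "homeomorphic_maps (space_of (M_cx n)) (space_of (M_cx n)) (act n g) (act n g)"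
    unfolding homeomorphic_maps_def using continuous_map_act act_act_self by simp
  then show ?thesis using homeomorphic_map_maps by blast
qed

text \<open>Every identification lifts to \<open>M_n\<close>: collapses and permutations with the
  same bits, a reflection in \<open>e\<close> with \<open>s e\<close> changed. As the change of one
  bit is a bijection of \<open>Z2L n\<close>, the set of all lifts of a point is preserved.\<close>

lemma orbit_Dhat_glue:
  assumes "((\<tau>, t), (\<sigma>, u)) \<in> Dhat_glue n"
  shows "(\<lambda>s. M_chart n (\<tau>, s) t) ` Z2L n = (\<lambda>s. M_chart n (\<sigma>, s) u) ` Z2L n"
proof -
  have "(\<tau>, t) \<in> topspace (Dhat_sum n)" "(\<sigma>, u) \<in> topspace (Dhat_sum n)"
    using Dhat_glue_D[OF assms] by auto
  then have top: "\<tau> \<in> PF n" "t \<in> cube (internal_edges \<tau>)" "\<sigma> \<in> PF n" "u \<in> cube (internal_edges \<sigma>)"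
    by (auto simp: topspace_Dhat_sum)
  have eq: "M_chart n (\<tau>, s) t = M_chart n (\<sigma>, s') u"
    if "s \<in> Z2L n" "s' \<in> Z2L n" "inv_pt n ((\<sigma>, s'), u) = inv_pt n ((\<tau>, s), t)" for s s'
    using M_chart_eq_iff[of "(\<tau>, s)" n t "(\<sigma>, s')" u] that top by simp
  have same: ?thesis if "\<And>s. inv_pt n ((\<sigma>, s), u) = inv_pt n ((\<tau>, s), t)"
    using eq that by (intro image_cong refl) blast
  from assms show ?thesis
    unfolding Dhat_glue_def
  proof (elim UnE CollectE exE conjE, goal_cases)
    case c: (1 \<tau>' t' e)
    then have eqs: "\<tau>' = \<tau>" "t' = t" "\<sigma> = reverse e \<tau>" "u = t(e := - t e)" and e: "e \<in> internal_edges \<tau>"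
      by auto
    have eL: "e \<in> Lsets n" using e internal_edges_Lsets[OF top(1)] by blast
    have flip: "M_chart n (\<tau>, s) t = M_chart n (\<sigma>, s(e := s e + 1)) u" if "s \<in> Z2L n" for s
      using eq[OF that Z2L_fun_upd[OF that eL]] inv_pt_reverse[OF top(1) e] unfolding eqs by blast
    show ?case
    proof (intro equalityI subsetI)
      fix z assume "z \<in> (\<lambda>s. M_chart n (\<tau>, s) t) ` Z2L n"
      then obtain s where "s \<in> Z2L n" "z = M_chart n (\<tau>, s) t" by (elim imageE) simp
      then show "z \<in> (\<lambda>s. M_chart n (\<sigma>, s) u) ` Z2L n"
        using flip Z2L_fun_upd[OF _ eL] by (intro image_eqI[of _ _ "s(e := s e + 1)"]) auto
    next
      fix z assume "z \<in> (\<lambda>s. M_chart n (\<sigma>, s) u) ` Z2L n"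
      then obtain s where s: "s \<in> Z2L n" "z = M_chart n (\<sigma>, s) u" by (elim imageE) simp
      define s' where "s' = s(e := s e + 1)"
      have s': "s' \<in> Z2L n" using Z2L_fun_upd[OF s(1) eL] by (simp add: s'_def)
      have "s'(e := s' e + 1) = s" by (cases "s e") (auto simp: s'_def fun_eq_iff)
      then have "z = M_chart n (\<tau>, s') t" using flip[OF s'] s(2) by simp
      then show "z \<in> (\<lambda>s. M_chart n (\<tau>, s) t) ` Z2L n" using s' by (rule image_eqI)
    qed
  next
    case c: (2 \<tau>' t' e)
    then have eqs: "\<tau>' = \<tau>" "t' = t" "\<sigma> = collapse e \<tau>" "u = restrict t (internal_edges \<tau> - {e})"
      and e: "e \<in> internal_edges \<tau>" "t e = 1" by auto
    show ?case using inv_pt_collapse[OF top(1) e(1), where t = t, OF e(2)] by (intro same) (simp add: eqs)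
  next
    case c: (3 \<tau>' \<sigma>' t')
    then have eqs: "\<tau>' = \<tau>" "t' = t" "\<sigma>' = \<sigma>" "u = t" and m: "mset \<sigma> = mset \<tau>" by auto
    show ?case using inv_pt_permute[OF top(1) m] by (intro same) (simp add: eqs)
  qed
qed

lemma orbit_Dhat_pt:
  assumes "\<tau> \<in> PF n" "t \<in> cube (internal_edges \<tau>)" "\<sigma> \<in> PF n" "u \<in> cube (internal_edges \<sigma>)"
    and "Dhat_pt n \<tau> t = Dhat_pt n \<sigma> u"
  shows "(\<lambda>s. M_chart n (\<tau>, s) t) ` Z2L n = (\<lambda>s. M_chart n (\<sigma>, s) u) ` Z2L n"
proof -
  have "((\<tau>, t), (\<sigma>, u)) \<in> (Dhat_glue n \<union> (Dhat_glue n)\<inverse>)\<^sup>*"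
    using gen_class_eq_iff[of "(\<tau>, t)" "Dhat_sum n" "(\<sigma>, u)" "Dhat_glue n"] assms
    by (simp add: topspace_Dhat_sum Dhat_pt_def)
  then have "(\<lambda>z. (\<lambda>s. M_chart n (fst z, s) (snd z)) ` Z2L n) (\<tau>, t) =
      (\<lambda>z. (\<lambda>s. M_chart n (fst z, s) (snd z)) ` Z2L n) (\<sigma>, u)"
  proof (rule rtrancl_invariant)
    fix a b assume "(a, b) \<in> Dhat_glue n"
    then show "(\<lambda>s. M_chart n (fst a, s) (snd a)) ` Z2L n = (\<lambda>s. M_chart n (fst b, s) (snd b)) ` Z2L n"
      using orbit_Dhat_glue[of "fst a" "snd a" "fst b" "snd b" n] by simp
  qed
  then show ?thesis by simp
qed

lemma M_point_chart:
  assumes "x \<in> topspace (space_of (M_cx n))"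
  obtains \<tau> s t where "\<tau> \<in> PF n" "s \<in> Z2L n" "t \<in> pos_cube (internal_edges \<tau>)"
    "t \<in> cube (internal_edges \<tau>)" "x = M_class n ((\<tau>, s), t)"
    "x = M_chart n (\<tau>, s) t"
proof -
  obtain z where z: "z \<in> topspace (M_sum n)" "x = M_class n z"
    using assms unfolding topspace_M by (elim imageE) simp
  obtain \<tau> s t where zt: "z = ((\<tau>, s), t)" by (metis prod.collapse)
  have "\<tau> \<in> PF n" "s \<in> Z2L n" "t \<in> pos_cube (internal_edges \<tau>)"
    using z(1) zt by (auto simp: topspace_M_sum)
  then show thesis
    using that[of \<tau> s t] M_pt_eq_chart[of "(\<tau>, s)" n t] z(2) zt pos_cube_subset[of "internal_edges \<tau>"]
    by auto
qed

lemma proj_eq_iff: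
  assumes x: "x \<in> topspace (space_of (M_cx n))" and y: "y \<in> topspace (space_of (M_cx n))"
  shows "proj n x = proj n y \<longleftrightarrow> (\<exists>g\<in>Z2L n. y = act n g x)"
proof
  obtain \<tau> s t where x': "\<tau> \<in> PF n" "s \<in> Z2L n" "t \<in> pos_cube (internal_edges \<tau>)"
    "t \<in> cube (internal_edges \<tau>)" "x = M_class n ((\<tau>, s), t)"
    "x = M_chart n (\<tau>, s) t"
    using M_point_chart[OF x] .
  have xt: "((\<tau>, s), t) \<in> topspace (M_sum n)" using x' by (simp add: topspace_M_sum)
  have act_x: "act n g x = M_class n (shift_index n g (\<tau>, s), t)" for g
    using act_class[OF xt] x'(5) by simp
  have xt': "(shift_index n g (\<tau>, s), t) \<in> topspace (M_sum n)" for g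
    using xt by (simp add: topspace_M_sum)
  {
    assume "\<exists>g\<in>Z2L n. y = act n g x"
    then obtain g where "y = act n g x" by (elim bexE)
    then show "proj n x = proj n y" using act_x[of g] proj_class[OF xt'[of g]] proj_class[OF xt] x'(5) by simp
  next
    assume eq: "proj n x = proj n y"
    obtain \<sigma> r u where y': "\<sigma> \<in> PF n" "r \<in> Z2L n" "u \<in> pos_cube (internal_edges \<sigma>)"
      "u \<in> cube (internal_edges \<sigma>)" "y = M_class n ((\<sigma>, r), u)"
      "y = M_chart n (\<sigma>, r) u"
      using M_point_chart[OF y] .
    have "Dhat_pt n \<tau> t = Dhat_pt n \<sigma> u"
      using eq x' y' proj_chart[of "(\<tau>, s)" n t] proj_chart[of "(\<sigma>, r)" n u] by simp
    then have "(\<lambda>s. M_chart n (\<tau>, s) t) ` Z2L n = (\<lambda>s. M_chart n (\<sigma>, s) u) ` Z2L n"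
      by (rule orbit_Dhat_pt[OF x'(1,4) y'(1,4)])
    then have "y \<in> (\<lambda>s. M_chart n (\<tau>, s) t) ` Z2L n" using y'(2,6) by (simp add: image_eqI)
    then obtain q where q: "q \<in> Z2L n" "y = M_chart n (\<tau>, q) t" by (elim imageE) simp
    \<comment> \<open>The difference of the two bit vectors, which is their sum in characteristic
      2.\<close>
    define g where "g = (\<lambda>S\<in>Lsets n. s S + q S)"
    have "shift_index n g (\<tau>, s) = (\<tau>, q)"
      using q(1) by (auto simp: shift_index_def g_def intro!: Z2L_eqI)
    then have "y = act n g x" using act_x[of g] q(2) M_pt_eq_chart[of "(\<tau>, q)" n t] x'(1,3) q(1) by simp
    then show "\<exists>g\<in>Z2L n. y = act n g x" by (intro bexI[of _ g]) (simp_all add: g_def)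
  }
qed

section \<open>Freeness of the action\<close>

lemma continuous_map_posn:
  "continuous_map (cube_topology (labels i)) euclideanreal (\<lambda>x. posn i x T)"
proof (cases "T \<in> labels i")
  case True
  have "continuous_map (cube_topology (labels i)) euclideanreal (\<lambda>x. x T)"
    using continuous_map_product_projection[OF True, of "\<lambda>_. top_of_set {- 1..1::real}"]
    by (simp add: continuous_map_in_subtopology cube_topology_def)
  then show ?thesis using True by (simp add: posn_def continuous_map_real_mult_left)
qed (simp add: posn_def)

text \<open>The condition \<open>V\<close> may depend on the index, so that a requirement on the
  twisted order can be encoded in it; \<open>inv\<close> makes the resulting open set of
  representatives saturated.\<close>

lemma openin_M_posn:
  assumes open_O: "\<And>i. i \<in> M_cells n \<Longrightarrow> open (V i)"
    and inv: "\<And>z z'. z \<in> topspace (M_sum n) \<Longrightarrow> z' \<in> topspace (M_sum n) \<Longrightarrow> inv_pt n z = inv_pt n z' \<Longrightarrow>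
      posn (fst z) (snd z) T \<in> V (fst z) \<Longrightarrow> posn (fst z') (snd z') T \<in> V (fst z')"
  defines "P \<equiv> {z \<in> topspace (M_sum n). posn (fst z) (snd z) T \<in> V (fst z)}"
  shows "openin (space_of (M_cx n)) (M_class n ` P)"
proof -
  let ?q = "M_class n"
  have op: "openin (M_sum n) P"
    unfolding M_sum_def openin_sum_topology
  proof (intro conjI ballI)
    show "P \<subseteq> Sigma (M_cells n) (topspace \<circ> (\<lambda>(\<tau>, s).
        subtopology (cube_topology (internal_edges \<tau>)) (pos_cube (internal_edges \<tau>))))"
      unfolding topspace_sum_topology[symmetric] M_sum_def[symmetric] by (auto simp: P_def)
    fix i assume i: "i \<in> M_cells n"
    let ?E = "labels i"
    have "{x. (i, x) \<in> P} = {x \<in> cube ?E. posn i x T \<in> V i} \<inter> pos_cube ?E"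
      using i pos_cube_subset[of ?E] by (auto simp: P_def topspace_M_sum)
    moreover have "openin (cube_topology ?E) {x \<in> cube ?E. posn i x T \<in> V i}"
      using openin_continuous_map_preimage[OF continuous_map_posn[of i T], of "V i"] open_O[OF i] by simp
    ultimately show "openin (case i of (\<tau>, s) \<Rightarrow>
        subtopology (cube_topology (internal_edges \<tau>)) (pos_cube (internal_edges \<tau>))) {x. (i, x) \<in> P}"
      by (auto simp: case_prod_beta openin_subtopology)
  qed
  have pre: "{z \<in> topspace (M_sum n). ?q z \<in> ?q ` P} = P"
  proof (intro equalityI subsetI)
    fix z assume "z \<in> {z \<in> topspace (M_sum n). ?q z \<in> ?q ` P}"
    then obtain z' where z: "z \<in> topspace (M_sum n)" "z' \<in> P" "?q z = ?q z'" by auto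
    then have z': "z' \<in> topspace (M_sum n)" "posn (fst z') (snd z') T \<in> V (fst z')" by (auto simp: P_def)
    have "inv_pt n z' = inv_pt n z" using z(3) M_class_eq_iff[OF z(1) z'(1)] by simp
    then show "z \<in> P" using inv[OF z'(1) z(1) _ z'(2)] z(1) by (simp add: P_def)
  qed (auto simp: P_def)
  have sub: "?q ` P \<subseteq> topspace (space_of (M_cx n))" unfolding topspace_M by (auto simp: P_def)
  have "\<forall>U. U \<subseteq> topspace (space_of (M_cx n)) \<longrightarrow>
      (openin (M_sum n) {z \<in> topspace (M_sum n). ?q z \<in> U} \<longleftrightarrow> openin (space_of (M_cx n)) U)"
    using quotient_map_M[of n] unfolding quotient_map_def by (rule conjunct2)
  from this[rule_format, OF sub] show ?thesis using op unfolding pre by (rule iffD1)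
qed

text \<open>A deck transformation either reverses the sign of a nonzero coordinate of the point or changes the twisted
  order of two leaves; both are locally constant.\<close>

lemma act_free:
  assumes x: "x \<in> topspace (space_of (M_cx n))" and g: "g \<in> Z2L n" "g \<noteq> (\<lambda>S\<in>Lsets n. 0)"
  shows "\<exists>W. openin (space_of (M_cx n)) W \<and> x \<in> W \<and> disjnt W (act n g ` W)"
proof -
  let ?q = "M_class n"
  obtain \<tau> s t where x': "\<tau> \<in> PF n" "s \<in> Z2L n" "t \<in> pos_cube (internal_edges \<tau>)"
    "x = ?q ((\<tau>, s), t)"
    using M_point_chart[OF x] by metis
  have xt: "((\<tau>, s), t) \<in> topspace (M_sum n)" using x' by (simp add: topspace_M_sum)
  \<comment> \<open>It suffices to find a condition on one coordinate that is open, invariant under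
    identification, true at \<open>x\<close>, and never true both at a point and at its translate by
    \<open>g\<close>.\<close>
  have separated: ?thesis
    if open_V: "\<And>i. i \<in> M_cells n \<Longrightarrow> open (V i)"
      and inv: "\<And>z z'. z \<in> topspace (M_sum n) \<Longrightarrow> z' \<in> topspace (M_sum n) \<Longrightarrow> inv_pt n z = inv_pt n z' \<Longrightarrow>
        posn (fst z) (snd z) T \<in> V (fst z) \<Longrightarrow> posn (fst z') (snd z') T \<in> V (fst z')"
      and mem: "posn (\<tau>, s) t T \<in> V (\<tau>, s)"
      and disj: "\<And>i y. i \<in> M_cells n \<Longrightarrow> posn i y T \<in> V i \<Longrightarrow>
        posn (shift_index n g i) y T \<notin> V (shift_index n g i)"
    for V :: "M_index \<Rightarrow> real set" and T
  proof -
    let ?P = "{z \<in> topspace (M_sum n). posn (fst z) (snd z) T \<in> V (fst z)}"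
    have "openin (space_of (M_cx n)) (?q ` ?P)" by (rule openin_M_posn[OF open_V inv])
    moreover have "x \<in> ?q ` ?P" using x'(4) xt mem by (intro image_eqI[of _ _ "((\<tau>, s), t)"]) auto
    moreover have "disjnt (?q ` ?P) (act n g ` ?q ` ?P)"
    proof (rule ccontr)
      assume "\<not> disjnt (?q ` ?P) (act n g ` ?q ` ?P)"
      then obtain z z' where z: "z \<in> ?P" "z' \<in> ?P" "?q z = act n g (?q z')"
        unfolding disjnt_iff by blast
      obtain i y where iy: "z' = (i, y)" by (cases z')
      have i: "i \<in> M_cells n" using z(2) iy by (simp add: topspace_M_sum)
      have top: "(shift_index n g i, y) \<in> topspace (M_sum n)" using z(2) iy by (simp add: topspace_M_sum)
      have top': "(i, y) \<in> topspace (M_sum n)" using z(2) iy by simp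
      have "?q z = ?q (shift_index n g i, y)" using z(3) act_class[OF top'] iy by simp
      moreover have zt: "z \<in> topspace (M_sum n)" "posn (fst z) (snd z) T \<in> V (fst z)" using z(1) by auto
      ultimately have "inv_pt n z = inv_pt n (shift_index n g i, y)"
        using M_class_eq_iff[OF zt(1) top] by simp
      from inv[OF zt(1) top this zt(2)] have "posn (shift_index n g i) y T \<in> V (shift_index n g i)" by simp
      moreover have "posn i y T \<in> V i" using z(2) iy by simp
      ultimately show False using disj[OF i] by blast
    qed
    ultimately show ?thesis by blast
  qed
  show ?thesis
  proof (cases "\<exists>T\<in>Lsets n. g T = 1 \<and> posn (\<tau>, s) t T \<noteq> 0")
    case True
    then obtain T where T: "T \<in> Lsets n" "g T = 1" "posn (\<tau>, s) t T \<noteq> 0" by (elim bexE conjE) simp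
    \<comment> \<open>The condition is to have a position of the same sign as \<open>x\<close> at
      \<open>T\<close>; since \<open>g T = 1\<close>, the translation reverses this sign.\<close>
    define c where "c = posn (\<tau>, s) t T"
    have V: "open {r. r * c > 0}"
      by (rule open_Collect_less) (intro continuous_intros)+
    show ?thesis
    proof (rule separated[of "\<lambda>_. {r. r * c > 0}" T])
      show "posn (\<tau>, s) t T \<in> {r. r * c > 0}"
        using T(3) by (simp add: c_def zero_less_mult_iff) linarith
      show "posn (shift_index n g i) y T \<notin> {r. r * c > 0}"
        if "i \<in> M_cells n" "posn i y T \<in> {r. r * c > 0}" for i y
        using that posn_shift[OF that(1), of g y T] T by simp
      fix z z' assume "inv_pt n z = inv_pt n z'" "posn (fst z) (snd z) T \<in> {r. r * c > 0}"
      then show "posn (fst z') (snd z') T \<in> {r. r * c > 0}"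
        using inv_pt_eq_iff[of n "fst z" "snd z" "fst z'" "snd z'"] by simp
    qed (rule V)
  next
    case False
    define N where "N = {T \<in> Lsets n. g T = 1}"
    have N_E: "N \<subseteq> internal_edges \<tau>"
    proof
      fix T assume "T \<in> N"
      then have "posn (\<tau>, s) t T = 0" using False by (auto simp: N_def)
      then show "T \<in> internal_edges \<tau>" by (cases "T \<in> internal_edges \<tau>") (simp_all add: posn_def)
    qed
    have "N \<noteq> {}"
    proof
      assume "N = {}"
      then have "g = (\<lambda>S\<in>Lsets n. 0)" by (intro Z2L_eqI[OF g(1)]) (auto simp: N_def)
      then show False using g(2) by simp
    qed
    moreover have "finite N" using N_E finite_subset finite_internal_edges by blast
    \<comment> \<open>All labels in the support of \<open>g\<close> are now edges at which the
      position vanishes. With \<open>e\<close> maximal in the support and \<open>a\<close>,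
      \<open>b\<close> separated just above \<open>e\<close>, every other edge containing both
      leaves is strictly larger than \<open>e\<close> and so not in the support. Hence the twisted
      order of \<open>a\<close> and \<open>b\<close> changes by \<open>g e = 1\<close>.\<close>
    ultimately obtain e where e: "e \<in> N" and max: "\<forall>f\<in>N. e \<subseteq> f \<longrightarrow> e = f"
      using finite_has_maximal by metis
    have e': "e \<in> internal_edges \<tau>" "e \<in> Lsets n" "g e = 1" using e N_E by (auto simp: N_def)
    have "branching \<tau>" "distinct (flat \<tau>)" using x'(1) by (auto simp: PF_iff)
    from internal_edge_split[OF this e'(1)]
    obtain a b where ab: "a \<in> e" "b \<in> e" "a \<noteq> b"
      and sep: "\<forall>f\<in>internal_edges \<tau>. a \<in> f \<and> b \<in> f \<longrightarrow> e \<subseteq> f"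
      by (elim bexE conjE) (rule that)
    have sum: "(\<Sum>T | T \<in> Lsets n \<and> a \<in> T \<and> b \<in> T. g T) = 1"
    proof -
      have "g f = 0" if "f \<in> {T \<in> Lsets n. a \<in> T \<and> b \<in> T} - {e}" for f
      proof (rule ccontr)
        assume "g f \<noteq> 0"
        then have "f \<in> N" using that by (simp add: N_def)
        then have "e \<subseteq> f" using sep N_E that by auto
        then show False using max \<open>f \<in> N\<close> that by auto
      qed
      then have "(\<Sum>T\<in>{T \<in> Lsets n. a \<in> T \<and> b \<in> T} - {e}. g T) = 0"
        by (rule sum.neutral[OF ballI])
      moreover have "e \<in> {T \<in> Lsets n. a \<in> T \<and> b \<in> T}" using e' ab by simp
      ultimately show ?thesis
        using sum.remove[of "{T \<in> Lsets n. a \<in> T \<and> b \<in> T}" e g] e'(3) by simp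
    qed
    \<comment> \<open>The empty set discards the indices with the other twisted order; on the open
      interval at \<open>e\<close> that order is an invariant of the point.\<close>
    define V where "V i = (if ordn n i a b = ordn n (\<tau>, s) a b then {-1<..<1::real} else {})" for i
    have te: "posn (\<tau>, s) t e = 0" using False e' by auto
    show ?thesis
    proof (rule separated[of V e])
      show "open (V i)" for i by (simp add: V_def)
      show "posn (\<tau>, s) t e \<in> V (\<tau>, s)" using te by (simp add: V_def)
      show "posn (shift_index n g i) y e \<notin> V (shift_index n g i)"
        if "i \<in> M_cells n" "posn i y e \<in> V i" for i y
      proof -
        have "ordn n i a b = ordn n (\<tau>, s) a b" using that(2) by (auto simp: V_def split: if_splits)
        then have "ordn n (shift_index n g i) a b \<noteq> ordn n (\<tau>, s) a b"
          unfolding ordn_shift sum by (cases "ordn n (\<tau>, s) a b") simp_all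
        then show ?thesis by (simp add: V_def)
      qed
      fix z z' assume inv: "inv_pt n z = inv_pt n z'" and z: "posn (fst z) (snd z) e \<in> V (fst z)"
      have o: "ordn n (fst z) a b = ordn n (\<tau>, s) a b" "\<bar>posn (fst z) (snd z) e\<bar> < 1"
        using z by (auto simp: V_def split: if_splits)
      have "inv_pt n (fst z, snd z) = inv_pt n (fst z', snd z')" using inv by simp
      then have "posn (fst z) (snd z) = posn (fst z') (snd z')" "ordn n (fst z) a b = ordn n (fst z') a b"
        unfolding inv_pt_eq_iff using o(2) ab by blast+
      then show "posn (fst z') (snd z') e \<in> V (fst z')" using o by (simp add: V_def abs_less_iff)
    qed
  qed
qed

lemma finite_degree_covering_proj:
  "finite_degree_covering_map (space_of (M_cx n)) (space_of (Dhat n)) (proj n)"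
proof (rule finite_degree_covering_map_orbits[where act = "act n" and G = "Z2L n"])
  let ?X = "space_of (M_cx n)" and ?e = "\<lambda>S\<in>Lsets n. 0 :: bit"
  show "finite (Z2L n)" by (rule finite_Z2L)
  show "?e \<in> Z2L n" by simp
  show "act n ?e x = x" if "x \<in> topspace ?X" for x by (rule act_zero[OF that])
  show "quotient_map ?X (space_of (Dhat n)) (proj n)" by (rule quotient_map_proj)
  show "homeomorphic_map ?X ?X (act n g)" for g by (rule homeomorphic_map_act)
  show "proj n x = proj n y \<longleftrightarrow> (\<exists>g\<in>Z2L n. y = act n g x)"
    if "x \<in> topspace ?X" "y \<in> topspace ?X" for x y by (rule proj_eq_iff[OF that])
  fix x assume x: "x \<in> topspace ?X"
  have "\<forall>g\<in>Z2L n - {?e}. \<exists>W. openin ?X W \<and> x \<in> W \<and> disjnt W (act n g ` W)"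
    using act_free[OF x] by blast
  then obtain W where W: "\<forall>g\<in>Z2L n - {?e}. openin ?X (W g) \<and> x \<in> W g \<and> disjnt (W g) (act n g ` W g)"
    using bchoice[of "Z2L n - {?e}"] by meson
  \<comment> \<open>For \<open>n = 1\<close> the group is trivial and there are no sets to
    intersect; the factor \<open>topspace\<close> makes \<open>U\<close> the whole space
    then.\<close>
  define U where "U = topspace ?X \<inter> (\<Inter>g\<in>Z2L n - {?e}. W g)"
  have "openin ?X U"
  proof (cases "Z2L n - {?e} = {}")
    case True
    have "U = topspace ?X" unfolding U_def True by simp
    then show ?thesis by simp
  next
    case False
    then show ?thesis
      unfolding U_def using W finite_Z2L by (intro openin_Int openin_topspace openin_INT2) auto
  qed
  moreover have "x \<in> U" using x W by (simp add: U_def)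
  moreover have "disjnt (act n g ` U) (act n h ` U)" if g: "g \<in> Z2L n" and h: "h \<in> Z2L n" and ne: "g \<noteq> h" for g h
  proof (rule ccontr)
    assume "\<not> disjnt (act n g ` U) (act n h ` U)"
    then obtain y z where yz: "y \<in> U" "z \<in> U" "act n g y = act n h z"
      unfolding disjnt_iff by blast
    \<comment> \<open>If translates by \<open>g\<close> and \<open>h\<close> meet, then so do
      \<open>U\<close> and its translate by the difference \<open>k = g + h\<close>, which is
      nonzero.\<close>
    define k where "k = (\<lambda>S\<in>Lsets n. g S + h S)"
    have k: "k \<in> Z2L n" by (simp add: k_def)
    have "k \<noteq> ?e"
    proof
      assume k0: "k = ?e"
      have "g T = h T" if "T \<in> Lsets n" for T
        using fun_cong[OF k0, of T] that by (cases "g T"; cases "h T") (auto simp: k_def)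
      then show False using ne Z2L_eqI[OF g h] by blast
    qed
    then have kW: "k \<in> Z2L n - {?e}" using k by simp
    have "z = act n h (act n h z)" using act_act_self[of z n h] yz(2) by (simp add: U_def)
    also have "\<dots> = act n k y" using yz(3)[symmetric] by (simp add: act_act k_def)
    finally have "z \<in> act n k ` W k" using yz(1) kW by (auto simp: U_def)
    moreover have "z \<in> W k" using yz(2) kW by (auto simp: U_def)
    ultimately show False using W kW unfolding disjnt_iff by blast
  qed
  ultimately show "\<exists>W. openin ?X W \<and> x \<in> W \<and>
      (\<forall>g\<in>Z2L n. \<forall>h\<in>Z2L n. g \<noteq> h \<longrightarrow> disjnt (act n g ` W) (act n h ` W))" by blast
qed

section \<open>Links and hyperplanes\<close>

subsection \<open>Directed 1-cubes\<close>

lemma posn_update: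
  "e \<in> labels i \<Longrightarrow> posn i (v(e := r)) = (posn i v)(e := sg (snd i e) * r)"
  by (auto simp: posn_def fun_eq_iff)

lemma abs_posn_corner: "v \<in> corners (labels i) \<Longrightarrow> \<bar>posn i v T\<bar> = 1"
  using corners_abs[of v "labels i" T] by (auto simp: posn_def abs_mult)

lemma corners_flip: "v \<in> corners E \<Longrightarrow> f \<in> E \<Longrightarrow> v(f := - v f) \<in> corners E"
  by (rule corners_I) (auto simp: corners_abs extensional_def corners_def PiE_def)

lemma corner_update_cube: "v \<in> corners E \<Longrightarrow> e \<in> E \<Longrightarrow> \<bar>r\<bar> \<le> 1 \<Longrightarrow> v(e := r) \<in> cube E"
  by (rule cube_I) (auto simp: corners_abs extensional_def corners_def PiE_def)

lemma origin_edge: "origin (edge (M_cx n) i v e) = M_chart n i v"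
  by (simp add: origin_def edge_def)

lemma edge_midpoint: "edge (M_cx n) i v e 0 = M_chart n i (v(e := 0))"
  by (simp add: edge_def)

lemma rev_edge_edge: "rev_edge (edge (M_cx n) i v e) = edge (M_cx n) i (v(e := - v e)) e"
  unfolding rev_edge_def by (rule ext) (auto simp: edge_def restrict_def)

text \<open>The origin yields the position, and the midpoint, where the position vanishes at exactly
  one label, yields this label and the order below it. Conversely, these data determine the
  invariants of every point of the 1-cube.\<close>

lemma edge_eq_iff:
  assumes ij: "i \<in> M_cells n" "j \<in> M_cells n"
    and vw: "v \<in> corners (labels i)" "w \<in> corners (labels j)"
    and ef: "e \<in> labels i" "f \<in> labels j"
  shows "edge (M_cx n) i v e = edge (M_cx n) j w f \<longleftrightarrow>
    e = f \<and> posn i v = posn j w \<and> (\<forall>a\<in>e. \<forall>b\<in>e. a \<noteq> b \<longrightarrow> ordn n i a b = ordn n j a b)"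
proof
  assume eq: "edge (M_cx n) i v e = edge (M_cx n) j w f"
  have "M_chart n i v = M_chart n j w"
    using arg_cong[OF eq, of origin] by (simp add: origin_edge)
  then have pos: "posn i v = posn j w"
    using M_chart_eq_iff[OF ij(1) _ ij(2)] vw corners_subset unfolding inv_pt_eq_iff by blast
  have "M_chart n i (v(e := 0)) = M_chart n j (w(f := 0))"
    using fun_cong[OF eq, of 0] by (simp add: edge_midpoint)
  then have inv: "inv_pt n (i, v(e := 0)) = inv_pt n (j, w(f := 0))"
    using M_chart_eq_iff[OF ij(1) corner_update_cube[OF vw(1) ef(1), of 0]
        ij(2) corner_update_cube[OF vw(2) ef(2), of 0]] by simp
  then have pos0: "(posn i v)(e := 0) = (posn j w)(f := 0)"
    unfolding inv_pt_eq_iff posn_update[OF ef(1)] posn_update[OF ef(2)] by simp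
  have "e = f"
  proof (rule ccontr)
    assume "e \<noteq> f"
    then have "posn j w e = 0" using fun_cong[OF pos0, of e] by simp
    then show False using abs_posn_corner[OF vw(2), of e] by simp
  qed
  moreover have "ordn n i a b = ordn n j a b" if ab: "a \<in> e" "b \<in> e" "a \<noteq> b" for a b
  proof -
    have "\<bar>posn i (v(e := 0)) e\<bar> < 1" by (simp add: posn_update[OF ef(1)])
    then show ?thesis using inv ab unfolding inv_pt_eq_iff by blast
  qed
  ultimately show "e = f \<and> posn i v = posn j w \<and>
      (\<forall>a\<in>e. \<forall>b\<in>e. a \<noteq> b \<longrightarrow> ordn n i a b = ordn n j a b)" using pos by blast
next
  assume r: "e = f \<and> posn i v = posn j w \<and>
      (\<forall>a\<in>e. \<forall>b\<in>e. a \<noteq> b \<longrightarrow> ordn n i a b = ordn n j a b)"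
  have "M_chart n i (v(e := - u * v e)) = M_chart n j (w(f := - u * w f))" if u: "u \<in> {-1..1}" for u
  proof -
    have le: "\<bar>- u * v e\<bar> \<le> 1" "\<bar>- u * w f\<bar> \<le> 1"
      using u corners_abs[OF vw(1) ef(1)] corners_abs[OF vw(2) ef(2)] by (auto simp: abs_mult abs_le_iff)
    have pi: "posn i (v(e := - u * v e)) = (posn i v)(e := - u * posn i v e)"
      unfolding posn_update[OF ef(1)] using ef(1) by (simp add: posn_def mult.left_commute)
    have pj: "posn j (w(f := - u * w f)) = (posn j w)(f := - u * posn j w f)"
      unfolding posn_update[OF ef(2)] using ef(2) by (simp add: posn_def mult.left_commute)
    have eqp: "posn i (v(e := - u * v e)) = posn j (w(f := - u * w f))"
      unfolding pi pj using r by simp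
    have "ordn n i a b = ordn n j a b"
      if "\<bar>posn i (v(e := - u * v e)) g\<bar> < 1" "a \<in> g" "b \<in> g" "a \<noteq> b" for g a b
    proof -
      have "g = e" using that(1) abs_posn_corner[OF vw(1), of g] unfolding pi by (cases "g = e") auto
      then show ?thesis using r that by blast
    qed
    then have "inv_pt n (i, v(e := - u * v e)) = inv_pt n (j, w(f := - u * w f))"
      unfolding inv_pt_eq_iff using eqp by (intro conjI allI impI)
    then show ?thesis
      using M_chart_eq_iff[OF ij(1) corner_update_cube[OF vw(1) ef(1) le(1)]
          ij(2) corner_update_cube[OF vw(2) ef(2) le(2)]] by simp
  qed
  then show "edge (M_cx n) i v e = edge (M_cx n) j w f"
    by (auto simp: edge_def restrict_def fun_eq_iff)
qed

lemma edges_M_E: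
  assumes "\<gamma> \<in> edges (M_cx n)"
  obtains i v e where "i \<in> M_cells n" "v \<in> corners (labels i)"
    "e \<in> labels i" "\<gamma> = edge (M_cx n) i v e"
proof -
  from assms obtain i v e where "\<gamma> = edge (M_cx n) i v e" "i \<in> cells (M_cx n)"
    "v \<in> corners (coords (M_cx n) i)" "e \<in> coords (M_cx n) i"
    unfolding edges_def by (elim CollectE exE conjE) (rule that)
  then show thesis using that[of i v e] by simp
qed

lemma posn_eq_if_chart_eq:
  assumes "i \<in> M_cells n" "j \<in> M_cells n"
    and "v \<in> corners (labels i)" "w \<in> corners (labels j)"
    and "M_chart n i v = M_chart n j w"
  shows "posn i v = posn j w"
  using M_chart_eq_iff[OF assms(1) subsetD[OF corners_subset assms(3)]
      assms(2) subsetD[OF corners_subset assms(4)]] assms(5)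
  unfolding inv_pt_eq_iff by simp

lemma chart_eq_if_posn_eq:
  assumes "i \<in> M_cells n" "j \<in> M_cells n"
    and "v \<in> corners (labels i)" "w \<in> corners (labels j)"
    and "posn i v = posn j w"
  shows "M_chart n i v = M_chart n j w"
proof -
  have "inv_pt n (i, v) = inv_pt n (j, w)"
    unfolding inv_pt_eq_iff using assms(5) abs_posn_corner[OF assms(3)] by simp
  then show ?thesis
    using M_chart_eq_iff[OF assms(1) subsetD[OF corners_subset assms(3)]
      assms(2) subsetD[OF corners_subset assms(4)]] by simp
qed

abbreviation ones :: "ptree list \<Rightarrow> nat set \<Rightarrow> real" where
  "ones \<tau> \<equiv> \<lambda>e\<in>internal_edges \<tau>. 1"

lemma posn_ones: "posn (\<tau>, s) (ones \<tau>) = (\<lambda>T. sg (s T))"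
  by (auto simp: posn_def fun_eq_iff)

text \<open>Reflecting the coordinates equal to -1 moves the corner to the one with all coordinates
  1 of another subcube, where the position is just the sign of the bits. So the bits
  \<open>s\<close> are the vertex as an element of \<open>(\<int>/2)^L\<close>.\<close>

lemma normalize_corner:
  assumes i: "i \<in> M_cells n" and v: "v \<in> corners (labels i)"
  obtains \<tau> s where "\<tau> \<in> PF n" "s \<in> Z2L n" "internal_edges \<tau> = labels i"
    "posn i v = (\<lambda>T. sg (s T))"
    "\<forall>e\<in>labels i. edge (M_cx n) i v e = edge (M_cx n) (\<tau>, s) (ones \<tau>) e"
proof -
  define N where "N = {e \<in> labels i. v e = -1}"
  have N: "N \<subseteq> labels i" by (auto simp: N_def)
  obtain \<tau> s where ts: "flip n N i = (\<tau>, s)" by (cases "flip n N i")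
  have fl: "\<tau> \<in> PF n" "s \<in> Z2L n" "internal_edges \<tau> = labels i"
    using flip_index(1,2)[OF i N] ts by auto
  have "(\<lambda>e\<in>labels i. if e \<in> N then - v e else v e) = ones \<tau>"
    using corners_D[OF v] fl(3) by (auto simp: N_def fun_eq_iff)
  then have pos: "posn i v = posn (\<tau>, s) (ones \<tau>)" using flip_index(4)[OF i N, of v] ts by simp
  have "edge (M_cx n) i v e = edge (M_cx n) (\<tau>, s) (ones \<tau>) e" if e: "e \<in> labels i" for e
  proof -
    have "ordn n i a b = ordn n (\<tau>, s) a b" if "a \<noteq> b" for a b
      using flip_index(3)[OF i N that] ts by simp
    then show ?thesis
      using edge_eq_iff[OF i, of "(\<tau>, s)" v "ones \<tau>" e e] fl v e pos ones_corner[of "internal_edges \<tau>"]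
      by simp
  qed
  then show thesis using that[OF fl] pos posn_ones by simp
qed

text \<open>With the same bits \<open>s\<close> on both sides the sums in \<open>ordn\<close>
  cancel, so at a fixed vertex only the actual orders of the leaves remain to be compared.\<close>

lemma edge_ones_eq_iff:
  assumes "\<tau> \<in> PF n" "\<sigma> \<in> PF n" "s \<in> Z2L n" "e \<in> internal_edges \<tau>" "f \<in> internal_edges \<sigma>"
  shows "edge (M_cx n) (\<tau>, s) (ones \<tau>) e = edge (M_cx n) (\<sigma>, s) (ones \<sigma>) f \<longleftrightarrow>
    e = f \<and> (\<forall>a\<in>e. \<forall>b\<in>e. before (flat \<tau>) a b \<longleftrightarrow> before (flat \<sigma>) a b)"
proof -
  have irrefl: "\<not> before (flat \<tau>) a a" "\<not> before (flat \<sigma>) a a" for a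
    using before_asym[of "flat \<tau>" a a] before_asym[of "flat \<sigma>" a a] assms(1,2) by (auto simp: PF_iff)
  have ordn: "ordn n (\<tau>, s) a b = ordn n (\<sigma>, s) a b \<longleftrightarrow> (before (flat \<tau>) a b \<longleftrightarrow> before (flat \<sigma>) a b)" for a b
    unfolding ordn_def fst_conv snd_conv add_right_cancel
    by (cases "before (flat \<tau>) a b"; cases "before (flat \<sigma>) a b") simp_all
  have "edge (M_cx n) (\<tau>, s) (ones \<tau>) e = edge (M_cx n) (\<sigma>, s) (ones \<sigma>) f \<longleftrightarrow>
    e = f \<and> (\<forall>a\<in>e. \<forall>b\<in>e. a \<noteq> b \<longrightarrow> (before (flat \<tau>) a b \<longleftrightarrow> before (flat \<sigma>) a b))"
    using edge_eq_iff[of "(\<tau>, s)" n "(\<sigma>, s)" "ones \<tau>" "ones \<sigma>" e f] assms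
      ones_corner[of "internal_edges \<tau>"] ones_corner[of "internal_edges \<sigma>"]
    by (simp add: posn_ones ordn)
  also have "\<dots> \<longleftrightarrow> e = f \<and> (\<forall>a\<in>e. \<forall>b\<in>e. before (flat \<tau>) a b \<longleftrightarrow> before (flat \<sigma>) a b)"
    using irrefl by metis
  finally show ?thesis .
qed

subsection \<open>The complex is nonpositively curved\<close>

text \<open>The directed 1-cubes of a corner are told apart by their labels. If two corners have the
  same ones, the labels and the orders below them agree, which are the hypotheses of
  \<open>M_gluing\<close>.\<close>

lemma link_simplicial_M: "link_simplicial (M_cx n) x"
  unfolding link_simplicial_def
proof (intro conjI allI impI)
  fix i v F assume c: "cube_corner (M_cx n) x i v F"
  then have i: "i \<in> M_cells n" "v \<in> corners (labels i)" "F \<subseteq> labels i"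
    by (auto simp: cube_corner_def)
  show "inj_on (edge (M_cx n) i v) F"
  proof (rule inj_onI)
    fix e f assume "e \<in> F" "f \<in> F" "edge (M_cx n) i v e = edge (M_cx n) i v f"
    then show "e = f" using edge_eq_iff[OF i(1,1,2,2), of e f] i(3) by auto
  qed
next
  fix i v F j w G
  assume c: "cube_corner (M_cx n) x i v F" "cube_corner (M_cx n) x j w G"
    and eq: "edge (M_cx n) i v ` F = edge (M_cx n) j w ` G"
  have i: "i \<in> M_cells n" "v \<in> corners (labels i)" "F \<subseteq> labels i"
    and j: "j \<in> M_cells n" "w \<in> corners (labels j)" "G \<subseteq> labels j"
    and x: "M_chart n i v = M_chart n j w"
    using c by (auto simp: cube_corner_def)
  have pos: "posn i v = posn j w" by (rule posn_eq_if_chart_eq[OF i(1) j(1) i(2) j(2) x])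
  have FG: "e \<in> G \<and> (\<forall>a\<in>e. \<forall>b\<in>e. a \<noteq> b \<longrightarrow> ordn n i a b = ordn n j a b)" if e: "e \<in> F" for e
  proof -
    have "edge (M_cx n) i v e \<in> edge (M_cx n) j w ` G" using eq e by blast
    then obtain f where f: "f \<in> G" "edge (M_cx n) i v e = edge (M_cx n) j w f" by (elim imageE) simp
    then show ?thesis using edge_eq_iff[OF i(1) j(1) i(2) j(2), of e f] e i(3) j(3) by auto
  qed
  have GF: "e \<in> F" if e: "e \<in> G" for e
  proof -
    have "edge (M_cx n) j w e \<in> edge (M_cx n) i v ` F" using eq e by blast
    then obtain f where f: "f \<in> F" "edge (M_cx n) j w e = edge (M_cx n) i v f" by (elim imageE) simp
    then show ?thesis using edge_eq_iff[OF j(1) i(1) j(2) i(2), of e f] e i(3) j(3) by auto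
  qed
  have G: "G = F" using FG GF by auto
  have "gluing (M_cx n) i (face (labels i) v F) j (face (labels j) w F)
      (transfer i j F w)"
  proof (rule M_gluing[OF i(1) j(1) i(2) j(2) i(3)])
    show "F \<subseteq> labels j" using j(3) G by simp
    show "posn i v T = posn j w T" for T using pos by simp
    show "ordn n i a b = ordn n j a b" if "e \<in> F" "a \<in> e" "b \<in> e" "a \<noteq> b" for e a b
      using FG[OF that(1)] that(2-4) by blast
  qed
  moreover have "transfer i j F w v = w"
  proof
    fix T
    consider "T \<in> F" | "T \<notin> F" "T \<in> labels j" | "T \<notin> labels j" by blast
    then show "transfer i j F w v T = w T"
    proof cases
      case 1
      then have T: "T \<in> labels i" "T \<in> labels j" using i(3) j(3) G by auto
      then have "sg (snd i T) * v T = sg (snd j T) * w T" using fun_cong[OF pos, of T] by (simp add: posn_def)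
      then have "sg (snd j T) * (sg (snd i T) * v T) = w T" by simp
      then show ?thesis using 1 T by (simp add: transfer_def ac_simps)
    next
      case 2
      then show ?thesis by (simp add: transfer_def)
    next
      case 3
      then show ?thesis using j(2) by (simp add: transfer_def corners_def PiE_def extensional_def)
    qed
  qed
  ultimately show "\<exists>h. gluing (M_cx n) i (face (coords (M_cx n) i) v F) j (face (coords (M_cx n) j) w G) h \<and>
      h v = w"
    unfolding G M_cx_simps by blast
qed

text \<open>All conditions concern pairs, since \<open>forest_exists\<close> asks for no more; this
  is the reason for flagness. Each \<open>\<gamma>\<close> contributes the leaf set
  \<open>\<epsilon> \<gamma>\<close> with its order in \<open>\<theta> \<gamma>\<close>. The general
  index set allows use for links and, with index type \<open>bool\<close>, for two
  hyperplanes.\<close>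

lemma compatible_forest:
  fixes \<theta> :: "'a \<Rightarrow> ptree list" and \<epsilon> :: "'a \<Rightarrow> nat set"
  assumes "finite S"
    and \<theta>: "\<And>\<gamma>. \<gamma> \<in> S \<Longrightarrow> \<theta> \<gamma> \<in> PF n \<and> \<epsilon> \<gamma> \<in> internal_edges (\<theta> \<gamma>)"
    and laminar: "\<And>\<gamma> \<delta>. \<gamma> \<in> S \<Longrightarrow> \<delta> \<in> S \<Longrightarrow> \<gamma> \<noteq> \<delta> \<Longrightarrow>
      \<epsilon> \<gamma> \<noteq> \<epsilon> \<delta> \<and> (\<epsilon> \<gamma> \<subseteq> \<epsilon> \<delta> \<or> \<epsilon> \<delta> \<subseteq> \<epsilon> \<gamma> \<or> \<epsilon> \<gamma> \<inter> \<epsilon> \<delta> = {})"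
    and agree: "\<And>\<gamma> \<delta> a b. \<gamma> \<in> S \<Longrightarrow> \<delta> \<in> S \<Longrightarrow> \<epsilon> \<gamma> \<subset> \<epsilon> \<delta> \<Longrightarrow> a \<in> \<epsilon> \<gamma> \<Longrightarrow> b \<in> \<epsilon> \<gamma> \<Longrightarrow>
      before (flat (\<theta> \<gamma>)) a b \<longleftrightarrow> before (flat (\<theta> \<delta>)) a b"
    and convex: "\<And>\<gamma> \<delta> a b k. \<gamma> \<in> S \<Longrightarrow> \<delta> \<in> S \<Longrightarrow> \<epsilon> \<gamma> \<subset> \<epsilon> \<delta> \<Longrightarrow> a \<in> \<epsilon> \<gamma> \<Longrightarrow> b \<in> \<epsilon> \<gamma> \<Longrightarrow>
      k \<in> \<epsilon> \<delta> - \<epsilon> \<gamma> \<Longrightarrow> before (flat (\<theta> \<delta>)) k a \<longleftrightarrow> before (flat (\<theta> \<delta>)) k b"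
  shows "\<exists>\<tau>\<in>PF n. internal_edges \<tau> = \<epsilon> ` S \<and>
    (\<forall>\<gamma>\<in>S. \<forall>a\<in>\<epsilon> \<gamma>. \<forall>b\<in>\<epsilon> \<gamma>. before (flat \<tau>) a b \<longleftrightarrow> before (flat (\<theta> \<gamma>)) a b)"
proof -
  have inj: "inj_on \<epsilon> S" using laminar by (intro inj_onI) blast
  define w where "w e = filter (\<lambda>a. a \<in> e) (flat (\<theta> (inv_into S \<epsilon> e)))" for e
  have w: "w (\<epsilon> \<gamma>) = filter (\<lambda>a. a \<in> \<epsilon> \<gamma>) (flat (\<theta> \<gamma>))" if "\<gamma> \<in> S" for \<gamma>
    using inv_into_f_f[OF inj that] by (simp add: w_def)
  have before_w: "before (w (\<epsilon> \<gamma>)) a b \<longleftrightarrow> before (flat (\<theta> \<gamma>)) a b"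
    if "\<gamma> \<in> S" "a \<in> \<epsilon> \<gamma>" "b \<in> \<epsilon> \<gamma>" for \<gamma> a b
    using that by (simp add: w before_filter)
  have "\<exists>\<tau>\<in>PF n. internal_edges \<tau> = \<epsilon> ` S \<and>
      (\<forall>e\<in>\<epsilon> ` S. \<forall>a\<in>e. \<forall>b\<in>e. before (flat \<tau>) a b \<longleftrightarrow> before (w e) a b)"
  proof (rule forest_exists)
    show "finite (\<epsilon> ` S)" using assms(1) by simp
    fix e f a b k assume "e \<in> \<epsilon> ` S"
    then obtain \<gamma> where g: "\<gamma> \<in> S" "e = \<epsilon> \<gamma>" by (elim imageE) simp
    have t: "branching (\<theta> \<gamma>)" "distinct (flat (\<theta> \<gamma>))" "set (flat (\<theta> \<gamma>)) = {1..n}" "e \<in> internal_edges (\<theta> \<gamma>)"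
      using \<theta>[OF g(1)] g(2) by (auto simp: PF_iff)
    show "e \<subseteq> {1..n} \<and> 2 \<le> card e"
      using internal_edge_subset[OF t(4)] two_le_card_internal_edge[OF t(1,2,4)] t(3) by simp
    show "distinct (w e) \<and> set (w e) = e"
      using w[OF g(1)] g(2) t(2) internal_edge_subset[OF t(4)] by auto
    assume "f \<in> \<epsilon> ` S"
    then obtain \<delta> where d: "\<delta> \<in> S" "f = \<epsilon> \<delta>" by (elim imageE) simp
    show "e \<subseteq> f \<or> f \<subseteq> e \<or> e \<inter> f = {}"
      using laminar[OF g(1) d(1)] g(2) d(2) by (cases "\<gamma> = \<delta>") auto
    assume sub: "e \<subset> f" and ab: "a \<in> e" "b \<in> e"
    then have ab': "a \<in> \<epsilon> \<gamma>" "b \<in> \<epsilon> \<gamma>" "a \<in> \<epsilon> \<delta>" "b \<in> \<epsilon> \<delta>" and sub': "\<epsilon> \<gamma> \<subset> \<epsilon> \<delta>"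
      using g(2) d(2) by auto
    show "before (w e) a b \<longleftrightarrow> before (w f) a b"
      using agree[OF g(1) d(1) sub' ab'(1,2)] before_w[OF g(1) ab'(1,2)] before_w[OF d(1) ab'(3,4)]
        g(2) d(2) by simp
    assume k: "k \<in> f - e"
    then have k': "k \<in> \<epsilon> \<delta>" "k \<in> \<epsilon> \<delta> - \<epsilon> \<gamma>" using g(2) d(2) by auto
    show "before (w f) k a \<longleftrightarrow> before (w f) k b"
      using convex[OF g(1) d(1) sub' ab'(1,2) k'(2)] before_w[OF d(1) k'(1) ab'(3)]
        before_w[OF d(1) k'(1) ab'(4)] d(2) by simp
  qed
  then obtain \<tau> where \<tau>: "\<tau> \<in> PF n" "internal_edges \<tau> = \<epsilon> ` S"
    "\<forall>e\<in>\<epsilon> ` S. \<forall>a\<in>e. \<forall>b\<in>e. before (flat \<tau>) a b \<longleftrightarrow> before (w e) a b"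
    by (elim bexE conjE) (rule that)
  have "before (flat \<tau>) a b \<longleftrightarrow> before (flat (\<theta> \<gamma>)) a b"
    if "\<gamma> \<in> S" "a \<in> \<epsilon> \<gamma>" "b \<in> \<epsilon> \<gamma>" for \<gamma> a b
    using \<tau>(3)[rule_format, OF imageI[OF that(1)] that(2,3)] before_w[OF that] by simp
  then show ?thesis using \<tau>(1,2) by blast
qed

lemma cube_cornerD:
  assumes "cube_corner (M_cx n) x i v F"
  shows "i \<in> M_cells n" "v \<in> corners (labels i)" "F \<subseteq> labels i"
    "M_chart n i v = x"
  using assms by (auto simp: cube_corner_def)

lemma sg_fun_inject: "(\<lambda>T. sg (s T)) = (\<lambda>T. sg (s' T)) \<Longrightarrow> s = s'"
  by (rule ext) (metis sg_inject)

text \<open>Two 1-cubes that span a square are edges of one forest \<open>\<sigma>\<close> with the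
  same vertex \<open>s\<close>. There their leaf sets are laminar, the orders are both induced from
  \<open>flat \<sigma>\<close>, and the smaller set is an interval; these are the pairwise
  conditions for a common forest of all of \<open>S\<close>.\<close>

lemma link_flag_M:
  assumes x: "x \<in> zero_cubes (M_cx n)"
  shows "link_flag (M_cx n) x"
  unfolding link_flag_def
proof (intro allI impI, elim conjE)
  fix S assume fin: "finite S" and link: "S \<subseteq> link_vertices (M_cx n) x"
    and pairs: "\<forall>a\<in>S. \<forall>b\<in>S. a \<noteq> b \<longrightarrow> {a, b} \<in> link_simplices (M_cx n) x"
  obtain i\<^sub>0 v\<^sub>0 where x0: "x = M_chart n i\<^sub>0 v\<^sub>0" "i\<^sub>0 \<in> M_cells n" "v\<^sub>0 \<in> corners (labels i\<^sub>0)"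
    using x unfolding zero_cubes_def M_cx_simps by (elim CollectE exE conjE) (rule that)
  \<comment> \<open>The vertex \<open>x\<close> as a bit vector; every corner at \<open>x\<close> is
    then normalized to the corner \<open>ones\<close> of a cube with this same
    \<open>s\<close>.\<close>
  obtain s where s: "s \<in> Z2L n" "posn i\<^sub>0 v\<^sub>0 = (\<lambda>T. sg (s T))"
    by (rule normalize_corner[OF x0(2,3)], rule that, assumption+)
  have normal: "\<exists>\<tau>\<in>PF n. internal_edges \<tau> = labels i \<and>
      (\<forall>e\<in>labels i. edge (M_cx n) i v e = edge (M_cx n) (\<tau>, s) (ones \<tau>) e)"
    if i: "i \<in> M_cells n" and v: "v \<in> corners (labels i)" and xi: "M_chart n i v = x" for i v
  proof -
    obtain \<tau> r where r: "\<tau> \<in> PF n" "r \<in> Z2L n" "internal_edges \<tau> = labels i"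
      "posn i v = (\<lambda>T. sg (r T))"
      "\<forall>e\<in>labels i. edge (M_cx n) i v e = edge (M_cx n) (\<tau>, r) (ones \<tau>) e"
      using normalize_corner[OF i v] .
    have "posn i v = posn i\<^sub>0 v\<^sub>0" using posn_eq_if_chart_eq[OF i x0(2) v x0(3)] xi x0(1) by simp
    then have "r = s" using s(2) r(4) by (intro sg_fun_inject) simp
    then show ?thesis using r(1,3,5) by (intro bexI[of _ \<tau>]) simp_all
  qed
  have "\<exists>\<tau> e. \<tau> \<in> PF n \<and> e \<in> internal_edges \<tau> \<and> \<gamma> = edge (M_cx n) (\<tau>, s) (ones \<tau>) e" if "\<gamma> \<in> S" for \<gamma>
  proof -
    have \<gamma>: "\<gamma> \<in> edges (M_cx n)" "origin \<gamma> = x" using link that by (auto simp: link_vertices_def)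
    obtain i v e where i: "i \<in> M_cells n" "v \<in> corners (labels i)"
      "e \<in> labels i" "\<gamma> = edge (M_cx n) i v e" using edges_M_E[OF \<gamma>(1)] .
    have "M_chart n i v = x" using \<gamma>(2) i(4) origin_edge by metis
    from normal[OF i(1,2) this] obtain \<tau> where "\<tau> \<in> PF n" "internal_edges \<tau> = labels i"
      "\<forall>e\<in>labels i. edge (M_cx n) i v e = edge (M_cx n) (\<tau>, s) (ones \<tau>) e"
      by (elim bexE conjE) (rule that)
    then have "\<tau> \<in> PF n \<and> e \<in> internal_edges \<tau> \<and> \<gamma> = edge (M_cx n) (\<tau>, s) (ones \<tau>) e"
      using i(3,4) by simp
    then show ?thesis by blast
  qed
  then obtain \<theta> \<epsilon> where \<theta>: "\<And>\<gamma>. \<gamma> \<in> S \<Longrightarrow> \<theta> \<gamma> \<in> PF n \<and> \<epsilon> \<gamma> \<in> internal_edges (\<theta> \<gamma>) \<and>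
      \<gamma> = edge (M_cx n) (\<theta> \<gamma>, s) (ones (\<theta> \<gamma>)) (\<epsilon> \<gamma>)" by metis
  have common: "\<exists>\<sigma>\<in>PF n. \<epsilon> \<gamma> \<in> internal_edges \<sigma> \<and> \<epsilon> \<delta> \<in> internal_edges \<sigma> \<and> \<epsilon> \<gamma> \<noteq> \<epsilon> \<delta> \<and>
      (\<forall>a\<in>\<epsilon> \<gamma>. \<forall>b\<in>\<epsilon> \<gamma>. before (flat (\<theta> \<gamma>)) a b \<longleftrightarrow> before (flat \<sigma>) a b) \<and>
      (\<forall>a\<in>\<epsilon> \<delta>. \<forall>b\<in>\<epsilon> \<delta>. before (flat (\<theta> \<delta>)) a b \<longleftrightarrow> before (flat \<sigma>) a b)"
    if \<gamma>: "\<gamma> \<in> S" and \<delta>: "\<delta> \<in> S" and ne: "\<gamma> \<noteq> \<delta>" for \<gamma> \<delta>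
  proof -
    have "{\<gamma>, \<delta>} \<in> link_simplices (M_cx n) x" using pairs \<gamma> \<delta> ne by blast
    then obtain i v F where F: "{\<gamma>, \<delta>} = edge (M_cx n) i v ` F" "cube_corner (M_cx n) x i v F"
      unfolding link_simplices_def by (elim CollectE exE conjE) (rule that)
    note c = cube_cornerD[OF F(2)]
    from normal[OF c(1,2,4)] obtain \<sigma> where \<sigma>: "\<sigma> \<in> PF n" "internal_edges \<sigma> = labels i"
      "\<forall>e\<in>labels i. edge (M_cx n) i v e = edge (M_cx n) (\<sigma>, s) (ones \<sigma>) e"
      by (elim bexE conjE) (rule that)
    have "\<exists>e\<in>internal_edges \<sigma>. \<zeta> = edge (M_cx n) (\<sigma>, s) (ones \<sigma>) e" if "\<zeta> \<in> {\<gamma>, \<delta>}" for \<zeta>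
    proof -
      obtain e where e: "e \<in> F" "\<zeta> = edge (M_cx n) i v e" using \<open>\<zeta> \<in> {\<gamma>, \<delta>}\<close> unfolding F(1) by (elim imageE) simp
      then have "e \<in> labels i" using c(3) by auto
      then show ?thesis using \<sigma>(2,3) e(2) by auto
    qed
    then obtain e f where e: "e \<in> internal_edges \<sigma>" "\<gamma> = edge (M_cx n) (\<sigma>, s) (ones \<sigma>) e"
      and f: "f \<in> internal_edges \<sigma>" "\<delta> = edge (M_cx n) (\<sigma>, s) (ones \<sigma>) f" by blast
    have "edge (M_cx n) (\<theta> \<gamma>, s) (ones (\<theta> \<gamma>)) (\<epsilon> \<gamma>) = edge (M_cx n) (\<sigma>, s) (ones \<sigma>) e"
      using \<theta>[OF \<gamma>] e(2) by simp
    then have 1: "\<epsilon> \<gamma> = e" "\<forall>a\<in>\<epsilon> \<gamma>. \<forall>b\<in>\<epsilon> \<gamma>. before (flat (\<theta> \<gamma>)) a b \<longleftrightarrow> before (flat \<sigma>) a b"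
      using edge_ones_eq_iff[of "\<theta> \<gamma>" n \<sigma> s "\<epsilon> \<gamma>" e] \<theta>[OF \<gamma>] \<sigma>(1) s(1) e(1) by simp_all
    have "edge (M_cx n) (\<theta> \<delta>, s) (ones (\<theta> \<delta>)) (\<epsilon> \<delta>) = edge (M_cx n) (\<sigma>, s) (ones \<sigma>) f"
      using \<theta>[OF \<delta>] f(2) by simp
    then have 2: "\<epsilon> \<delta> = f" "\<forall>a\<in>\<epsilon> \<delta>. \<forall>b\<in>\<epsilon> \<delta>. before (flat (\<theta> \<delta>)) a b \<longleftrightarrow> before (flat \<sigma>) a b"
      using edge_ones_eq_iff[of "\<theta> \<delta>" n \<sigma> s "\<epsilon> \<delta>" f] \<theta>[OF \<delta>] \<sigma>(1) s(1) f(1) by simp_all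
    have "e \<noteq> f" using ne e(2) f(2) by auto
    then show ?thesis using \<sigma>(1) 1 2 e(1) f(1) by (intro bexI[of _ \<sigma>] conjI) auto
  qed
  have "\<exists>\<tau>\<in>PF n. internal_edges \<tau> = \<epsilon> ` S \<and>
      (\<forall>\<gamma>\<in>S. \<forall>a\<in>\<epsilon> \<gamma>. \<forall>b\<in>\<epsilon> \<gamma>. before (flat \<tau>) a b \<longleftrightarrow> before (flat (\<theta> \<gamma>)) a b)"
  proof (rule compatible_forest[OF fin])
    show "\<theta> \<gamma> \<in> PF n \<and> \<epsilon> \<gamma> \<in> internal_edges (\<theta> \<gamma>)" if "\<gamma> \<in> S" for \<gamma> using \<theta>[OF that] by simp
  next
    fix \<gamma> \<delta> assume \<gamma>: "\<gamma> \<in> S" and \<delta>: "\<delta> \<in> S" and ne: "\<gamma> \<noteq> \<delta>"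
    obtain \<sigma> where "\<sigma> \<in> PF n" "\<epsilon> \<gamma> \<in> internal_edges \<sigma>" "\<epsilon> \<delta> \<in> internal_edges \<sigma>" "\<epsilon> \<gamma> \<noteq> \<epsilon> \<delta>"
      using common[OF \<gamma> \<delta> ne] by (elim bexE conjE) (rule that)
    then show "\<epsilon> \<gamma> \<noteq> \<epsilon> \<delta> \<and> (\<epsilon> \<gamma> \<subseteq> \<epsilon> \<delta> \<or> \<epsilon> \<delta> \<subseteq> \<epsilon> \<gamma> \<or> \<epsilon> \<gamma> \<inter> \<epsilon> \<delta> = {})"
      using internal_edges_laminar[of \<sigma> "\<epsilon> \<gamma>" "\<epsilon> \<delta>"] by (simp add: PF_iff)
  next
    fix \<gamma> \<delta> a b k assume \<gamma>: "\<gamma> \<in> S" and \<delta>: "\<delta> \<in> S" and sub: "\<epsilon> \<gamma> \<subset> \<epsilon> \<delta>" and ab: "a \<in> \<epsilon> \<gamma>" "b \<in> \<epsilon> \<gamma>"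
    have "\<gamma> \<noteq> \<delta>" using sub by auto
    from common[OF \<gamma> \<delta> this] obtain \<sigma> where \<sigma>: "\<sigma> \<in> PF n" "\<epsilon> \<gamma> \<in> internal_edges \<sigma>"
      "\<forall>a\<in>\<epsilon> \<gamma>. \<forall>b\<in>\<epsilon> \<gamma>. before (flat (\<theta> \<gamma>)) a b \<longleftrightarrow> before (flat \<sigma>) a b"
      "\<forall>a\<in>\<epsilon> \<delta>. \<forall>b\<in>\<epsilon> \<delta>. before (flat (\<theta> \<delta>)) a b \<longleftrightarrow> before (flat \<sigma>) a b"
      by (elim bexE conjE) (rule that)
    have ab': "a \<in> \<epsilon> \<delta>" "b \<in> \<epsilon> \<delta>" using sub ab by auto
    show "before (flat (\<theta> \<gamma>)) a b \<longleftrightarrow> before (flat (\<theta> \<delta>)) a b"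
      using \<sigma>(3)[rule_format, OF ab] \<sigma>(4)[rule_format, OF ab'] by simp
    assume k: "k \<in> \<epsilon> \<delta> - \<epsilon> \<gamma>"
    have "before (flat \<sigma>) k a \<longleftrightarrow> before (flat \<sigma>) k b"
      using internal_edge_convex[OF _ _ \<sigma>(2) ab, of k] \<sigma>(1) k by (simp add: PF_iff)
    then show "before (flat (\<theta> \<delta>)) k a \<longleftrightarrow> before (flat (\<theta> \<delta>)) k b"
      using \<sigma>(4)[rule_format, of k a] \<sigma>(4)[rule_format, of k b] k ab' by simp
  qed
  then obtain \<tau> where \<tau>: "\<tau> \<in> PF n" "internal_edges \<tau> = \<epsilon> ` S"
    "\<forall>\<gamma>\<in>S. \<forall>a\<in>\<epsilon> \<gamma>. \<forall>b\<in>\<epsilon> \<gamma>. before (flat \<tau>) a b \<longleftrightarrow> before (flat (\<theta> \<gamma>)) a b"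
    by (elim bexE conjE) (rule that)
  have \<gamma>_eq: "edge (M_cx n) (\<tau>, s) (ones \<tau>) (\<epsilon> \<gamma>) = \<gamma>" if \<gamma>: "\<gamma> \<in> S" for \<gamma>
  proof -
    have "edge (M_cx n) (\<tau>, s) (ones \<tau>) (\<epsilon> \<gamma>) = edge (M_cx n) (\<theta> \<gamma>, s) (ones (\<theta> \<gamma>)) (\<epsilon> \<gamma>)"
      using edge_ones_eq_iff[OF \<tau>(1) _ s(1), of "\<theta> \<gamma>" "\<epsilon> \<gamma>" "\<epsilon> \<gamma>"] \<theta>[OF \<gamma>] \<tau>(2,3) \<gamma> by simp
    then show ?thesis using \<theta>[OF \<gamma>] by simp
  qed
  have "edge (M_cx n) (\<tau>, s) (ones \<tau>) ` (\<epsilon> ` S) = (\<lambda>\<gamma>. \<gamma>) ` S"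
    unfolding image_image by (rule image_cong[OF refl \<gamma>_eq])
  then have "edge (M_cx n) (\<tau>, s) (ones \<tau>) ` internal_edges \<tau> = S" by (simp add: \<tau>(2))
  moreover have "cube_corner (M_cx n) x (\<tau>, s) (ones \<tau>) (internal_edges \<tau>)"
  proof -
    have "M_chart n (\<tau>, s) (ones \<tau>) = x"
      unfolding x0(1) using \<tau>(1) s x0(2,3) ones_corner[of "internal_edges \<tau>"]
      by (intro chart_eq_if_posn_eq) (simp_all add: posn_ones)
    then show ?thesis using \<tau>(1) s(1) ones_corner[of "internal_edges \<tau>"] by (simp add: cube_corner_def)
  qed
  ultimately show "S \<in> link_simplices (M_cx n) x" unfolding link_simplices_def by blast
qed

lemma nonpositively_curved_M: "nonpositively_curved (M_cx n)"
  unfolding nonpositively_curved_def using link_simplicial_M link_flag_M by blast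

subsection \<open>Hyperplanes\<close>

lemma topspace_midcube_sum:
  "topspace (midcube_sum K) =
    (SIGMA m : (SIGMA i : cells K. coords K i). {x \<in> cube (coords K (fst m)). x (snd m) = 0})"
  by (auto simp: midcube_sum_def)

text \<open>Every midcube is open in the disjoint union, so the midcubes with property
  \<open>Q\<close> and those without it form complementary open saturated sets. Their images in the
  quotient are clopen, and a connected component lies in one of them.\<close>

lemma component_invariant:
  fixes Q :: "'i \<times> 'c \<Rightarrow> bool"
  assumes glue: "\<And>m x m' y. ((m, x), (m', y)) \<in> midcube_glue K \<Longrightarrow> Q m \<longleftrightarrow> Q m'"
    and C: "C \<in> connected_components_of (quotient_space (midcube_sum K) (midcube_glue K))"
    and m: "(m, x) \<in> \<Union>C" and m': "(m', y) \<in> \<Union>C" and Q: "Q m"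
  shows "Q m'"
proof -
  let ?T = "midcube_sum K" and ?g = "midcube_glue K"
  let ?q = "gen_class ?T ?g"
  have inv: "Q (fst z) \<longleftrightarrow> Q (fst z')"
    if "z \<in> topspace ?T" "z' \<in> topspace ?T" "?q z = ?q z'" for z z'
  proof -
    have "(z, z') \<in> (?g \<union> ?g\<inverse>)\<^sup>*" using that(3) gen_class_eq_iff[OF that(1,2), of ?g] by simp
    then show ?thesis
    proof (rule rtrancl_invariant[where f = "\<lambda>z. Q (fst z)"])
      fix a b assume "(a, b) \<in> ?g"
      then show "Q (fst a) \<longleftrightarrow> Q (fst b)" using glue[of "fst a" "snd a" "fst b" "snd b"] by simp
    qed
  qed
  have op: "openin (quotient_space ?T ?g) (?q ` {z \<in> topspace ?T. R (fst z)})"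
    if R: "\<And>z z'. z \<in> topspace ?T \<Longrightarrow> z' \<in> topspace ?T \<Longrightarrow> ?q z = ?q z' \<Longrightarrow> R (fst z) \<Longrightarrow> R (fst z')"
    for R :: "'i \<times> 'c \<Rightarrow> bool"
  proof -
    let ?U = "{z \<in> topspace ?T. R (fst z)}"
    have "openin ?T ?U"
      unfolding midcube_sum_def openin_sum_topology
    proof (intro conjI ballI)
      let ?X = "\<lambda>(i, e). subtopology (cube_topology (coords K i)) {x. x e = 0}"
      show "{z \<in> topspace (sum_topology ?X (SIGMA i : cells K. coords K i)). R (fst z)} \<subseteq>
          Sigma (SIGMA i : cells K. coords K i) (topspace \<circ> ?X)" by auto
      fix k assume k: "k \<in> (SIGMA i : cells K. coords K i)"
      have "{x. (k, x) \<in> {z \<in> topspace (sum_topology ?X (SIGMA i : cells K. coords K i)). R (fst z)}} =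
          (if R k then topspace (?X k) else {})" using k by auto
      then show "openin (?X k) {x. (k, x) \<in> {z \<in> topspace (sum_topology ?X (SIGMA i : cells K. coords K i)). R (fst z)}}"
        by simp
    qed
    moreover have "\<Union>(?q ` ?U) = ?U"
    proof (subst Union_quotient_space)
      show "?q ` ?U \<subseteq> ?q ` topspace ?T" by auto
      show "{x \<in> topspace ?T. ?q x \<in> ?q ` ?U} = ?U"
      proof (intro equalityI subsetI)
        fix z assume "z \<in> {x \<in> topspace ?T. ?q x \<in> ?q ` ?U}"
        then obtain z' where z: "z \<in> topspace ?T" "z' \<in> ?U" "?q z = ?q z'" by auto
        then have "R (fst z)" using R[of z' z] by simp
        then show "z \<in> ?U" using z(1) by simp
      qed auto
    qed
    moreover have "?q ` ?U \<subseteq> topspace ?T // gen_equiv (topspace ?T) ?g"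
      unfolding quotient_eq_gen_class by auto
    ultimately show ?thesis unfolding openin_quotient_space by simp
  qed
  let ?A = "?q ` {z \<in> topspace ?T. Q (fst z)}" and ?B = "?q ` {z \<in> topspace ?T. \<not> Q (fst z)}"
  have A: "openin (quotient_space ?T ?g) ?A"
  proof (rule op)
    fix z z' assume "z \<in> topspace ?T" "z' \<in> topspace ?T" "?q z = ?q z'" "Q (fst z)"
    then show "Q (fst z')" using inv[of z z'] by simp
  qed
  have B: "openin (quotient_space ?T ?g) ?B"
  proof (rule op[of "\<lambda>m. \<not> Q m"])
    fix z z' assume "z \<in> topspace ?T" "z' \<in> topspace ?T" "?q z = ?q z'" "\<not> Q (fst z)"
    then show "\<not> Q (fst z')" using inv[of z z'] by simp
  qed
  have "topspace (quotient_space ?T ?g) - ?A = ?B"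
    unfolding topspace_quotient_space
  proof (intro equalityI subsetI)
    fix D assume "D \<in> ?B"
    then obtain z where z: "z \<in> topspace ?T" "\<not> Q (fst z)" "D = ?q z" by auto
    moreover have "D \<notin> ?A"
    proof
      assume "D \<in> ?A"
      then obtain z' where "z' \<in> topspace ?T" "Q (fst z')" "D = ?q z'" by auto
      then show False using inv[of z z'] z by simp
    qed
    ultimately show "D \<in> ?q ` topspace ?T - ?A" by simp
  qed auto
  then have "closedin (quotient_space ?T ?g) ?A"
    using A B unfolding closedin_def by (simp add: openin_subset)
  then have cases: "C \<subseteq> ?A \<or> disjnt C ?A"
    using connectedin_clopen_cases[OF connectedin_connected_components_of[OF C]] A by blast
  have mem: "z \<in> topspace ?T \<and> ?q z \<in> C" if z: "z \<in> \<Union>C" for z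
  proof -
    obtain D where D: "D \<in> C" "z \<in> D" using z by auto
    have "C \<subseteq> ?q ` topspace ?T"
      using connected_components_of_subset[OF C] topspace_quotient_space[of ?T ?g] by simp
    then obtain z' where z': "z' \<in> topspace ?T" "D = ?q z'" using D(1) by auto
    have "z \<in> topspace ?T" "(z', z) \<in> (?g \<union> ?g\<inverse>)\<^sup>*"
      using D(2) mem_gen_class[OF z'(1), of z ?g] z'(2) by auto
    then show ?thesis using gen_class_eq_iff[OF z'(1), of z ?g] D(1) z'(2) by simp
  qed
  have "?q (m, x) \<in> C \<inter> ?A" using mem[OF m] Q by auto
  then have "C \<subseteq> ?A" using cases by (auto simp: disjnt_iff)
  then have "?q (m', y) \<in> ?A" using mem[OF m'] by auto
  then obtain z where z: "z \<in> topspace ?T" "Q (fst z)" "?q (m', y) = ?q z" by auto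
  then show ?thesis using inv[of "(m', y)" z] mem[OF m'] by simp
qed

text \<open>At the midpoint of a 1-cube the position is 0 at its label and of absolute value 1
  elsewhere. A point of the midcube of \<open>e\<close> with this position must therefore be the
  midpoint of an edge of its own cube, with label \<open>e\<close>.\<close>

lemma edge_through_midpoint:
  assumes i: "i \<in> M_cells n" and j: "j \<in> M_cells n"
    and x: "x \<in> cube (labels i)" and e: "e \<in> labels i" and xe: "x e = 0"
    and v: "v \<in> corners (labels j)" and f: "f \<in> labels j"
    and eq: "M_chart n i x = edge (M_cx n) j v f 0"
  shows "\<exists>w\<in>corners (labels i). edge (M_cx n) j v f = edge (M_cx n) i w e"
proof -
  have "inv_pt n (i, x) = inv_pt n (j, v(f := 0))"
    using M_chart_eq_iff[OF i x j corner_update_cube[OF v f, of 0]] eq by (simp add: edge_midpoint)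
  then have inv: "posn i x = (posn j v)(f := 0)"
    "\<And>g a b. \<bar>posn i x g\<bar> < 1 \<Longrightarrow> a \<in> g \<Longrightarrow> b \<in> g \<Longrightarrow> a \<noteq> b \<Longrightarrow> ordn n i a b = ordn n j a b"
    unfolding inv_pt_eq_iff posn_update[OF f] by (simp, blast)
  have pe: "posn i x e = 0" using e xe by (simp add: posn_def)
  have ef: "e = f"
  proof (rule ccontr)
    assume "e \<noteq> f"
    then have "posn j v e = 0" using pe inv(1) by simp
    then show False using abs_posn_corner[OF v, of e] by simp
  qed
  \<comment> \<open>The sign is chosen so that \<open>w\<close> has the same position at
    \<open>e\<close> as the origin of the given 1-cube; otherwise the direction could be
    reversed.\<close>
  define w where "w = x(e := sg (snd i e) * posn j v e)"
  have "w \<in> corners (labels i)"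
  proof (rule corners_I)
    show "w \<in> extensional (labels i)"
      using cube_extensional[OF x] e by (auto simp: w_def extensional_def)
    fix T assume T: "T \<in> labels i"
    show "\<bar>w T\<bar> = 1"
    proof (cases "T = e")
      case True
      then show ?thesis using abs_posn_corner[OF v, of e] by (simp add: w_def abs_mult)
    next
      case False
      have "\<bar>posn i x T\<bar> = 1" using False ef inv(1) abs_posn_corner[OF v, of T] by simp
      then show ?thesis using False T by (simp add: w_def posn_def abs_mult)
    qed
  qed
  moreover have "edge (M_cx n) j v f = edge (M_cx n) i w e"
  proof -
    have "posn i w = posn j v"
      unfolding w_def posn_update[OF e] inv(1) using ef by auto
    moreover have "ordn n j a b = ordn n i a b" if "a \<in> f" "b \<in> f" "a \<noteq> b" for a b
      using inv(2)[of e a b] pe ef that by simp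
    ultimately show ?thesis
      using edge_eq_iff[OF j i v \<open>w \<in> corners _\<close> f e] ef by simp
  qed
  ultimately show ?thesis by blast
qed

lemma hyperplanes_E:
  assumes "H \<in> hyperplanes K"
  obtains C where "C \<in> connected_components_of (quotient_space (midcube_sum K) (midcube_glue K))"
    "H = {chart K i x | i e x. ((i, e), x) \<in> \<Union>C}"
  using assms unfolding hyperplanes_def by (elim CollectE exE conjE) (rule that)

lemma midcube_mem:
  assumes C: "C \<in> connected_components_of (quotient_space (midcube_sum (M_cx n)) (midcube_glue (M_cx n)))"
    and m: "((i, e), x) \<in> \<Union>C"
  shows "i \<in> M_cells n" "e \<in> labels i" "x \<in> cube (labels i)" "x e = 0"
proof -
  let ?T = "midcube_sum (M_cx n)" and ?g = "midcube_glue (M_cx n)"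
  obtain D where D: "D \<in> C" "((i, e), x) \<in> D" using m by auto
  have "C \<subseteq> gen_class ?T ?g ` topspace ?T"
    using connected_components_of_subset[OF C] topspace_quotient_space[of ?T ?g] by simp
  then obtain z' where z': "z' \<in> topspace ?T" "D = gen_class ?T ?g z'" using D(1) by auto
  have "((i, e), x) \<in> topspace ?T"
    using D(2) mem_gen_class[OF z'(1), of "((i, e), x)" ?g] z'(2) by simp
  then show "i \<in> M_cells n" "e \<in> labels i" "x \<in> cube (labels i)" "x e = 0"
    unfolding topspace_midcube_sum by auto
qed

text \<open>By definition, duality only says that the midpoint lies in the point set
  \<open>H\<close>. This produces a midcube of the component \<open>C\<close> to which the 1-cube is
  dual inside one cube.\<close>

lemma dual_edge:
  assumes C: "C \<in> connected_components_of (quotient_space (midcube_sum (M_cx n)) (midcube_glue (M_cx n)))"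
    and H: "H = {chart (M_cx n) i x | i e x. ((i, e), x) \<in> \<Union>C}"
    and dual: "dual (M_cx n) \<gamma> H"
  obtains i e x w where "((i, e), x) \<in> \<Union>C" "i \<in> M_cells n" "e \<in> labels i"
    "w \<in> corners (labels i)" "\<gamma> = edge (M_cx n) i w e"
proof -
  have \<gamma>: "\<gamma> \<in> edges (M_cx n)" "\<gamma> 0 \<in> H" using dual by (auto simp: dual_def)
  obtain j v f where j: "j \<in> M_cells n" "v \<in> corners (labels j)"
    "f \<in> labels j" "\<gamma> = edge (M_cx n) j v f" using edges_M_E[OF \<gamma>(1)] .
  obtain i e x where m: "\<gamma> 0 = M_chart n i x" "((i, e), x) \<in> \<Union>C"
    using \<gamma>(2) unfolding H M_cx_simps by (elim CollectE exE conjE) (rule that)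
  note mm = midcube_mem[OF C m(2)]
  have "M_chart n i x = edge (M_cx n) j v f 0" using m(1) j(4) by simp
  from edge_through_midpoint[OF mm(1) j(1) mm(3,2,4) j(2,3) this]
  obtain w where "w \<in> corners (labels i)" "edge (M_cx n) j v f = edge (M_cx n) i w e"
    by (elim bexE) (rule that)
  then show thesis using that[OF m(2) mm(1,2)] j(4) by simp
qed

text \<open>The glued face meets the midcube, so \<open>e\<close> is free in it and it contains the
  midpoint of a 1-cube in direction \<open>e\<close>, which the gluing maps to the other midcube.
  Invariance under midcube gluings thus reduces to invariance under equality of dual
  1-cubes.\<close>

lemma midcube_glue_edge:
  assumes "(((i, e), x), ((j, f), y)) \<in> midcube_glue (M_cx n)"
  obtains v w where "i \<in> M_cells n" "j \<in> M_cells n"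
    "e \<in> labels i" "f \<in> labels j"
    "v \<in> corners (labels i)" "w \<in> corners (labels j)"
    "edge (M_cx n) i v e = edge (M_cx n) j w f"
proof -
  obtain h A B where h: "gluing (M_cx n) i A j B h" "e \<in> labels i" "f \<in> labels j"
    "x \<in> A" "x e = 0" "h ` {z \<in> A. z e = 0} = {z \<in> B. z f = 0}"
    using assms unfolding midcube_glue_def by auto
  have g: "i \<in> M_cells n" "j \<in> M_cells n" "is_face (labels i) A"
    "is_face (labels j) B" "\<forall>x\<in>A. M_chart n j (h x) = M_chart n i x"
    using h(1) by (simp_all add: gluing_def)
  obtain v F where v: "v \<in> corners (labels i)" "F \<subseteq> labels i"
    "A = face (labels i) v F" using g(3) unfolding is_face_def by (elim bexE exE conjE) (rule that)
  have "e \<in> F"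
  proof (rule ccontr)
    assume "e \<notin> F"
    then have "x e = v e" using h(2,4) v(3) by (simp add: face_def)
    then show False using corners_abs[OF v(1) h(2)] h(5) by simp
  qed
  then have z: "v(e := 0) \<in> {z \<in> A. z e = 0}"
    using corner_update_cube[OF v(1) h(2), of 0] v(3) by (simp add: face_def)
  then have hz: "h (v(e := 0)) \<in> {z \<in> B. z f = 0}" unfolding h(6)[symmetric] by (rule imageI)
  have "B \<subseteq> cube (labels j)"
    using g(4) face_subset unfolding is_face_def by blast
  then have hc: "h (v(e := 0)) \<in> cube (labels j)" "h (v(e := 0)) f = 0" using hz by auto
  have "M_chart n j (h (v(e := 0))) = edge (M_cx n) i v e 0" using g(5) z by (simp add: edge_midpoint)
  from edge_through_midpoint[OF g(2,1) hc(1) h(3) hc(2) v(1) h(2) this]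
  obtain w where "w \<in> corners (labels j)" "edge (M_cx n) i v e = edge (M_cx n) j w f"
    by (elim bexE) (rule that)
  then show thesis using that[OF g(1,2) h(2,3) v(1)] by simp
qed

text \<open>The negation of the alternative in \<open>internal_edges_laminar\<close>.\<close>

definition crosses :: "nat set \<Rightarrow> nat set \<Rightarrow> bool" where
  "crosses T e \<longleftrightarrow> \<not> T \<subseteq> e \<and> \<not> e \<subseteq> T \<and> T \<inter> e \<noteq> {}"

text \<open>The data of the midcube \<open>(i, e)\<close> that are constant on hyperplanes: along a hyperplane dual to edges
  labelled \<open>e\<close> one only crosses edges \<open>T\<close> that form a square corner with \<open>e\<close>, so \<open>T\<close> is nested with or disjoint from \<open>e\<close>.\<close>

definition midcube_data ::
  "nat \<Rightarrow> M_index \<Rightarrow> nat set \<Rightarrow> nat set \<times> (nat \<Rightarrow> nat \<Rightarrow> bit) \<times> (nat set \<Rightarrow> bit)" where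
  "midcube_data n i e = (e, \<lambda>a b. if a \<in> e \<and> b \<in> e \<and> a \<noteq> b then ordn n i a b else 0,
     \<lambda>T. if crosses T e then snd i T else 0)"

lemma midcube_data_eqD:
  assumes "midcube_data n i e = midcube_data n j f"
  shows "e = f" "a \<in> e \<Longrightarrow> b \<in> e \<Longrightarrow> a \<noteq> b \<Longrightarrow> ordn n i a b = ordn n j a b"
    "crosses T e \<Longrightarrow> snd i T = snd j T"
proof -
  show ef: "e = f" using assms by (simp add: midcube_data_def)
  have "fst (snd (midcube_data n i e)) a b = fst (snd (midcube_data n j f)) a b"
    "snd (snd (midcube_data n i e)) T = snd (snd (midcube_data n j f)) T" using assms by simp_all
  then show "a \<in> e \<Longrightarrow> b \<in> e \<Longrightarrow> a \<noteq> b \<Longrightarrow> ordn n i a b = ordn n j a b"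
    "crosses T e \<Longrightarrow> snd i T = snd j T" using ef by (simp_all add: midcube_data_def)
qed

lemma crosses_not_internal:
  assumes "i \<in> M_cells n" "e \<in> labels i" "crosses T e"
  shows "T \<notin> labels i"
proof
  assume "T \<in> labels i"
  moreover have "branching (fst i)" "distinct (flat (fst i))" using assms(1) by (auto simp: PF_iff)
  ultimately show False
    using internal_edges_laminar[of "fst i" T e] assms(2,3) by (auto simp: crosses_def)
qed

text \<open>A label crossing \<open>e\<close> is an edge of neither forest, so the position of the
  origin there is the sign of its bit, and equal positions give equal bits.\<close>

lemma midcube_data_edge:
  assumes ij: "i \<in> M_cells n" "j \<in> M_cells n"
    and ef: "e \<in> labels i" "f \<in> labels j"
    and vw: "v \<in> corners (labels i)" "w \<in> corners (labels j)"
    and eq: "edge (M_cx n) i v e = edge (M_cx n) j w f"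
  shows "midcube_data n i e = midcube_data n j f"
proof -
  have d: "e = f" "posn i v = posn j w" "\<forall>a\<in>e. \<forall>b\<in>e. a \<noteq> b \<longrightarrow> ordn n i a b = ordn n j a b"
    using edge_eq_iff[OF ij vw ef] eq by simp_all
  have "snd i T = snd j T" if T: "crosses T e" for T
  proof -
    have "T \<notin> labels i" "T \<notin> labels j"
      using crosses_not_internal[OF ij(1) ef(1) T] crosses_not_internal[OF ij(2) ef(2)] T d(1) by auto
    then have "sg (snd i T) = sg (snd j T)" using fun_cong[OF d(2), of T] by (simp add: posn_def)
    then show ?thesis by (simp add: sg_inject)
  qed
  then show ?thesis using d(1,3) by (auto simp: midcube_data_def fun_eq_iff)
qed

lemma dual_data:
  assumes H: "H \<in> hyperplanes (M_cx n)"
    and \<gamma>: "dual (M_cx n) (edge (M_cx n) i v e) H" and \<delta>: "dual (M_cx n) (edge (M_cx n) j w f) H"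
    and ij: "i \<in> M_cells n" "j \<in> M_cells n"
    and ef: "e \<in> labels i" "f \<in> labels j"
    and vw: "v \<in> corners (labels i)" "w \<in> corners (labels j)"
  shows "midcube_data n i e = midcube_data n j f"
proof -
  obtain C where C: "C \<in> connected_components_of (quotient_space (midcube_sum (M_cx n)) (midcube_glue (M_cx n)))"
    "H = {chart (M_cx n) i x | i e x. ((i, e), x) \<in> \<Union>C}" using hyperplanes_E[OF H] .
  obtain i' e' x v' where i': "((i', e'), x) \<in> \<Union>C" "i' \<in> M_cells n" "e' \<in> labels i'"
    "v' \<in> corners (labels i')" "edge (M_cx n) i v e = edge (M_cx n) i' v' e'"
    using dual_edge[OF C \<gamma>] .
  obtain j' f' y w' where j': "((j', f'), y) \<in> \<Union>C" "j' \<in> M_cells n" "f' \<in> labels j'"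
    "w' \<in> corners (labels j')" "edge (M_cx n) j w f = edge (M_cx n) j' w' f'"
    using dual_edge[OF C \<delta>] .
  let ?Q = "\<lambda>m. midcube_data n (fst m) (snd m) = midcube_data n i' e'"
  have "?Q (j', f')"
  proof (rule component_invariant[OF _ C(1) i'(1) j'(1)])
    fix m x m' y assume "((m, x), (m', y)) \<in> midcube_glue (M_cx n)"
    then have "(((fst m, snd m), x), ((fst m', snd m'), y)) \<in> midcube_glue (M_cx n)" by simp
    then obtain v w where k: "fst m \<in> M_cells n" "fst m' \<in> M_cells n"
      "snd m \<in> labels (fst m)" "snd m' \<in> labels (fst m')"
      "v \<in> corners (labels (fst m))" "w \<in> corners (labels (fst m'))"
      "edge (M_cx n) (fst m) v (snd m) = edge (M_cx n) (fst m') w (snd m')"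
      by (rule midcube_glue_edge)
    then show "?Q m \<longleftrightarrow> ?Q m'" using midcube_data_edge[OF k] by simp
  qed simp
  then have "midcube_data n j' f' = midcube_data n i' e'" by simp
  moreover have "midcube_data n i e = midcube_data n i' e'"
    by (rule midcube_data_edge[OF ij(1) i'(2) ef(1) i'(3) vw(1) i'(4,5)])
  moreover have "midcube_data n j f = midcube_data n j' f'"
    by (rule midcube_data_edge[OF ij(2) j'(2) ef(2) j'(3) vw(2) j'(4,5)])
  ultimately show ?thesis by simp
qed

section \<open>Intersection and osculation\<close>

lemma not_self_intersect:
  assumes H: "H \<in> hyperplanes (M_cx n)"
  shows "\<not> intersect (M_cx n) H H"
proof
  assume "intersect (M_cx n) H H"
  then obtain \<gamma> \<delta> where d: "dual (M_cx n) \<gamma> H" "dual (M_cx n) \<delta> H" "square_corner (M_cx n) \<gamma> \<delta>"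
    unfolding intersect_def by (elim exE conjE) (rule that)
  obtain i v e f where i: "i \<in> M_cells n" "v \<in> corners (labels i)"
    "e \<in> labels i" "f \<in> labels i" "e \<noteq> f"
    "\<gamma> = edge (M_cx n) i v e" "\<delta> = edge (M_cx n) i v f"
    using d(3) unfolding square_corner_def M_cx_simps by (elim exE conjE) (rule that)
  have "midcube_data n i e = midcube_data n i f"
    by (rule dual_data[OF H d(1)[unfolded i(6)] d(2)[unfolded i(7)] i(1,1,3,4,2,2)])
  then show False using midcube_data_eqD(1) i(5) by blast
qed

text \<open>A common origin gives equal positions, and a common hyperplane gives equal labels and
  twisted orders; by \<open>edge_eq_iff\<close> the two directed 1-cubes coincide.\<close>

lemma not_self_osculate:
  assumes H: "H \<in> hyperplanes (M_cx n)"
  shows "\<not> osculate (M_cx n) H H"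
proof
  assume "osculate (M_cx n) H H"
  then obtain \<gamma> \<delta> where d: "dual (M_cx n) \<gamma> H" "dual (M_cx n) \<delta> H" "\<gamma> \<noteq> \<delta>" "origin \<gamma> = origin \<delta>"
    unfolding osculate_def by (elim exE conjE) (rule that)
  have "\<gamma> \<in> edges (M_cx n)" "\<delta> \<in> edges (M_cx n)" using d(1,2) by (auto simp: dual_def)
  from edges_M_E[OF this(1)] obtain i v e where i: "i \<in> M_cells n" "v \<in> corners (labels i)"
    "e \<in> labels i" "\<gamma> = edge (M_cx n) i v e" .
  from edges_M_E[OF \<open>\<delta> \<in> edges (M_cx n)\<close>] obtain j w f where j: "j \<in> M_cells n"
    "w \<in> corners (labels j)" "f \<in> labels j" "\<delta> = edge (M_cx n) j w f" .
  have data: "midcube_data n i e = midcube_data n j f"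
    by (rule dual_data[OF H d(1)[unfolded i(4)] d(2)[unfolded j(4)] i(1) j(1) i(3) j(3) i(2) j(2)])
  have "M_chart n i v = M_chart n j w" using d(4) i(4) j(4) by (simp add: origin_edge)
  then have "posn i v = posn j w" by (rule posn_eq_if_chart_eq[OF i(1) j(1) i(2) j(2)])
  then have "edge (M_cx n) i v e = edge (M_cx n) j w f"
    using edge_eq_iff[OF i(1) j(1) i(2) j(2) i(3) j(3)] midcube_data_eqD(1,2)[OF data] by simp
  then show False using d(3) i(4) j(4) by simp
qed

text \<open>The twisted orders of \<open>k, a\<close> and of \<open>k, b\<close> are known to agree
  with those at the index \<open>i\<close>. Passing to actual orders introduces sums of bit changes
  over the \<open>T\<close> containing \<open>k, a\<close> and over those containing
  \<open>k, b\<close>. The two sums differ only in labels crossing \<open>e\<close>, whose bits have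
  not changed, so the interval property at \<open>i\<close> carries over to
  \<open>\<tau>\<close>.\<close>

lemma convex_transfer:
  assumes i: "i \<in> M_cells n" "e \<in> labels i"
    and ordn: "\<And>a b. a \<in> f \<Longrightarrow> b \<in> f \<Longrightarrow> a \<noteq> b \<Longrightarrow> ordn n i a b = ordn n (\<tau>, s) a b"
    and cross: "\<And>T. crosses T e \<Longrightarrow> snd i T = s T"
    and sub: "e \<subseteq> f" and a: "a \<in> e" and b: "b \<in> e" and k: "k \<in> f - e"
  shows "before (flat \<tau>) k a \<longleftrightarrow> before (flat \<tau>) k b"
proof -
  define S where "S x = {T \<in> Lsets n. k \<in> T \<and> x \<in> T}" for x
  have sum: "(\<Sum>T\<in>S x. snd i T + s T) = (\<Sum>T\<in>S a \<inter> S b. snd i T + s T)" if x: "x \<in> {a, b}" for x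
  proof (rule sum.mono_neutral_right)
    show "finite (S x)" by (simp add: S_def)
    show "S a \<inter> S b \<subseteq> S x" using x by auto
    show "\<forall>T\<in>S x - S a \<inter> S b. snd i T + s T = 0"
    proof
      fix T assume T: "T \<in> S x - S a \<inter> S b"
      \<comment> \<open>Such a \<open>T\<close> contains \<open>k\<close>, which is outside
        \<open>e\<close>, and exactly one of \<open>a\<close> and \<open>b\<close>, which are in
        \<open>e\<close>.\<close>
      have "crosses T e"
        unfolding crosses_def using T x a b k by (auto simp: S_def)
      then have "snd i T = s T" by (rule cross)
      then show "snd i T + s T = 0" by (cases "s T") simp_all
    qed
  qed
  have conv: "before (flat (fst i)) k a \<longleftrightarrow> before (flat (fst i)) k b"
    using internal_edge_convex[OF _ _ i(2) a b, of k] i(1) k by (auto simp: PF_iff)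
  have ord: "of_bool (before (flat \<tau>) k x) =
      of_bool (before (flat (fst i)) k x) + (\<Sum>T\<in>S a \<inter> S b. snd i T + s T)" if x: "x \<in> {a, b}" for x
  proof -
    have "x \<in> f" "k \<in> f" "k \<noteq> x" using x a b k sub by auto
    then have "ordn n i k x = ordn n (\<tau>, s) k x" using ordn by blast
    then have "of_bool (before (flat (fst i)) k x) + (\<Sum>T\<in>S x. snd i T) =
        of_bool (before (flat \<tau>) k x) + (\<Sum>T\<in>S x. s T)"
      by (simp only: ordn_def fst_conv snd_conv S_def)
    then have "of_bool (before (flat \<tau>) k x) =
        of_bool (before (flat (fst i)) k x) + ((\<Sum>T\<in>S x. snd i T) + (\<Sum>T\<in>S x. s T))"
      by (cases "\<Sum>T\<in>S x. snd i T"; cases "\<Sum>T\<in>S x. s T") auto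
    then show ?thesis unfolding sum.distrib[symmetric] sum[OF x] .
  qed
  have "of_bool (before (flat \<tau>) k a) = (of_bool (before (flat \<tau>) k b) :: bit)"
    using ord[of a] ord[of b] conv by simp
  then show ?thesis by (cases "before (flat \<tau>) k a"; cases "before (flat \<tau>) k b") simp_all
qed

text \<open>The data of both hyperplanes are compared between the vertex of the square and the other
  common vertex \<open>s\<close>. Laminarity is seen at the square; the orders agree on common
  leaves because both come from \<open>ordn n i\<close>; the interval condition is moved by
  \<open>convex_transfer\<close>, with the larger label supplying the orders and the smaller one the
  unchanged bits. So one forest contains both 1-cubes, and they span a square at
  \<open>s\<close>.\<close>

lemma not_inter_osculate:
  assumes H1: "H\<^sub>1 \<in> hyperplanes (M_cx n)" and H2: "H\<^sub>2 \<in> hyperplanes (M_cx n)"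
    and int: "intersect (M_cx n) H\<^sub>1 H\<^sub>2"
  shows "\<not> osculate (M_cx n) H\<^sub>1 H\<^sub>2"
proof
  assume "osculate (M_cx n) H\<^sub>1 H\<^sub>2"
  then obtain \<gamma> \<delta> where d: "dual (M_cx n) \<gamma> H\<^sub>1" "dual (M_cx n) \<delta> H\<^sub>2" "origin \<gamma> = origin \<delta>"
      "\<not> square_corner (M_cx n) \<gamma> \<delta>"
    unfolding osculate_def by (elim exE conjE) (rule that)
  obtain \<gamma>' \<delta>' where d': "dual (M_cx n) \<gamma>' H\<^sub>1" "dual (M_cx n) \<delta>' H\<^sub>2" "square_corner (M_cx n) \<gamma>' \<delta>'"
    using int unfolding intersect_def by (elim exE conjE) (rule that)
  obtain i u e f where i: "i \<in> M_cells n" "u \<in> corners (labels i)"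
    "e \<in> labels i" "f \<in> labels i" "e \<noteq> f"
    "\<gamma>' = edge (M_cx n) i u e" "\<delta>' = edge (M_cx n) i u f"
    using d'(3) unfolding square_corner_def M_cx_simps by (elim exE conjE) (rule that)
  have "\<gamma> \<in> edges (M_cx n)" "\<delta> \<in> edges (M_cx n)" using d(1,2) by (auto simp: dual_def)
  from edges_M_E[OF this(1)] obtain j v g where j: "j \<in> M_cells n" "v \<in> corners (labels j)"
    "g \<in> labels j" "\<gamma> = edge (M_cx n) j v g" .
  from edges_M_E[OF \<open>\<delta> \<in> edges (M_cx n)\<close>] obtain k w h where k: "k \<in> M_cells n"
    "w \<in> corners (labels k)" "h \<in> labels k" "\<delta> = edge (M_cx n) k w h" .
  obtain \<tau> s where \<tau>: "\<tau> \<in> PF n" "s \<in> Z2L n" "internal_edges \<tau> = labels j"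
    "posn j v = (\<lambda>T. sg (s T))"
    "\<forall>e\<in>labels j. edge (M_cx n) j v e = edge (M_cx n) (\<tau>, s) (ones \<tau>) e"
    using normalize_corner[OF j(1,2)] .
  obtain \<sigma> r where \<sigma>: "\<sigma> \<in> PF n" "r \<in> Z2L n" "internal_edges \<sigma> = labels k"
    "posn k w = (\<lambda>T. sg (r T))"
    "\<forall>e\<in>labels k. edge (M_cx n) k w e = edge (M_cx n) (\<sigma>, r) (ones \<sigma>) e"
    using normalize_corner[OF k(1,2)] .
  have "M_chart n j v = M_chart n k w" using d(3) j(4) k(4) by (simp add: origin_edge)
  then have "posn j v = posn k w" by (rule posn_eq_if_chart_eq[OF j(1) k(1) j(2) k(2)])
  then have rs: "r = s" using \<tau>(4) \<sigma>(4) by (intro sg_fun_inject) simp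
  have \<gamma>: "\<gamma> = edge (M_cx n) (\<tau>, s) (ones \<tau>) g" and \<delta>: "\<delta> = edge (M_cx n) (\<sigma>, s) (ones \<sigma>) h"
    using j(3,4) k(3,4) \<tau>(5) \<sigma>(5) rs by auto
  have c: "(\<tau>, s) \<in> M_cells n" "(\<sigma>, s) \<in> M_cells n" "g \<in> labels (\<tau>, s)"
    "h \<in> labels (\<sigma>, s)" "ones \<tau> \<in> corners (labels (\<tau>, s))"
    "ones \<sigma> \<in> corners (labels (\<sigma>, s))"
    using \<tau>(1-3) \<sigma>(1-3) j(3) k(3) ones_corner[of "internal_edges \<tau>"] ones_corner[of "internal_edges \<sigma>"]
    by simp_all
  have D1: "midcube_data n i e = midcube_data n (\<tau>, s) g"
    by (rule dual_data[OF H1 d'(1)[unfolded i(6)] d(1)[unfolded \<gamma>] i(1) c(1) i(3) c(3) i(2) c(5)])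
  have D2: "midcube_data n i f = midcube_data n (\<sigma>, s) h"
    by (rule dual_data[OF H2 d'(2)[unfolded i(7)] d(2)[unfolded \<delta>] i(1) c(2) i(4) c(4) i(2) c(6)])
  have g: "g = e" and h: "h = f" using midcube_data_eqD(1)[OF D1] midcube_data_eqD(1)[OF D2] by auto
  have o1: "ordn n i a b = ordn n (\<tau>, s) a b" if "a \<in> e" "b \<in> e" "a \<noteq> b" for a b
    using midcube_data_eqD(2)[OF D1 that] .
  have o2: "ordn n i a b = ordn n (\<sigma>, s) a b" if "a \<in> f" "b \<in> f" "a \<noteq> b" for a b
    using midcube_data_eqD(2)[OF D2 that] .
  have x1: "snd i T = s T" if "crosses T e" for T using midcube_data_eqD(3)[OF D1 that] by simp
  have x2: "snd i T = s T" if "crosses T f" for T using midcube_data_eqD(3)[OF D2 that] by simp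
  have same: "before (flat \<tau>) a b \<longleftrightarrow> before (flat \<sigma>) a b" if ab: "a \<in> e" "b \<in> e" "a \<in> f" "b \<in> f" for a b
  proof (cases "a = b")
    case True
    have "distinct (flat \<tau>)" "distinct (flat \<sigma>)" using \<tau>(1) \<sigma>(1) by (auto simp: PF_iff)
    then show ?thesis using True before_asym by metis
  next
    case False
    have "ordn n (\<tau>, s) a b = ordn n (\<sigma>, s) a b" using o1[OF ab(1,2) False] o2[OF ab(3,4) False] by simp
    then show ?thesis unfolding ordn_def fst_conv snd_conv add_right_cancel
      by (cases "before (flat \<tau>) a b"; cases "before (flat \<sigma>) a b") simp_all
  qed
  \<comment> \<open>The family of two 1-cubes is indexed by \<open>bool\<close>, with
    \<open>True\<close> for the first hyperplane; this treats both inclusions between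
    \<open>e\<close> and \<open>f\<close> at once.\<close>
  define \<theta> where "\<theta> x = (if x then \<tau> else \<sigma>)" for x
  define \<epsilon> where "\<epsilon> x = (if x then e else f)" for x
  have "\<exists>\<rho>\<in>PF n. internal_edges \<rho> = \<epsilon> ` UNIV \<and>
      (\<forall>x\<in>UNIV. \<forall>a\<in>\<epsilon> x. \<forall>b\<in>\<epsilon> x. before (flat \<rho>) a b \<longleftrightarrow> before (flat (\<theta> x)) a b)"
  proof (rule compatible_forest)
    show "\<theta> x \<in> PF n \<and> \<epsilon> x \<in> internal_edges (\<theta> x)" for x
      using \<tau>(1) \<sigma>(1) c(3,4) g h by (simp add: \<theta>_def \<epsilon>_def)
    have lam: "e \<subseteq> f \<or> f \<subseteq> e \<or> e \<inter> f = {}"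
      using internal_edges_laminar[OF _ _ i(3,4)] i(1) by (auto simp: PF_iff)
    show "\<epsilon> x \<noteq> \<epsilon> y \<and> (\<epsilon> x \<subseteq> \<epsilon> y \<or> \<epsilon> y \<subseteq> \<epsilon> x \<or> \<epsilon> x \<inter> \<epsilon> y = {})" if "x \<noteq> y" for x y
      using that lam i(5) by (cases x; cases y) (auto simp: \<epsilon>_def)
    fix x y a b l assume sub: "\<epsilon> x \<subset> \<epsilon> y" and ab: "a \<in> \<epsilon> x" "b \<in> \<epsilon> x"
    have "x \<noteq> y"
    proof
      assume "x = y"
      then show False using sub by simp
    qed
    then consider "x" "\<not> y" | "\<not> x" "y" by auto
    then show "before (flat (\<theta> x)) a b \<longleftrightarrow> before (flat (\<theta> y)) a b"
    proof cases
      case 1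
      then show ?thesis using same[of a b] sub ab by (auto simp: \<theta>_def \<epsilon>_def)
    next
      case 2
      then show ?thesis using same[of a b] sub ab by (auto simp: \<theta>_def \<epsilon>_def)
    qed
    assume l: "l \<in> \<epsilon> y - \<epsilon> x"
    from \<open>x \<noteq> y\<close> consider "x" "\<not> y" | "\<not> x" "y" by auto
    then show "before (flat (\<theta> y)) l a \<longleftrightarrow> before (flat (\<theta> y)) l b"
    proof cases
      case 1
      have "before (flat \<sigma>) l a \<longleftrightarrow> before (flat \<sigma>) l b"
        by (rule convex_transfer[OF i(1,3) o2 x1]) (use 1 sub ab l in \<open>auto simp: \<epsilon>_def\<close>)
      then show ?thesis using 1 by (simp add: \<theta>_def)
    next
      case 2
      have "before (flat \<tau>) l a \<longleftrightarrow> before (flat \<tau>) l b"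
        by (rule convex_transfer[OF i(1,4) o1 x2]) (use 2 sub ab l in \<open>auto simp: \<epsilon>_def\<close>)
      then show ?thesis using 2 by (simp add: \<theta>_def)
    qed
  qed simp
  then obtain \<rho> where \<rho>: "\<rho> \<in> PF n" "internal_edges \<rho> = \<epsilon> ` UNIV"
    "\<forall>x\<in>UNIV. \<forall>a\<in>\<epsilon> x. \<forall>b\<in>\<epsilon> x. before (flat \<rho>) a b \<longleftrightarrow> before (flat (\<theta> x)) a b"
    by (elim bexE conjE) (rule that)
  have \<rho>E: "e \<in> internal_edges \<rho>" "f \<in> internal_edges \<rho>"
    unfolding \<rho>(2) using rangeI[of \<epsilon> True] rangeI[of \<epsilon> False] by (simp_all add: \<epsilon>_def)
  have "\<gamma> = edge (M_cx n) (\<rho>, s) (ones \<rho>) e"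
    unfolding \<gamma> g using edge_ones_eq_iff[OF \<tau>(1) \<rho>(1) \<tau>(2) _ \<rho>E(1)] c(3) g
      bspec[OF \<rho>(3), of True] by (simp add: \<epsilon>_def \<theta>_def)
  moreover have "\<delta> = edge (M_cx n) (\<rho>, s) (ones \<rho>) f"
    unfolding \<delta> h using edge_ones_eq_iff[OF \<sigma>(1) \<rho>(1) \<tau>(2) _ \<rho>E(2)] c(4) h
      bspec[OF \<rho>(3), of False] by (simp add: \<epsilon>_def \<theta>_def)
  ultimately have "square_corner (M_cx n) \<gamma> \<delta>"
    unfolding square_corner_def M_cx_simps
    using \<rho>(1) \<tau>(2) \<rho>E i(5) ones_corner[of "internal_edges \<rho>"]
    by (intro exI[of _ "(\<rho>, s)"] exI[of _ "ones \<rho>"] exI[of _ e] exI[of _ f]) simp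
  then show False using d(4) by blast
qed

section \<open>Two-sidedness\<close>

lemma opposite_flip:
  assumes "i \<in> M_cells n" "v \<in> corners (labels i)" "e \<in> labels i"
    "f \<in> labels i" "e \<noteq> f"
  shows "(edge (M_cx n) i v e, edge (M_cx n) i (v(f := - v f)) e) \<in> opposite (M_cx n)"
  unfolding opposite_def M_cx_simps
  by (rule CollectI, intro exI conjI, rule refl) (rule assms)+

text \<open>The corners are joined by changing one coordinate other than \<open>e\<close> at a time;
  each change passes to the opposite 1-cube of a square.\<close>

lemma opposite_corners:
  assumes i: "i \<in> M_cells n" "e \<in> labels i"
    and "v \<in> corners (labels i)" "w \<in> corners (labels i)" "v e = w e"
  shows "(edge (M_cx n) i v e, edge (M_cx n) i w e) \<in> (opposite (M_cx n))\<^sup>*"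
  using assms(3-)
proof (induction "card {f \<in> labels i. v f \<noteq> w f}" arbitrary: v rule: less_induct)
  case less
  let ?D = "\<lambda>v. {f \<in> labels i. v f \<noteq> w f}"
  show ?case
  proof (cases "?D v = {}")
    case True
    have "v = w"
    proof
      fix T show "v T = w T"
        using True less.prems(1,2)
        by (cases "T \<in> labels i") (auto simp: corners_def PiE_def extensional_def)
    qed
    then show ?thesis by simp
  next
    case False
    then obtain f where f: "f \<in> labels i" "v f \<noteq> w f" by auto
    then have ne: "e \<noteq> f" using less.prems(3) by auto
    let ?v = "v(f := - v f)"
    have vf: "- v f = w f" using corners_D[OF less.prems(1) f(1)] corners_D[OF less.prems(2) f(1)] f(2) by auto
    have "?D ?v \<subset> ?D v" using f vf by auto
    then have "card (?D ?v) < card (?D v)" by (intro psubset_card_mono) auto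
    then have "(edge (M_cx n) i ?v e, edge (M_cx n) i w e) \<in> (opposite (M_cx n))\<^sup>*"
      using corners_flip[OF less.prems(1) f(1)] less.prems(2,3) ne by (intro less.hyps) auto
    then show ?thesis
      using opposite_flip[OF i(1) less.prems(1) i(2) f(1) ne] by (rule converse_rtrancl_into_rtrancl[rotated])
  qed
qed

text \<open>The orientation is detected by the sign of the position of the origin at the label
  \<open>e\<close>. Passing to an opposite 1-cube changes only another coordinate and so preserves
  this sign.\<close>

lemma opposite_orientation:
  assumes i: "i \<in> M_cells n" "e \<in> labels i" "v \<in> corners (labels i)"
    and "(edge (M_cx n) i v e, \<delta>) \<in> (opposite (M_cx n))\<^sup>*"
  shows "\<exists>j w. j \<in> M_cells n \<and> e \<in> labels j \<and> w \<in> corners (labels j) \<and>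
    \<delta> = edge (M_cx n) j w e \<and> posn j w e = posn i v e"
  using assms(4)
proof (induction rule: rtrancl_induct)
  case base
  then show ?case using i by blast
next
  case (step \<delta> \<delta>')
  obtain j w where j: "j \<in> M_cells n" "e \<in> labels j" "w \<in> corners (labels j)"
    "\<delta> = edge (M_cx n) j w e" "posn j w e = posn i v e"
    using step.IH by (elim exE conjE) (rule that)
  obtain k u e' f where k: "(\<delta>, \<delta>') = (edge (M_cx n) k u e', edge (M_cx n) k (u(f := - u f)) e')"
    "k \<in> M_cells n" "u \<in> corners (labels k)" "e' \<in> labels k"
    "f \<in> labels k" "e' \<noteq> f"
    using step.hyps(2) unfolding opposite_def M_cx_simps by (elim CollectE exE conjE) (rule that)
  have "edge (M_cx n) k u e' = edge (M_cx n) j w e" using k(1) j(4) by simp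
  then have eq: "e' = e" "posn k u = posn j w"
    using edge_eq_iff[OF k(2) j(1) k(3) j(3) k(4) j(2)] by simp_all
  have "posn k (u(f := - u f)) e = posn i v e"
    unfolding posn_update[OF k(5)] using k(6) eq j(5) by simp
  moreover have "\<delta>' = edge (M_cx n) k (u(f := - u f)) e" using k(1) eq(1) by simp
  ultimately show ?case using k(2,4) eq(1) corners_flip[OF k(3,5)] by blast
qed

lemma edge_flip_cases:
  assumes "i \<in> M_cells n" "e \<in> labels i"
    and "v \<in> corners (labels i)" "w \<in> corners (labels i)"
    and "(\<gamma>, edge (M_cx n) i v e) \<in> (opposite (M_cx n))\<^sup>*"
  shows "(\<gamma>, edge (M_cx n) i w e) \<in> (opposite (M_cx n))\<^sup>* \<or>
    (\<gamma>, rev_edge (edge (M_cx n) i w e)) \<in> (opposite (M_cx n))\<^sup>*"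
proof (cases "v e = w e")
  case True
  then show ?thesis using opposite_corners[OF assms(1-4)] assms(5) by (meson rtrancl_trans)
next
  case False
  then have "v e = (w(e := - w e)) e"
    using corners_D[OF assms(3,2)] corners_D[OF assms(4,2)] by auto
  from opposite_corners[OF assms(1-3) corners_flip[OF assms(4,2)] this] show ?thesis
    using assms(5) unfolding rev_edge_edge by (meson rtrancl_trans)
qed

text \<open>Some orientation is reached because the property of midcubes of being reached from
  \<open>\<gamma>\<close> is preserved by the gluings, hence holds on the whole component. Both
  cannot be reached because reversing a 1-cube changes the sign in
  \<open>opposite_orientation\<close>.\<close>

lemma two_sided_M:
  assumes H: "H \<in> hyperplanes (M_cx n)"
  shows "two_sided (M_cx n) H"
  unfolding two_sided_def
proof (intro allI impI)
  let ?R = "(opposite (M_cx n))\<^sup>*"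
  fix \<gamma> \<delta> assume \<gamma>: "dual (M_cx n) \<gamma> H" and \<delta>: "dual (M_cx n) \<delta> H"
  obtain C where C: "C \<in> connected_components_of (quotient_space (midcube_sum (M_cx n)) (midcube_glue (M_cx n)))"
    "H = {chart (M_cx n) i x | i e x. ((i, e), x) \<in> \<Union>C}" using hyperplanes_E[OF H] .
  obtain i e x v where i: "((i, e), x) \<in> \<Union>C" "i \<in> M_cells n" "e \<in> labels i"
    "v \<in> corners (labels i)" "\<gamma> = edge (M_cx n) i v e"
    using dual_edge[OF C \<gamma>] .
  obtain j f y w where j: "((j, f), y) \<in> \<Union>C" "j \<in> M_cells n" "f \<in> labels j"
    "w \<in> corners (labels j)" "\<delta> = edge (M_cx n) j w f"
    using dual_edge[OF C \<delta>] .
  \<comment> \<open>Some 1-cube dual to the midcube is reached from \<open>\<gamma>\<close>, in one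
    of its directions. By \<open>edge_flip_cases\<close> each dual 1-cube of the same cube is then
    reached up to reversal.\<close>
  define Q where "Q m \<longleftrightarrow> (\<exists>u\<in>corners (labels (fst m)).
    (\<gamma>, edge (M_cx n) (fst m) u (snd m)) \<in> ?R)" for m
  have move: "Q m'"
    if m: "Q m" "fst m \<in> M_cells n" "fst m' \<in> M_cells n" "snd m \<in> labels (fst m)"
      "snd m' \<in> labels (fst m')"
      "v \<in> corners (labels (fst m))" "w \<in> corners (labels (fst m'))"
      "edge (M_cx n) (fst m) v (snd m) = edge (M_cx n) (fst m') w (snd m')" for m m' v w
  proof -
    obtain u where u: "u \<in> corners (labels (fst m))"
      "(\<gamma>, edge (M_cx n) (fst m) u (snd m)) \<in> ?R" using m(1) unfolding Q_def by (elim bexE) (rule that)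
    have "(\<gamma>, edge (M_cx n) (fst m') w (snd m')) \<in> ?R \<or>
        (\<gamma>, rev_edge (edge (M_cx n) (fst m') w (snd m'))) \<in> ?R"
      using edge_flip_cases[OF m(2,4) u(1) m(6) u(2)] unfolding m(8) .
    then show ?thesis
      unfolding rev_edge_edge Q_def using m(7) corners_flip[OF m(7,5)] by blast
  qed
  have "Q (j, f)"
  proof (rule component_invariant[OF _ C(1) i(1) j(1)])
    show "Q (i, e)" unfolding Q_def using i(4,5) by (intro bexI[of _ v]) simp_all
    fix m x m' y assume "((m, x), (m', y)) \<in> midcube_glue (M_cx n)"
    then have "(((fst m, snd m), x), ((fst m', snd m'), y)) \<in> midcube_glue (M_cx n)" by simp
    then obtain v w where k: "fst m \<in> M_cells n" "fst m' \<in> M_cells n"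
      "snd m \<in> labels (fst m)" "snd m' \<in> labels (fst m')"
      "v \<in> corners (labels (fst m))" "w \<in> corners (labels (fst m'))"
      "edge (M_cx n) (fst m) v (snd m) = edge (M_cx n) (fst m') w (snd m')"
      by (rule midcube_glue_edge)
    show "Q m \<longleftrightarrow> Q m'"
    proof
      assume "Q m" then show "Q m'" by (rule move[OF _ k])
    next
      assume "Q m'" then show "Q m" by (rule move[OF _ k(2,1,4,3,6,5) k(7)[symmetric]])
    qed
  qed
  then obtain u where u: "u \<in> corners (labels j)" "(\<gamma>, edge (M_cx n) j u f) \<in> ?R"
    unfolding Q_def fst_conv snd_conv by (elim bexE) (rule that)
  have some: "(\<gamma>, \<delta>) \<in> ?R \<or> (\<gamma>, rev_edge \<delta>) \<in> ?R"
    using edge_flip_cases[OF j(2,3) u(1) j(4) u(2)] j(5) by simp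
  moreover have "\<not> ((\<gamma>, \<delta>) \<in> ?R \<and> (\<gamma>, rev_edge \<delta>) \<in> ?R)"
  proof
    assume both: "(\<gamma>, \<delta>) \<in> ?R \<and> (\<gamma>, rev_edge \<delta>) \<in> ?R"
    have 1: "(edge (M_cx n) i v e, \<delta>) \<in> ?R" and 2: "(edge (M_cx n) i v e, rev_edge \<delta>) \<in> ?R"
      using both i(5) by auto
    obtain k p where k: "k \<in> M_cells n" "e \<in> labels k" "p \<in> corners (labels k)"
      "\<delta> = edge (M_cx n) k p e" "posn k p e = posn i v e"
      using opposite_orientation[OF i(2,3,4) 1] by (elim exE conjE) (rule that)
    obtain l q where l: "l \<in> M_cells n" "e \<in> labels l" "q \<in> corners (labels l)"
      "rev_edge \<delta> = edge (M_cx n) l q e" "posn l q e = posn i v e"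
      using opposite_orientation[OF i(2,3,4) 2] by (elim exE conjE) (rule that)
    have "edge (M_cx n) k (p(e := - p e)) e = edge (M_cx n) l q e"
      using l(4) unfolding k(4) rev_edge_edge .
    then have "posn k (p(e := - p e)) = posn l q"
      using edge_eq_iff[OF k(1) l(1) corners_flip[OF k(3,2)] l(3) k(2) l(2)] by simp
    then have "posn k (p(e := - p e)) e = posn k p e" using k(5) l(5) by simp
    \<comment> \<open>Changing the sign of the coordinate \<open>e\<close> negates the position
      there, which would have to equal its own negative.\<close>
    then have "posn k p e = 0" unfolding posn_update[OF k(2)] using k(2) by (simp add: posn_def)
    then show False using abs_posn_corner[OF k(3), of e] by simp
  qed
  ultimately show "((\<gamma>, \<delta>) \<in> ?R) \<noteq> ((\<gamma>, rev_edge \<delta>) \<in> ?R)" by blast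
qed

lemma special_M: "special (M_cx n)"
  unfolding special_def
  using cube_complex_M nonpositively_curved_M two_sided_M not_self_intersect not_self_osculate
    not_inter_osculate by blast

theorem theorem1p1:
  fixes n :: nat
  assumes "n \<ge> 1"
  shows "cube_complex (Dhat n) \<and> special (M_cx n) \<and> compact_space (space_of (M_cx n)) \<and>
    (\<exists>p. finite_degree_covering_map (space_of (M_cx n)) (space_of (Dhat n)) p \<and>
       (\<forall>\<tau> \<in> PF n. \<forall>s \<in> Z2L n. \<forall>t \<in> pos_cube (internal_edges \<tau>).
          p (M_pt n \<tau> s t) = Dhat_pt n \<tau> t))"
proof (intro conjI exI[of _ "proj n"] ballI)
  fix \<tau> s t assume "\<tau> \<in> PF n" "s \<in> Z2L n" "t \<in> pos_cube (internal_edges \<tau>)"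
  then show "proj n (M_pt n \<tau> s t) = Dhat_pt n \<tau> t"
    using proj_class[of "((\<tau>, s), t)" n] by (simp add: M_pt_def topspace_M_sum)
qed (rule cube_complex_Dhat special_M compact_space_M finite_degree_covering_proj)+

end
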